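(* Let $\mu$ be an arbitrary probability measure on $\mathbb{C}$ and let $\{z_i\}_{i\ge 1}$ be i.i.d. complex-valued random variables distributed according to $\mu$. For each $n\in\mathbb{N}$ let $$P_n(z):=(z-z_1)\cdots(z-z_n).$$ Then for any $k\in\mathbb{N}$, $\mathcal{M}(P_n^{(k)})\to\mu$ in probability as $n\to\infty$.
   Context: For a non-constant polynomial $P$, $\mathcal{M}(P)$ denotes the uniform probability measure on the multiset of zeros of $P$, i.e. $\mathcal{M}(P)=\frac{1}{\deg P}\sum_{w}\delta_w$, the sum running over the complex zeros $w$ of $P$ counted with multiplicity. $P_n^{(k)}$ is the $k$-th derivative of $P_n$ (so $\mathcal{M}(P_n^{(k)})$ is considered for $n>k$). Convergence in probability of random probability measures to $\mu$ is with respect to the topology of weak convergence of probability measures on $\mathbb{C}$. *)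

theory Defs
  imports "HOL-Probability.Probability" "HOL-Computational_Algebra.Fundamental_Theorem_Algebra"
begin

text \<open>
  For non-constant \<open>P\<close> this is $(\deg P)^{-1} \sum_w \delta_w$, the sum running over the zeros
  of \<open>P\<close> with multiplicity (see \<open>emeasure_zero_measure\<close>). For constant \<open>P\<close>
  it is an unspecified probability measure.
\<close>

definition zero_measure :: "complex poly \<Rightarrow> complex measure" where
  "zero_measure P = distr (measure_pmf (pmf_of_multiset (proots P))) borel (\<lambda>w. w)"

lemma sum_mset_count:
  fixes f :: "'a \<Rightarrow> real"
  assumes "finite B" and "set_mset X \<subseteq> B"
  shows "(\<Sum>x\<in>#X. f x) = (\<Sum>x\<in>B. real (count X x) * f x)"
  using assms(2)
proof (induction X)
  case (add y X)
  have "(\<Sum>x\<in>B. real (count (add_mset y X) x) * f x)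
      = (\<Sum>x\<in>B. real (count X x) * f x + (if x = y then f x else 0))"
    by (intro sum.cong) (auto simp: algebra_simps)
  then show ?case
    using add assms(1) by (simp add: sum.distrib)
qed simp

lemma emeasure_zero_measure:
  assumes "degree P > 0" and "A \<in> sets borel"
  shows "emeasure (zero_measure P) A = ennreal ((\<Sum>w\<in>#proots P. indicator A w) / real (degree P))"
proof -
  have ne: "proots P \<noteq> {#}"
    using assms(1) size_proots_complex[of P] by auto
  have "emeasure (zero_measure P) A = ennreal (measure (pmf_of_multiset (proots P)) A)"
    using assms(2)
    by (simp add: zero_measure_def emeasure_distr measure_pmf.emeasure_eq_measure)
  also have "measure (pmf_of_multiset (proots P)) A
      = measure (pmf_of_multiset (proots P)) (A \<inter> set_mset (proots P))"
    using measure_Int_set_pmf[of "pmf_of_multiset (proots P)" A] ne by simp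
  also have "\<dots> = (\<Sum>w\<in>A \<inter> set_mset (proots P). real (count (proots P) w) / real (degree P))"
    using ne by (simp add: measure_measure_pmf_finite size_proots_complex)
  also have "\<dots> = (\<Sum>w\<in>set_mset (proots P). real (count (proots P) w) * indicator A w)
      / real (degree P)"
    unfolding sum_divide_distrib
    by (intro sum.mono_neutral_cong_left) (auto simp: indicator_def)
  also have "(\<Sum>w\<in>set_mset (proots P). real (count (proots P) w) * indicator A w)
      = (\<Sum>w\<in>#proots P. indicator A w)"
    by (rule sum_mset_count [symmetric]) simp_all
  finally show ?thesis .
qed

text \<open>
  The topology of weak convergence on the Borel probability measures: the coarsest one for
  which $\nu \mapsto \int f\,d\nu$ is continuous for every bounded continuous real \<open>f\<close>.
\<close>

definition weak_topology :: "'a::topological_space measure topology" where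
  "weak_topology = topology_generated_by
     {{\<nu> \<in> space (prob_algebra borel). (\<integral>x. f x \<partial>\<nu>) \<in> V} | (f :: 'a \<Rightarrow> real) V.
        continuous_on UNIV f \<and> bounded (range f) \<and> open V}"

lemma topspace_weak_topology:
  "topspace weak_topology = {\<nu>. prob_space \<nu> \<and> sets \<nu> = sets borel}"
proof -
  let ?S = "{{\<nu> \<in> space (prob_algebra borel). (\<integral>x. f x \<partial>\<nu>) \<in> V} | (f :: 'a \<Rightarrow> real) V.
        continuous_on UNIV f \<and> bounded (range f) \<and> open V}"
  have "space (prob_algebra borel) \<in> ?S"
    by (rule CollectI, rule exI[of _ "\<lambda>_. 0"], rule exI[of _ UNIV]) auto
  then have "\<Union>?S = space (prob_algebra borel)"
    by blast
  then show ?thesis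
    by (auto simp: weak_topology_def topology_generated_by_topspace space_prob_algebra)
qed

text \<open>
  Convergence in probability to a deterministic point \<open>c\<close> of a topological space.
  The outer measure equals the probability whenever the event \<open>X n \<notin> U\<close> is measurable;
  it is used because \<open>measure\<close> and \<open>emeasure\<close> are \<open>0\<close> on non-measurable sets.
\<close>

definition tendsto_in_probability ::
    "'w measure \<Rightarrow> 'b topology \<Rightarrow> (nat \<Rightarrow> 'w \<Rightarrow> 'b) \<Rightarrow> 'b \<Rightarrow> bool" where
  "tendsto_in_probability M T X c \<longleftrightarrow>
     c \<in> topspace T \<and>
     (\<forall>U. openin T U \<and> c \<in> U \<longrightarrow>
        (\<lambda>n. outer_measure_of M {\<omega> \<in> space M. X n \<omega> \<notin> U}) \<longlonglongrightarrow> 0)"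

end

theory Submission
  imports Defs "HOL-Complex_Analysis.Complex_Analysis" "HOL-Real_Asymp.Real_Asymp"
begin

text \<open>
  Write $Q = P_n^{(k)} / P_n$. Dividing out the zeros of $P_n^{(k)}$ and of $P_n$ in a disc around
  \<open>a\<close> by Blaschke factors, the maximum principle bounds the sum of $\log^+ (r / |w - a|)$ over
  the zeros \<open>w\<close> of $P_n^{(k)}$ by the same sum over the zeros of $P_n$, plus
  $\max \log |Q|$ over a circle around \<open>a\<close>, minus $\log |Q(a)|$. On a circle avoiding the
  zeros of $P_n$ by $1/n$ the maximum is $O(\log n)$, so an upper bound for the zeros of
  $P_n^{(k)}$ only needs $|Q(a)| \ge e^{-en}$ at the centre. Up to a factor, $Q(a)$ is the \<open>k\<close>-th elementary symmetric
  polynomial of the i.i.d. variables $1 / (a - z_i)$, and decoupling reduces its anticoncentration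
  to the spreading of a random walk. Averaging over \<open>a\<close> gives upper bounds for all nonnegative
  continuous functions of compact support, and a disc around infinity gives tightness; as the total
  mass is fixed, these one-sided bounds imply convergence.
\<close>

section \<open>Derivatives and elementary symmetric polynomials\<close>

text \<open>As \<open>\<mu>\<close> is arbitrary, \<open>ln (norm x)\<close> need not be integrable,
  so global logarithmic potentials may be infinite and cannot be compared in the limit. Hence the
  truncated kernel: it vanishes outside a disc, and its singularity is integrable for area, so that
  averaging over the centre asks nothing of \<open>\<mu>\<close>. The comparison needs two radii,
  because the circle must dodge the roots and its radius therefore depends on them; the loss is the
  ratio of the two kernel masses, which tends to \<open>1\<close> as the radii approach each other.
  Up to the averaging everything is deterministic and holds for every configuration of roots.
  Randomness enters through the weak law, the choice of the exterior disc, and the requirement that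
  the quotient is not exponentially small at most centres. That requirement is out of reach at atoms
  of \<open>\<mu>\<close>, where the quotient tends to have poles, but the atoms are countable and
  have no area. Near infinity a single well-chosen centre suffices, since only a count of far zeros
  is wanted there.\<close>

lemma poly_higher_pderiv_pcompose:
  fixes p :: "'a :: {comm_semiring_1,semiring_no_zero_divisors,semiring_char_0} poly"
  shows "(pderiv ^^ k) (p \<circ>\<^sub>p [:a, 1:]) = (pderiv ^^ k) p \<circ>\<^sub>p [:a, 1:]"
  by (induction k) (simp_all add: pderiv_pcompose pderiv_pCons)

lemma poly_higher_pderiv:
  fixes p :: "complex poly"
  shows "poly ((pderiv ^^ k) p) a = fact k * coeff (p \<circ>\<^sub>p [:a, 1:]) k"
proof -
  have "poly ((pderiv ^^ k) p) a = poly ((pderiv ^^ k) (p \<circ>\<^sub>p [:a, 1:])) 0"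
    by (simp add: poly_higher_pderiv_pcompose poly_pcompose)
  also have "\<dots> = fact k * coeff (p \<circ>\<^sub>p [:a, 1:]) k"
    by (simp add: poly_0_coeff_0 coeff_higher_pderiv pochhammer_fact)
  finally show ?thesis .
qed

text \<open>Expanding around \<open>a\<close>, each factor \<open>a - x i + X\<close> is
  \<open>(a - x i) * (1 + X / (a - x i))\<close>. The remaining coefficient is the
  \<open>k\<close>-th elementary symmetric polynomial of the \<open>1 / (a - x i)\<close>. Encoding
  it as a coefficient turns a splitting of the index set into a product of polynomials.\<close>

lemma poly_higher_pderiv_prod:
  fixes x :: "'i \<Rightarrow> complex"
  assumes "finite I" "\<And>i. i \<in> I \<Longrightarrow> a \<noteq> x i"
  shows "poly ((pderiv ^^ k) (\<Prod>i\<in>I. [:- x i, 1:])) a =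
    fact k * poly (\<Prod>i\<in>I. [:- x i, 1:]) a * coeff (\<Prod>i\<in>I. [:1, 1 / (a - x i):]) k"
proof -
  have "(\<Prod>i\<in>I. [:- x i, 1:]) \<circ>\<^sub>p [:a, 1:] = (\<Prod>i\<in>I. smult (a - x i) [:1, 1 / (a - x i):])"
    unfolding pcompose_prod by (rule prod.cong) (use assms in \<open>auto simp: pcompose_pCons\<close>)
  also have "\<dots> = smult (\<Prod>i\<in>I. a - x i) (\<Prod>i\<in>I. [:1, 1 / (a - x i):])"
    by (rule prod_smult)
  finally show ?thesis
    by (simp add: poly_higher_pderiv poly_prod)
qed

text \<open>A new factor changes the coefficient \<open>q_k\<close> to
  \<open>q_k + y i * q_(k-1)\<close>, and \<open>s^k + t * s^(k-1) \<le> (s + t)^k\<close> for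
  nonnegative \<open>s\<close> and \<open>t\<close>. The bound is cruder than the true one by
  \<open>k!\<close>, a constant after taking logarithms divided by \<open>n\<close>.\<close>

lemma norm_coeff_prod_le:
  fixes y :: "'i \<Rightarrow> 'a :: {real_normed_field}"
  assumes "finite I"
  shows "norm (coeff (\<Prod>i\<in>I. [:1, y i:]) k) \<le> (\<Sum>i\<in>I. norm (y i)) ^ k"
  using assms
proof (induction I arbitrary: k)
  case empty
  then show ?case by (cases k) auto
next
  case (insert i I)
  let ?q = "\<Prod>i\<in>I. [:1, y i:]" and ?s = "\<Sum>i\<in>I. norm (y i)"
  show ?case
  proof (cases k)
    case 0
    then show ?thesis
      using insert.hyps insert.IH[of 0] by (simp add: coeff_mult)
  next
    case (Suc j)
    have "coeff (\<Prod>i\<in>insert i I. [:1, y i:]) k = coeff ?q (Suc j) + y i * coeff ?q j"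
      using insert.hyps Suc by simp
    then have "norm (coeff (\<Prod>i\<in>insert i I. [:1, y i:]) k) \<le> ?s ^ Suc j + norm (y i) * ?s ^ j"
      using insert.IH[of "Suc j"] mult_left_mono[OF insert.IH[of j] norm_ge_zero[of "y i"]]
        norm_triangle_ineq[of "coeff ?q (Suc j)" "y i * coeff ?q j"]
      by (simp add: norm_mult)
    also have "\<dots> = ?s ^ j * (?s + norm (y i))"
      by (simp add: algebra_simps)
    also have "\<dots> \<le> (?s + norm (y i)) ^ j * (?s + norm (y i))"
      by (intro mult_right_mono power_mono) (auto simp: sum_nonneg)
    finally show ?thesis
      using insert.hyps Suc by (simp add: algebra_simps)
  qed
qed

lemma degree_prod_linear: "degree (\<Prod>i\<in>I. [:- x i, 1 :: complex:]) = card I"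
  by (simp add: degree_prod_sum_eq)

text \<open>The leading coefficient is a product of \<open>k\<close> integers between
  \<open>1\<close> and the degree, so it contributes only \<open>O(ln n)\<close> to the logarithmic
  comparison.\<close>

lemma lead_coeff_higher_pderiv_bounds:
  fixes p :: "complex poly"
  assumes "lead_coeff p = 1" "k \<le> degree p"
  shows "1 \<le> norm (lead_coeff ((pderiv ^^ k) p))"
    "norm (lead_coeff ((pderiv ^^ k) p)) \<le> real (degree p) ^ k"
proof -
  let ?m = "degree p - k"
  have "lead_coeff ((pderiv ^^ k) p) = pochhammer (of_nat (Suc ?m)) k"
    using assms by (simp add: coeff_higher_pderiv degree_higher_pderiv)
  also have "\<dots> = of_real (\<Prod>i<k. real (Suc ?m) + real i)"
    by (simp add: pochhammer_prod atLeast0LessThan)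
  finally have eq: "norm (lead_coeff ((pderiv ^^ k) p)) = (\<Prod>i<k. real (Suc ?m) + real i)"
    by (simp only: norm_of_real) (auto intro!: abs_of_nonneg prod_nonneg)
  show "1 \<le> norm (lead_coeff ((pderiv ^^ k) p))"
    unfolding eq by (rule prod_ge_1) auto
  have "(\<Prod>i<k. real (Suc ?m) + real i) \<le> (\<Prod>i<k. real (degree p))"
    by (rule prod_mono) (use assms in auto)
  then show "norm (lead_coeff ((pderiv ^^ k) p)) \<le> real (degree p) ^ k"
    unfolding eq by simp
qed

section \<open>Products over multisets\<close>

lemma prod_mset_pos:
  fixes f :: "'a \<Rightarrow> real"
  assumes "\<And>x. x \<in># A \<Longrightarrow> 0 < f x"
  shows "0 < (\<Prod>x\<in>#A. f x)"
  using assms by (induction A) auto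

lemma norm_prod_mset: "norm (\<Prod>x\<in>#A. f x) = (\<Prod>x\<in>#A. norm (f x :: 'a :: {real_normed_field}))"
  by (induction A) (auto simp: norm_mult)

lemma holomorphic_on_prod_mset:
  assumes "\<And>x. x \<in># A \<Longrightarrow> (\<lambda>v. f v x) holomorphic_on S"
  shows "(\<lambda>v. \<Prod>x\<in>#A. f v x) holomorphic_on S"
  using assms by (induction A) (auto intro!: holomorphic_intros)

lemma prod_mset_ne_0:
  fixes f :: "'a \<Rightarrow> 'b :: {comm_semiring_1, semiring_no_zero_divisors}"
  assumes "\<And>x. x \<in># A \<Longrightarrow> f x \<noteq> 0"
  shows "(\<Prod>x\<in>#A. f x) \<noteq> 0"
  using assms by (induction A) auto

section \<open>Comparison of logarithmic potentials\<close>

text \<open>A linear form \<open>g + b v\<close> with its zero in the disc is reflected across the circle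
  \<open>|v| = r\<close>; this multiplies it by an inverse Blaschke factor.\<close>
definition reflect_form :: "real \<Rightarrow> complex \<Rightarrow> complex \<Rightarrow> complex \<Rightarrow> complex" where
  "reflect_form r g b v =
     (if norm b * r \<le> norm g then g + b * v else (cnj g * v + cnj b * r\<^sup>2) / r)"

lemma norm_reflect_form_circle:
  assumes "r > 0" "norm v = r"
  shows "norm (reflect_form r g b v) = norm (g + b * v)"
proof -
  have "v * cnj v = r\<^sup>2"
    using assms by (metis complex_norm_square of_real_power)
  then have "(cnj g * v + cnj b * r\<^sup>2) / r = cnj (g + b * v) * v / r"
    by (simp add: algebra_simps)
  then have "norm ((cnj g * v + cnj b * r\<^sup>2) / r) = norm (cnj (g + b * v)) * norm v / r"
    using assms by (simp only: norm_divide norm_mult) simp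
  then show ?thesis
    using assms unfolding reflect_form_def complex_mod_cnj by simp
qed

lemma norm_reflect_form_0:
  assumes "r > 0"
  shows "norm (reflect_form r g b 0) = max (norm g) (norm b * r)"
  using assms by (simp add: reflect_form_def norm_mult norm_divide norm_power power2_eq_square)

text \<open>The hypothesis keeps the zero of \<open>g + b * v\<close> off the circle; after the
  reflection the zero, if there is one, lies strictly outside the closed disc.\<close>

lemma reflect_form_ne_0:
  assumes "r > 0" "norm v \<le> r" "norm g \<noteq> norm b * r"
  shows "reflect_form r g b v \<noteq> 0"
proof (cases "norm b * r \<le> norm g")
  case True
  have "norm (b * v) \<le> norm b * r"
    unfolding norm_mult using assms by (intro mult_left_mono) auto
  then have "norm (b * v) < norm g"
    using True assms by linarith
  then have "g + b * v \<noteq> 0"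
    by (metis add_eq_0_iff norm_minus_cancel less_irrefl)
  then show ?thesis
    using True by (simp add: reflect_form_def)
next
  case False
  have "norm (cnj g * v) \<le> norm g * r"
    unfolding norm_mult using assms by (simp add: mult_left_mono)
  also have "\<dots> < norm b * r * r"
    using False assms by simp
  also have "\<dots> = norm (cnj b * r\<^sup>2)"
    using assms by (simp add: norm_mult norm_power power2_eq_square)
  finally have "cnj g * v + cnj b * r\<^sup>2 \<noteq> 0"
    by (metis add_eq_0_iff norm_minus_cancel less_irrefl)
  then show ?thesis
    using False assms by (simp add: reflect_form_def)
qed

lemma holomorphic_on_reflect_form: "reflect_form r g b holomorphic_on S"
  unfolding reflect_form_def by (cases "norm b * r \<le> norm g") (auto intro!: holomorphic_intros)

text \<open>Jensen's inequality for a quotient: the maximum principle for the quotient of the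
  reflected products.\<close>
lemma prod_max_le_of_circle:
  fixes g b :: "'i \<Rightarrow> complex"
  assumes r: "r > 0"
    and Z: "\<And>z. z \<in># Z \<Longrightarrow> norm (g z) \<noteq> norm (b z) * r"
    and le: "\<And>v. norm v = r \<Longrightarrow>
      (\<Prod>w\<in>#W. norm (g w + b w * v)) \<le> M * (\<Prod>z\<in>#Z. norm (g z + b z * v))"
  shows "(\<Prod>w\<in>#W. max (norm (g w)) (norm (b w) * r)) \<le>
    M * (\<Prod>z\<in>#Z. max (norm (g z)) (norm (b z) * r))"
proof -
  \<comment> \<open>Reflection removes the poles in the denominator. In the numerator it keeps the
    modulus on the circle and raises the value at the centre to the product of maxima.\<close>
  define F where "F v = (\<Prod>w\<in>#W. reflect_form r (g w) (b w) v) /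
    (\<Prod>z\<in>#Z. reflect_form r (g z) (b z) v)" for v
  have ne: "(\<Prod>z\<in>#Z. reflect_form r (g z) (b z) v) \<noteq> 0" if "norm v \<le> r" for v
    using reflect_form_ne_0[OF r that Z] by (intro prod_mset_ne_0) auto
  have holo: "F holomorphic_on cball 0 r"
    unfolding F_def using ne
    by (intro holomorphic_on_divide holomorphic_on_prod_mset holomorphic_on_reflect_form) auto
  have "norm (F 0) \<le> M"
  proof (rule maximum_modulus_frontier[of F "cball 0 r"])
    show "F holomorphic_on interior (cball 0 r)"
      using holomorphic_on_subset[OF holo interior_subset] .
    show "continuous_on (closure (cball 0 r)) F"
      using holomorphic_on_imp_continuous_on[OF holo] by simp
    show "norm (F v) \<le> M" if "v \<in> frontier (cball 0 r)" for v
    proof -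
      have v: "norm v = r"
        using that r by (simp add: dist_norm)
      have "norm (F v) = (\<Prod>w\<in>#W. norm (g w + b w * v)) / (\<Prod>z\<in>#Z. norm (g z + b z * v))"
        using norm_reflect_form_circle[OF r v] by (simp add: F_def norm_divide norm_prod_mset)
      moreover have "(\<Prod>z\<in>#Z. norm (g z + b z * v)) > 0"
        using reflect_form_ne_0[OF r _ Z, of v] norm_reflect_form_circle[OF r v] v
        by (intro prod_mset_pos) (metis order_refl zero_less_norm_iff)
      ultimately show ?thesis
        using le[OF v] by (simp add: divide_le_eq)
    qed
    show "(0::complex) \<in> cball 0 r" "bounded (cball (0::complex) r)"
      using r by auto
  qed
  moreover have "norm (F 0) = (\<Prod>w\<in>#W. max (norm (g w)) (norm (b w) * r)) /
      (\<Prod>z\<in>#Z. max (norm (g z)) (norm (b z) * r))"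
    by (simp add: F_def norm_divide norm_prod_mset norm_reflect_form_0[OF r])
  moreover have "(\<Prod>z\<in>#Z. max (norm (g z)) (norm (b z) * r)) > 0"
    using reflect_form_ne_0[OF r _ Z, of 0] norm_reflect_form_0[OF r] r
    by (intro prod_mset_pos) (metis norm_zero less_imp_le zero_less_norm_iff)
  ultimately show ?thesis
    by (simp add: divide_le_eq)
qed

text \<open>Pigeonhole: the \<open>n + 1\<close> radii \<open>r + j * d\<close> are \<open>d\<close>
  apart, so each \<open>t i\<close> is within \<open>d / 2\<close> of at most one of them, and at
  most \<open>n\<close> are lost.\<close>

lemma exists_radius_away:
  fixes t :: "'i \<Rightarrow> real"
  assumes "finite I" "card I \<le> n" "n \<ge> 1" "r < r'"
  obtains \<rho> where "r \<le> \<rho>" "\<rho> \<le> r'" "\<And>i. i \<in> I \<Longrightarrow> (r' - r) / (2 * real n) \<le> \<bar>\<rho> - t i\<bar>"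
proof -
  define d where "d = (r' - r) / real n"
  have d: "d > 0" "real n * d = r' - r"
    using assms by (auto simp: d_def)
  define \<rho> where "\<rho> j = r + real j * d" for j :: nat
  define near where "near i = {j \<in> {..n}. \<bar>\<rho> j - t i\<bar> < d / 2}" for i
  have fin: "finite (near i)" for i
    by (simp add: near_def)
  have "card (near i) \<le> Suc 0" for i
  proof -
    have "j = j'" if "j \<in> near i" "j' \<in> near i" for j j'
    proof -
      have "\<bar>\<rho> j - \<rho> j'\<bar> \<le> \<bar>\<rho> j - t i\<bar> + \<bar>\<rho> j' - t i\<bar>"
        by linarith
      also have "\<dots> < d"
        using that by (simp add: near_def)
      also have "\<rho> j - \<rho> j' = (real j - real j') * d"
        by (simp add: \<rho>_def left_diff_distrib)
      finally have "\<bar>real j - real j'\<bar> * d < 1 * d"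
        using d(1) by (simp add: abs_mult)
      then have "\<bar>real j - real j'\<bar> < 1"
        using d(1) by (metis mult_less_cancel_right_pos)
      then show ?thesis by linarith
    qed
    then show ?thesis
      using fin card_le_Suc0_iff_eq by blast
  qed
  then have "card (\<Union>i\<in>I. near i) \<le> (\<Sum>i\<in>I. Suc 0)"
    using card_UN_le[OF assms(1), of near] sum_mono[of I "\<lambda>i. card (near i)" "\<lambda>_. Suc 0"]
    by (meson order_trans)
  then have "card (\<Union>i\<in>I. near i) < card {..n}"
    using assms by simp
  moreover have "finite (\<Union>i\<in>I. near i)"
    using assms(1) fin by blast
  ultimately have "\<not> {..n} \<subseteq> (\<Union>i\<in>I. near i)"
    using card_mono leD by blast
  then obtain j where j: "j \<le> n" "j \<notin> (\<Union>i\<in>I. near i)"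
    by auto
  show ?thesis
  proof
    show "r \<le> \<rho> j"
      using d by (simp add: \<rho>_def)
    have "real j * d \<le> real n * d"
      using j d by (intro mult_right_mono) auto
    then show "\<rho> j \<le> r'"
      using d by (simp add: \<rho>_def)
    show "(r' - r) / (2 * real n) \<le> \<bar>\<rho> j - t i\<bar>" if "i \<in> I" for i
      using j that by (auto simp: near_def d_def)
  qed
qed

section \<open>Comparison of potentials for a polynomial and its derivative\<close>

definition poly_of_roots :: "nat \<Rightarrow> (nat \<Rightarrow> complex) \<Rightarrow> complex poly" where
  "poly_of_roots n x = (\<Prod>i=1..n. [:- x i, 1:])"

text \<open>The first disjunct excludes the points where the quotient of the derivative and the
  polynomial has a pole.\<close>
definition small_deriv :: "nat \<Rightarrow> real \<Rightarrow> nat \<Rightarrow> (nat \<Rightarrow> complex) \<Rightarrow> complex \<Rightarrow> bool" where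
  "small_deriv k e n x a \<longleftrightarrow> poly (poly_of_roots n x) a = 0 \<or>
     norm (poly ((pderiv ^^ k) (poly_of_roots n x)) a) \<le> exp (- e * n) * norm (poly (poly_of_roots n x) a)"

lemma degree_poly_of_roots [simp]: "degree (poly_of_roots n x) = n"
  by (simp add: poly_of_roots_def degree_prod_linear)

lemma lead_coeff_poly_of_roots: "lead_coeff (poly_of_roots n x) = 1"
  unfolding poly_of_roots_def lead_coeff_prod by simp

lemma norm_poly_of_roots: "norm (poly (poly_of_roots n x) a) = (\<Prod>i=1..n. norm (a - x i))"
  by (simp add: poly_of_roots_def poly_prod prod_norm)

lemma norm_poly_eq_prod_proots:
  fixes p :: "complex poly"
  shows "norm (poly p a) = norm (lead_coeff p) * (\<Prod>w\<in>#proots p. norm (a - w))"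
proof -
  have "poly (\<Prod>x\<in>#A. [:- x, 1:]) a = (\<Prod>x\<in>#A. a - x)" for A
    by (induction A) (auto simp: algebra_simps)
  then have "poly p a = lead_coeff p * (\<Prod>w\<in>#proots p. a - w)"
    by (subst complex_poly_decompose_multiset[symmetric]) simp
  then show ?thesis
    by (simp only: norm_mult norm_prod_mset)
qed

lemma prod_mset_mult_const:
  fixes c :: real
  shows "(\<Prod>x\<in>#A. f x * c) = (\<Prod>x\<in>#A. f x) * c ^ size A"
  by (induction A) (auto simp: algebra_simps)

lemma prod_mset_nonneg:
  fixes f :: "'a \<Rightarrow> real"
  assumes "\<And>x. x \<in># A \<Longrightarrow> 0 \<le> f x"
  shows "0 \<le> (\<Prod>x\<in>#A. f x)"
  using assms by (induction A) auto

lemma ln_prod_mset: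
  fixes f :: "'a \<Rightarrow> real"
  assumes "\<And>x. x \<in># A \<Longrightarrow> 0 < f x"
  shows "ln (\<Prod>x\<in>#A. f x) = (\<Sum>x\<in>#A. ln (f x))"
  using assms
proof (induction A)
  case (add x A)
  then show ?case
    using prod_mset_pos[of A f] by (simp add: ln_mult_pos)
qed simp

text \<open>The circle on which the maximum principle is applied is chosen at distance at least of
  order \<open>1/n\<close> from all poles, so the quotient is only polynomially large on it.\<close>
lemma log_potential_le:
  fixes r r' c C :: real
  assumes r: "0 < r" "r < r'" and c: "0 < c" and C: "0 < C"
  obtains K where "K \<ge> 0"
    "\<And>n x u D g b e. 1 \<le> n \<Longrightarrow> k \<le> n \<Longrightarrow>
      (\<And>v w. v = 0 \<or> r \<le> norm v \<and> norm v \<le> r' \<Longrightarrow> (u v - w) * D v = g w + b w * v) \<Longrightarrow>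
      (\<And>v. v = 0 \<or> r \<le> norm v \<and> norm v \<le> r' \<Longrightarrow> c \<le> norm (D v) \<and> norm (D v) \<le> C) \<Longrightarrow>
      (\<And>w. c \<le> norm (g w) + norm (b w)) \<Longrightarrow> \<not> small_deriv k e n x (u 0) \<Longrightarrow>
      (\<Sum>w\<in>#proots ((pderiv ^^ k) (poly_of_roots n x)). ln (max 1 (r * norm (b w) / norm (g w))))
      \<le> K * (1 + ln (real n)) + e * n + (\<Sum>i=1..n. ln (max 1 (r' * norm (b (x i)) / norm (g (x i)))))"
proof -
  \<comment> \<open>If \<open>norm (b w) < b0\<close>, then
    \<open>norm (g w) - norm (b w) * \<rho> \<ge> c / 2\<close>, since
    \<open>b0 * (1 + r') = c / 2\<close>. Otherwise the separation of the radii is multiplied by at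
    least \<open>b0\<close>. In both cases \<open>\<kappa> / n\<close> is a lower bound for the
    gap.\<close>
  define b0 where "b0 = c / (2 * (1 + r'))"
  define \<kappa> where "\<kappa> = min (b0 * (r' - r) / 2) (c / 2)"
  define A where "A = (C / (\<kappa> * c)) * C"
  have b0: "b0 > 0" "b0 * (1 + r') = c / 2"
    using r c by (auto simp: b0_def field_simps)
  have \<kappa>: "\<kappa> > 0"
    using b0 r c by (simp add: \<kappa>_def)
  have A: "A > 0"
    using \<kappa> c C by (simp add: A_def)
  define K where "K = \<bar>ln (fact k)\<bar> + real k * \<bar>ln A\<bar> + 3 * real k"
  show ?thesis
  proof (rule that[of K])
    show "K \<ge> 0" by (simp add: K_def)
    \<comment> \<open>\<open>u\<close> is a Moebius coordinate with denominator \<open>D\<close>;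
      clearing it turns \<open>u v - w\<close> into a linear form in \<open>v\<close>. The two uses
      are \<open>u v = a + v\<close> with \<open>D v = 1\<close>, and
      \<open>u v = 1 / (t + v)\<close> with \<open>D v = t + v\<close>. Only the centre and an
      annulus are constrained, because in the second use \<open>D\<close> vanishes inside the disc,
      at the point that \<open>u\<close> sends to infinity.\<close>
    fix n x u D g b e
    assume n: "1 \<le> n" "k \<le> n"
      and uD: "\<And>v w. v = 0 \<or> r \<le> norm v \<and> norm v \<le> r' \<Longrightarrow> (u v - w) * D v = g w + b w * v"
      and D: "\<And>v. v = 0 \<or> r \<le> norm v \<and> norm v \<le> r' \<Longrightarrow> c \<le> norm (D v) \<and> norm (D v) \<le> C"
      and gb: "\<And>w. c \<le> norm (g w) + norm (b w)"
      and good: "\<not> small_deriv k e n x (u 0)"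
    define p where "p = poly_of_roots n x"
    define S where "S = (pderiv ^^ k) p"
    define W where "W = proots S"
    define Z where "Z = image_mset x (mset_set {1..n})"
    define lc where "lc = norm (lead_coeff S)"
    have sizeW: "size W = n - k"
      by (simp add: W_def S_def p_def size_proots_complex degree_higher_pderiv)
    have lc: "1 \<le> lc" "lc \<le> real n ^ k"
      using lead_coeff_higher_pderiv_bounds[OF lead_coeff_poly_of_roots, of k n x] n
      by (simp_all add: lc_def S_def p_def)
    have prodZ: "(\<Prod>z\<in>#Z. f z) = (\<Prod>i=1..n. f (x i))" for f :: "complex \<Rightarrow> real"
      by (simp add: Z_def prod_unfold_prod_mset image_mset.compositionality o_def)
    have S: "norm (poly S a) = lc * (\<Prod>w\<in>#W. norm (a - w))" for a
      by (simp add: lc_def W_def norm_poly_eq_prod_proots[of S])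
    have p: "norm (poly p a) = (\<Prod>i=1..n. norm (a - x i))" for a
      by (simp add: p_def norm_poly_of_roots)
    obtain \<rho> where \<rho>: "r \<le> \<rho>" "\<rho> \<le> r'"
      "\<And>i. i \<in> {1..n} \<Longrightarrow> (r' - r) / (2 * real n) \<le> \<bar>\<rho> - norm (g (x i)) / norm (b (x i))\<bar>"
      using exists_radius_away[of "{1..n}" n r r' "\<lambda>i. norm (g (x i)) / norm (b (x i))"] n r by auto
    have away: "\<kappa> / n \<le> \<bar>norm (g (x i)) - norm (b (x i)) * \<rho>\<bar>" if i: "i \<in> {1..n}" for i
    proof (cases "b0 \<le> norm (b (x i))")
      case True
      have "\<kappa> / n \<le> b0 * (r' - r) / 2 / n"
        by (intro divide_right_mono) (auto simp: \<kappa>_def)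
      also have "\<dots> = b0 * ((r' - r) / (2 * real n))"
        by simp
      also have "\<dots> \<le> norm (b (x i)) * \<bar>\<rho> - norm (g (x i)) / norm (b (x i))\<bar>"
        using True \<rho>(3)[OF i] b0 r by (intro mult_mono) auto
      also have "\<dots> = \<bar>norm (b (x i)) * (\<rho> - norm (g (x i)) / norm (b (x i)))\<bar>"
        by (simp add: abs_mult)
      also have "norm (b (x i)) * (\<rho> - norm (g (x i)) / norm (b (x i))) = norm (b (x i)) * \<rho> - norm (g (x i))"
        using True b0 by (auto simp: field_simps)
      finally show ?thesis by (simp add: abs_minus_commute)
    next
      case False
      have "norm (b (x i)) * \<rho> \<le> b0 * r'"
        using False \<rho> r b0 by (intro mult_mono) auto
      then have "c / 2 \<le> norm (g (x i)) - norm (b (x i)) * \<rho>"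
        using gb[of "x i"] False b0 by (simp add: algebra_simps)
      moreover have "\<kappa> / n \<le> \<kappa> / 1"
        using \<kappa> n by (intro divide_left_mono) auto
      moreover have "\<kappa> / 1 \<le> c / 2"
        by (simp add: \<kappa>_def)
      ultimately show ?thesis
        by linarith
    qed
    \<comment> \<open>On the circle each root is at distance at least
      \<open>\<kappa> / (n * C)\<close>, so the \<open>n\<close> reciprocals add up to at most
      \<open>n^2 * C / \<kappa>\<close>. The factor \<open>1 / c\<close> pays for the zeros carrying
      \<open>k\<close> fewer factors \<open>norm (D v)\<close> than the roots.\<close>
    define M where "M = fact k * (real n ^ 2 * C / (\<kappa> * c)) ^ k"
    have M: "M > 0"
      using n \<kappa> c C by (simp add: M_def)
    have circle: "(\<Prod>w\<in>#W. norm (g w + b w * v)) \<le> M * (\<Prod>z\<in>#Z. norm (g z + b z * v))"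
      if v: "norm v = \<rho>" for v
    proof -
      have v': "v = 0 \<or> r \<le> norm v \<and> norm v \<le> r'"
        using v \<rho> by simp
      note Dv = D[OF v']
      have Dpos: "norm (D v) > 0"
        using Dv c by linarith
      have Dn: "norm (D v) ^ n = norm (D v) ^ (n - k) * norm (D v) ^ k"
        using n by (simp flip: power_add)
      have eq: "norm (g w + b w * v) = norm (u v - w) * norm (D v)" for w
        by (simp flip: uD[OF v'] add: norm_mult)
      have low: "\<kappa> / (n * C) \<le> norm (u v - x i)" if i: "i \<in> {1..n}" for i
      proof -
        have "\<kappa> / n \<le> \<bar>norm (g (x i)) - norm (b (x i) * v)\<bar>"
          using away[OF i] v by (simp add: norm_mult)
        also have "\<dots> \<le> norm (g (x i) + b (x i) * v)"
          by (metis norm_triangle_ineq3 diff_minus_eq_add norm_minus_cancel)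
        also have "\<dots> \<le> norm (u v - x i) * C"
          unfolding eq using Dv by (intro mult_left_mono) auto
        finally show ?thesis
          using C n by (simp add: field_simps)
      qed
      have pos: "\<kappa> / (n * C) > 0"
        using \<kappa> n C by simp
      have ne: "u v \<noteq> x i" if "i \<in> {1..n}" for i
        using low[OF that] pos by auto
      have "norm (coeff (\<Prod>i=1..n. [:1, 1 / (u v - x i):]) k) \<le> (\<Sum>i=1..n. norm (1 / (u v - x i))) ^ k"
        by (rule norm_coeff_prod_le) simp
      also have "\<dots> \<le> (real n * (n * C / \<kappa>)) ^ k"
      proof (intro power_mono sum_nonneg)
        have "norm (1 / (u v - x i)) \<le> n * C / \<kappa>" if i: "i \<in> {1..n}" for i
          using le_imp_inverse_le[OF low[OF i] pos] by (simp add: norm_divide divide_simps)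
        then show "(\<Sum>i=1..n. norm (1 / (u v - x i))) \<le> real n * (n * C / \<kappa>)"
          using sum_bounded_above[of "{1..n}" "\<lambda>i. norm (1 / (u v - x i))" "n * C / \<kappa>"] by simp
      qed auto
      finally have "norm (poly S (u v)) \<le> fact k * norm (poly p (u v)) * (real n * (n * C / \<kappa>)) ^ k"
        unfolding S_def p_def poly_of_roots_def
        by (subst poly_higher_pderiv_prod) (use ne in \<open>auto simp: norm_mult intro!: mult_left_mono\<close>)
      moreover have "(\<Prod>w\<in>#W. norm (u v - w)) \<le> norm (poly S (u v))"
        unfolding S using mult_right_mono[OF lc(1), of "\<Prod>w\<in>#W. norm (u v - w)"]
        by (simp add: prod_mset_nonneg)
      ultimately have "(\<Prod>w\<in>#W. norm (u v - w)) \<le> fact k * norm (poly p (u v)) * (real n * (n * C / \<kappa>)) ^ k"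
        by linarith
      then have "(\<Prod>w\<in>#W. norm (u v - w)) * norm (D v) ^ (n - k)
          \<le> fact k * norm (poly p (u v)) * (real n * (n * C / \<kappa>)) ^ k * norm (D v) ^ (n - k)"
        by (rule mult_right_mono) simp
      also have "\<dots> = fact k * ((real n * (n * C / \<kappa>)) / norm (D v)) ^ k * (norm (poly p (u v)) * norm (D v) ^ n)"
        using Dpos by (simp add: Dn power_divide power_mult_distrib)
      also have "\<dots> \<le> fact k * ((real n * (n * C / \<kappa>)) / c) ^ k * (norm (poly p (u v)) * norm (D v) ^ n)"
        using Dv Dpos c n C \<kappa> by (intro mult_right_mono mult_left_mono power_mono divide_left_mono) auto
      also have "fact k * ((real n * (n * C / \<kappa>)) / c) ^ k = M"
        by (simp add: M_def power2_eq_square mult.assoc)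
      also have "norm (poly p (u v)) * norm (D v) ^ n = (\<Prod>z\<in>#Z. norm (g z + b z * v))"
        unfolding eq p prodZ by (simp add: prod.distrib)
      also have "(\<Prod>w\<in>#W. norm (u v - w)) * norm (D v) ^ (n - k) = (\<Prod>w\<in>#W. norm (g w + b w * v))"
        unfolding eq prod_mset_mult_const by (simp add: sizeW)
      finally show ?thesis .
    qed
    have "(\<Prod>w\<in>#W. max (norm (g w)) (norm (b w) * \<rho>)) \<le>
        M * (\<Prod>z\<in>#Z. max (norm (g z)) (norm (b z) * \<rho>))"
    proof (rule prod_max_le_of_circle[OF _ _ circle])
      show "\<rho> > 0" using \<rho> r by simp
      fix z assume "z \<in># Z"
      then obtain i where i: "i \<in> {1..n}" "z = x i" by (auto simp: Z_def)
      have "\<kappa> / n > 0" using \<kappa> n by simp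
      then show "norm (g z) \<noteq> norm (b z) * \<rho>"
        using away[OF i(1)] i(2) by auto
    qed
    note main = this
    have D0: "c \<le> norm (D 0)" "norm (D 0) \<le> C"
      using D[of 0] by auto
    have g0: "norm (g w) = norm (u 0 - w) * norm (D 0)" for w
      using uD[of 0 w] by (metis add.right_neutral mult_zero_right norm_mult)
    have good1: "poly p (u 0) \<noteq> 0" and good2: "exp (- e * n) * norm (poly p (u 0)) < norm (poly S (u 0))"
      using good by (auto simp: small_deriv_def S_def p_def)
    have "poly S (u 0) \<noteq> 0"
      using good1 good2 by (metis norm_zero not_less mult_nonneg_nonneg exp_ge_zero norm_ge_zero)
    then have gW: "norm (g w) > 0" if "w \<in># W" for w
    proof -
      have "S \<noteq> 0"
        using \<open>poly S (u 0) \<noteq> 0\<close> by auto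
      then have "w \<noteq> u 0"
        using that \<open>poly S (u 0) \<noteq> 0\<close> by (auto simp: W_def)
      moreover have "norm (D 0) > 0"
        using D0 c by linarith
      ultimately show ?thesis
        unfolding g0 by simp
    qed
    have gZ: "norm (g z) > 0" if z: "z \<in># Z" for z
    proof -
      obtain i where i: "i \<in> {1..n}" "z = x i" using z by (auto simp: Z_def)
      have "norm (poly p (u 0)) \<noteq> 0" using good1 by simp
      then show ?thesis using i D0 c by (auto simp: g0 p intro!: mult_pos_pos)
    qed
    have pos: "(\<Prod>w\<in>#W. norm (g w)) > 0" "(\<Prod>w\<in>#Z. norm (g w)) > 0"
      using gW gZ by (auto intro!: prod_mset_pos)
    have split: "(\<Prod>w\<in>#V. max (norm (g w)) (norm (b w) * \<rho>)) =
        (\<Prod>w\<in>#V. norm (g w)) * (\<Prod>w\<in>#V. max 1 (\<rho> * norm (b w) / norm (g w)))"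
      if "\<And>w. w \<in># V \<Longrightarrow> norm (g w) > 0" for V
    proof -
      have "max (norm (g w)) (norm (b w) * \<rho>) = norm (g w) * max 1 (\<rho> * norm (b w) / norm (g w))"
        if "w \<in># V" for w
        using \<open>\<And>w. w \<in># V \<Longrightarrow> norm (g w) > 0\<close>[OF that]
        by (simp add: max_mult_distrib_left mult.commute)
      then have "(\<Prod>w\<in>#V. max (norm (g w)) (norm (b w) * \<rho>)) =
          (\<Prod>w\<in>#V. norm (g w) * max 1 (\<rho> * norm (b w) / norm (g w)))"
        by (metis (mono_tags, lifting) image_mset_cong)
      then show ?thesis by (simp add: prod_mset.distrib)
    qed
    \<comment> \<open>At the centre the inequality is needed in the other direction: since
      \<open>small_deriv\<close> fails there, the product of \<open>norm (g z)\<close> over the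
      roots is at most the one over the zeros, up to \<open>exp (e * n)\<close> and polynomial
      factors. Cancelling these products leaves only the truncated factors \<open>mW\<close> and
      \<open>mZ\<close>.\<close>
    have "norm (poly S (u 0)) * norm (D 0) ^ (n - k) \<le> real n ^ k * (\<Prod>w\<in>#W. norm (g w))"
    proof -
      have "norm (poly S (u 0)) * norm (D 0) ^ (n - k) = lc * (\<Prod>w\<in>#W. norm (g w))"
        unfolding S g0 prod_mset_mult_const by (simp add: sizeW)
      also have "\<dots> \<le> real n ^ k * (\<Prod>w\<in>#W. norm (g w))"
        using lc(2) pos by (intro mult_right_mono) auto
      finally show ?thesis .
    qed
    moreover have "exp (- e * n) * norm (poly p (u 0)) * norm (D 0) ^ (n - k) \<le>
        norm (poly S (u 0)) * norm (D 0) ^ (n - k)"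
      using good2 by (intro mult_right_mono) auto
    moreover have "(\<Prod>z\<in>#Z. norm (g z)) = norm (poly p (u 0)) * norm (D 0) ^ n"
      unfolding prodZ p g0 by (simp add: prod.distrib)
    moreover have "norm (D 0) ^ n = norm (D 0) ^ (n - k) * norm (D 0) ^ k"
      using n by (simp flip: power_add)
    ultimately have "exp (- e * n) * (\<Prod>z\<in>#Z. norm (g z)) \<le> real n ^ k * (\<Prod>w\<in>#W. norm (g w)) * norm (D 0) ^ k"
      using mult_right_mono[of "exp (- e * n) * norm (poly p (u 0)) * norm (D 0) ^ (n - k)" "real n ^ k * (\<Prod>w\<in>#W. norm (g w))" "norm (D 0) ^ k"]
      by (simp add: algebra_simps)
    also have "\<dots> \<le> real n ^ k * (\<Prod>w\<in>#W. norm (g w)) * C ^ k"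
      using D0 c pos by (intro mult_left_mono power_mono) auto
    finally have "exp (e * n) * (exp (- e * n) * (\<Prod>z\<in>#Z. norm (g z))) \<le> exp (e * n) * (real n ^ k * (\<Prod>w\<in>#W. norm (g w)) * C ^ k)"
      by (rule mult_left_mono) simp
    then have center: "(\<Prod>z\<in>#Z. norm (g z)) \<le> exp (e * n) * real n ^ k * C ^ k * (\<Prod>w\<in>#W. norm (g w))"
      by (simp add: mult.assoc[symmetric] flip: exp_add) (simp add: algebra_simps)
    define mW where "mW = (\<Prod>w\<in>#W. max 1 (\<rho> * norm (b w) / norm (g w)))"
    define mZ where "mZ = (\<Prod>w\<in>#Z. max 1 (\<rho> * norm (b w) / norm (g w)))"
    have m: "mW > 0" "mZ > 0"
      unfolding mW_def mZ_def by (auto intro!: prod_mset_pos)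
    have "(\<Prod>w\<in>#W. norm (g w)) * mW \<le> M * ((\<Prod>w\<in>#Z. norm (g w)) * mZ)"
      using main unfolding split[OF gW, of W, simplified] split[OF gZ, of Z, simplified] mW_def mZ_def by simp
    also have "\<dots> \<le> M * ((exp (e * n) * real n ^ k * C ^ k * (\<Prod>w\<in>#W. norm (g w))) * mZ)"
      using center M m by (intro mult_left_mono mult_right_mono) auto
    also have "\<dots> = (\<Prod>w\<in>#W. norm (g w)) * (M * real n ^ k * C ^ k * exp (e * n) * mZ)"
      by (simp add: algebra_simps)
    finally have "mW \<le> M * real n ^ k * C ^ k * exp (e * n) * mZ"
      using pos by (simp add: mult_le_cancel_left_pos)
    \<comment> \<open>The exponent \<open>3\<close> collects \<open>n^2\<close> from the circle and
      \<open>n\<close> from the leading coefficient; it becomes the term \<open>3 * real k\<close>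
      in \<open>K\<close>.\<close>
    also have "M * real n ^ k * C ^ k = fact k * (A * real n ^ 3) ^ k"
      by (simp add: M_def A_def power_mult_distrib power_divide power3_eq_cube power2_eq_square)
    finally have "ln mW \<le> ln (fact k * (A * real n ^ 3) ^ k * exp (e * n) * mZ)"
      using m by simp
    also have "\<dots> = ln (fact k) + real k * (ln A + 3 * ln (real n)) + e * n + ln mZ"
      using m A n by (simp add: ln_mult ln_realpow)
    also have "\<dots> \<le> K * (1 + ln (real n)) + e * n + ln mZ"
    proof -
      have "ln (real n) \<ge> 0" using n by simp
      then have "\<bar>ln (fact k)\<bar> * 1 \<le> \<bar>ln (fact k)\<bar> * (1 + ln (real n))"
        "real k * (\<bar>ln A\<bar> * 1) \<le> real k * (\<bar>ln A\<bar> * (1 + ln (real n)))"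
        by (simp_all add: mult_left_mono distrib_left)
      moreover have "real k * ln A \<le> real k * \<bar>ln A\<bar>"
        by (intro mult_left_mono) auto
      ultimately show ?thesis
        by (simp add: K_def algebra_simps)
    qed
    finally have *: "ln mW \<le> K * (1 + ln (real n)) + e * n + ln mZ" .
    \<comment> \<open>The radius \<open>\<rho>\<close> depends on the roots, which the final bound
      must not show; it is decreased to \<open>r\<close> on the side of the zeros and increased to
      \<open>r'\<close> on the side of the roots.\<close>
    have mono: "ln (max 1 (s * norm (b w) / norm (g w))) \<le> ln (max 1 (t * norm (b w) / norm (g w)))"
      if "s \<le> t" for s t w
    proof -
      have "s * norm (b w) / norm (g w) \<le> t * norm (b w) / norm (g w)"
        using that by (intro divide_right_mono mult_right_mono) auto
      then show ?thesis
        by (subst ln_le_cancel_iff) auto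
    qed
    have "(\<Sum>w\<in>#W. ln (max 1 (r * norm (b w) / norm (g w)))) \<le> ln mW"
      unfolding mW_def
      by (subst ln_prod_mset) (use mono[OF \<rho>(1)] in \<open>auto intro!: sum_mset_mono\<close>)
    moreover have "ln mZ \<le> (\<Sum>i=1..n. ln (max 1 (r' * norm (b (x i)) / norm (g (x i)))))"
    proof -
      have "ln mZ = (\<Sum>i=1..n. ln (max 1 (\<rho> * norm (b (x i)) / norm (g (x i)))))"
        unfolding mZ_def prodZ by (subst ln_prod) (auto simp: less_max_iff_disj)
      also have "\<dots> \<le> (\<Sum>i=1..n. ln (max 1 (r' * norm (b (x i)) / norm (g (x i)))))"
        by (intro sum_mono mono[OF \<rho>(2)])
      finally show ?thesis .
    qed
    ultimately show "(\<Sum>w\<in>#proots ((pderiv ^^ k) (poly_of_roots n x)). ln (max 1 (r * norm (b w) / norm (g w))))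
      \<le> K * (1 + ln (real n)) + e * n + (\<Sum>i=1..n. ln (max 1 (r' * norm (b (x i)) / norm (g (x i)))))"
      using * by (simp add: W_def S_def p_def)
  qed
qed

section \<open>Averaging over the centre\<close>

text \<open>The value at \<open>0\<close> is \<open>0\<close>, because \<open>r / 0 = 0\<close>.\<close>
definition log_kernel :: "real \<Rightarrow> complex \<Rightarrow> real" where
  "log_kernel r a = ln (max 1 (r / norm a))"

lemma log_kernel_nonneg: "0 \<le> log_kernel r a"
  by (simp add: log_kernel_def)

lemma log_kernel_eq_0: "0 < r \<Longrightarrow> r \<le> norm a \<Longrightarrow> log_kernel r a = 0"
  by (auto simp: log_kernel_def max_def le_divide_eq)

lemma log_kernel_measurable [measurable]: "log_kernel r \<in> borel_measurable borel"
  unfolding log_kernel_def by measurable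

lemma log_kernel_scale: "0 < r \<Longrightarrow> log_kernel r (r *\<^sub>R a) = log_kernel 1 a"
  by (simp add: log_kernel_def)

lemma log_kernel_le_shift:
  assumes "0 \<le> L" "0 < r"
  shows "log_kernel r a \<le> L + log_kernel (r * exp (- L)) a"
proof -
  have "max 1 (r / norm a) \<le> exp L * max 1 (r * exp (- L) / norm a)"
  proof (rule max.boundedI)
    have "1 * 1 \<le> exp L * max 1 (r * exp (- L) / norm a)"
      using assms by (intro mult_mono) auto
    then show "1 \<le> exp L * max 1 (r * exp (- L) / norm a)" by simp
    have "r / norm a = exp L * (r * exp (- L) / norm a)"
      by (simp add: exp_minus)
    also have "\<dots> \<le> exp L * max 1 (r * exp (- L) / norm a)"
      by (intro mult_left_mono) auto
    finally show "r / norm a \<le> exp L * max 1 (r * exp (- L) / norm a)" .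
  qed
  then have "log_kernel r a \<le> ln (exp L * max 1 (r * exp (- L) / norm a))"
    unfolding log_kernel_def by (subst ln_le_cancel_iff) auto
  also have "\<dots> = L + log_kernel (r * exp (- L)) a"
    unfolding log_kernel_def by (subst ln_mult_pos) auto
  finally show ?thesis .
qed

text \<open>The kernel is at most the number of discs of radius \<open>exp (- j)\<close> around
  \<open>0\<close>, with \<open>j \<ge> 0\<close>, that contain the point, and the areas of these
  discs form a geometric series.\<close>

lemma integrable_log_kernel_1: "integrable lborel (log_kernel 1)"
proof (rule integrableI_nonneg)
  have le: "ennreal (log_kernel 1 a) \<le> (\<Sum>j. indicator (ball 0 (exp (- real j))) a)" for a
  proof (cases "a = 0 \<or> norm a \<ge> 1")
    case True
    then have "log_kernel 1 a = 0"
      using log_kernel_eq_0[of 1 a] by (auto simp: log_kernel_def)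
    then show ?thesis by simp
  next
    case False
    define t where "t = ln (1 / norm a)"
    define N where "N = nat \<lceil>t\<rceil>"
    have "(\<Sum>j<N. indicator (ball 0 (exp (- real j))) a) = (\<Sum>j<N. 1 :: ennreal)"
    proof (rule sum.cong)
      fix j assume "j \<in> {..<N}"
      then have "real j < t"
        unfolding N_def by simp linarith
      then have "t = - ln (norm a)" "real j < - ln (norm a)"
        using False by (auto simp: t_def ln_div)
      then have "ln (norm a) < - real j" by simp
      then have "norm a < exp (- real j)"
        using False by (metis exp_less_cancel_iff exp_ln zero_less_norm_iff)
      then show "indicator (ball 0 (exp (- real j))) a = (1 :: ennreal)"
        by (simp add: indicator_def)
    qed simp
    then have "ennreal (real N) \<le> (\<Sum>j. indicator (ball 0 (exp (- real j))) a)"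
      using sum_le_suminf[of "\<lambda>j. indicator (ball 0 (exp (- real j))) a :: ennreal" "{..<N}"]
      by (simp add: ennreal_of_nat_eq_real_of_nat)
    moreover have "log_kernel 1 a = t"
      using False by (simp add: log_kernel_def t_def max_def)
    moreover have "t \<le> real N"
      unfolding N_def by linarith
    ultimately show ?thesis
      by (metis ennreal_leI order_trans)
  qed
  have "(\<integral>\<^sup>+a. ennreal (log_kernel 1 a) \<partial>lborel) \<le> (\<integral>\<^sup>+(a::complex). (\<Sum>j. indicator (ball 0 (exp (- real j))) a) \<partial>lborel)"
    by (rule nn_integral_mono) (rule le)
  also have "\<dots> = (\<Sum>j. emeasure lborel (ball (0::complex) (exp (- real j))))"
    by (subst nn_integral_suminf) (auto intro!: borel_measurable_indicator)
  also have "(\<lambda>j. emeasure lborel (ball (0::complex) (exp (- real j)))) = (\<lambda>j. ennreal (pi * (exp (- 2)) ^ j))"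
    by (simp add: emeasure_ball unit_ball_vol_2 power2_eq_square mult.commute
        flip: exp_add exp_of_nat_mult)
  also have "(\<Sum>j. ennreal (pi * (exp (- 2)) ^ j)) < \<infinity>"
    by (subst suminf_ennreal2) (auto intro!: summable_mult summable_geometric)
  finally show "(\<integral>\<^sup>+a. ennreal (log_kernel 1 a) \<partial>lborel) < \<infinity>" .
qed (auto simp: log_kernel_nonneg)

text \<open>The value is \<open>pi / 2\<close>; the argument only uses that it is finite and
  positive.\<close>

definition kernel_mass :: real where
  "kernel_mass = (\<integral>a. log_kernel 1 a \<partial>lborel)"

lemma kernel_mass_pos: "0 < kernel_mass"
proof -
  \<comment> \<open>This disc avoids \<open>0\<close>, where the kernel has the default value
    \<open>0\<close>, and lies within \<open>norm a < 3/4\<close>.\<close>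
  have "ln (4/3) * indicator (ball (1/2) (1/4)) a \<le> log_kernel 1 a" for a :: complex
  proof (cases "a \<in> ball (1/2) (1/4)")
    case True
    have "norm a \<le> norm (1/2 :: complex) + norm (1/2 - a)" "norm (1/2 :: complex) \<le> norm (1/2 - a) + norm a"
      by (metis norm_minus_commute norm_triangle_sub, metis norm_triangle_sub add.commute)
    moreover have "norm (1/2 - a) < 1/4"
      using True by (simp add: dist_norm)
    ultimately have "norm a < 3/4" "norm a > 0"
      unfolding norm_divide norm_one norm_numeral by linarith+
    then show ?thesis
      using True unfolding log_kernel_def by (simp add: field_simps)
  qed (simp add: log_kernel_nonneg)
  then have "(\<integral>a. ln (4/3) * indicator (ball (1/2 :: complex) (1/4)) a \<partial>lborel) \<le> kernel_mass"
    unfolding kernel_mass_def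
    by (intro integral_mono integrable_log_kernel_1 integrable_mult_right integrable_real_indicator)
      (use emeasure_lborel_ball_finite in \<open>auto simp: less_top[symmetric]\<close>)
  moreover have "(\<integral>a. ln (4/3) * indicator (ball (1/2 :: complex) (1/4)) a \<partial>lborel) =
      ln (4/3) * measure lborel (ball (1/2 :: complex) (1/4))"
    by simp
  moreover have "measure lborel (ball (1/2 :: complex) (1/4)) > 0"
    by (simp add: content_ball unit_ball_vol_2)
  ultimately show ?thesis
    by (smt (verit) ln_gt_zero mult_pos_pos divide_less_eq_1_pos less_divide_eq_1_pos)
qed

lemma
  assumes "0 < r"
  shows integrable_log_kernel: "integrable lborel (\<lambda>a. log_kernel r (a - w))"
    and integral_log_kernel: "(\<integral>a. log_kernel r (a - w) \<partial>lborel) = r\<^sup>2 * kernel_mass"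
proof -
  have eq: "lborel = density (distr lborel borel (\<lambda>a. w + r *\<^sub>R a)) (\<lambda>_. ennreal (r\<^sup>2))"
    using lborel_affine[of r w] assms by simp
  show "integrable lborel (\<lambda>a. log_kernel r (a - w))"
    by (subst eq) (use assms in \<open>simp add: integrable_density integrable_distr_eq log_kernel_scale
      integrable_log_kernel_1\<close>)
  show "(\<integral>a. log_kernel r (a - w) \<partial>lborel) = r\<^sup>2 * kernel_mass"
    by (subst eq) (use assms in \<open>simp add: integral_density integral_distr log_kernel_scale kernel_mass_def\<close>)
qed

lemma
  assumes "\<And>x. x \<in># A \<Longrightarrow> integrable M (g x)"
  shows integrable_sum_mset: "integrable M (\<lambda>a. \<Sum>x\<in>#A. g x a :: real)"
    and integral_sum_mset: "(\<integral>a. (\<Sum>x\<in>#A. g x a) \<partial>M) = (\<Sum>x\<in>#A. \<integral>a. g x a \<partial>M)"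
proof -
  have "integrable M (\<lambda>a. \<Sum>x\<in>#A. g x a) \<and> (\<integral>a. (\<Sum>x\<in>#A. g x a) \<partial>M) = (\<Sum>x\<in>#A. \<integral>a. g x a \<partial>M)"
    using assms by (induction A) auto
  then show "integrable M (\<lambda>a. \<Sum>x\<in>#A. g x a)"
    "(\<integral>a. (\<Sum>x\<in>#A. g x a) \<partial>M) = (\<Sum>x\<in>#A. \<integral>a. g x a \<partial>M)"
    by auto
qed

lemma sum_mset_nonneg:
  fixes f :: "'a \<Rightarrow> real"
  assumes "\<And>x. x \<in># A \<Longrightarrow> 0 \<le> f x"
  shows "0 \<le> (\<Sum>x\<in>#A. f x)"
  using assms by (induction A) auto

lemma sum_mset_minus_const:
  fixes f :: "'a \<Rightarrow> real"
  shows "(\<Sum>x\<in>#A. c * (f x - d)) = c * ((\<Sum>x\<in>#A. f x) - d * size A)"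
  by (induction A) (auto simp: algebra_simps)

lemma eventually_ln_le:
  assumes "0 < d"
  shows "\<forall>\<^sub>F n in sequentially. K * (1 + ln (real n)) \<le> d * real n"
  using assms by real_asymp

section \<open>Test functions and their convolution with the kernel\<close>

lemma small_deriv_measurable: "{a. small_deriv k e n x a} \<in> sets borel"
proof -
  have "closed {a. poly (poly_of_roots n x) a = 0}"
    by (intro closed_Collect_eq continuous_intros)
  moreover have "closed {a. norm (poly ((pderiv ^^ k) (poly_of_roots n x)) a) \<le>
      exp (- e * n) * norm (poly (poly_of_roots n x) a)}"
    by (intro closed_Collect_le continuous_intros)
  ultimately have "closed {a. small_deriv k e n x a}"
    unfolding small_deriv_def by (rule closed_Collect_disj)
  then show ?thesis by (rule borel_closed)
qed

lemma compact_support_uniformly_continuous: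
  fixes f :: "'a :: euclidean_space \<Rightarrow> real"
  assumes f: "continuous_on UNIV f" and supp: "\<And>a. a \<notin> ball 0 R \<Longrightarrow> f a = 0" and "0 < e"
  obtains d where "0 < d" "\<And>a b. dist a b < d \<Longrightarrow> \<bar>f a - f b\<bar> < e"
proof -
  have "uniformly_continuous_on (cball 0 (R + 1)) f"
    using f by (intro compact_uniformly_continuous) (auto intro: continuous_on_subset)
  then obtain d where d: "d > 0"
    "\<And>a b. a \<in> cball 0 (R + 1) \<Longrightarrow> b \<in> cball 0 (R + 1) \<Longrightarrow> dist a b < d \<Longrightarrow> dist (f a) (f b) < e"
    unfolding uniformly_continuous_on_def using \<open>0 < e\<close> by metis
  show ?thesis
  proof (rule that[of "min d 1"])
    fix a b :: 'a assume ab: "dist a b < min d 1"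
    show "\<bar>f a - f b\<bar> < e"
    proof (cases "a \<in> cball 0 (R + 1) \<and> b \<in> cball 0 (R + 1)")
      case True
      then show ?thesis using d(2)[of a b] ab by (auto simp: dist_real_def)
    next
      case False
      have "dist 0 a \<le> dist 0 b + dist a b" "dist 0 b \<le> dist 0 a + dist a b"
        by (metis dist_commute dist_triangle, metis dist_triangle)
      then have "a \<notin> ball 0 R" "b \<notin> ball 0 R"
        using False ab by auto
      then show ?thesis using supp \<open>0 < e\<close> by simp
    qed
  qed (use d in auto)
qed

text \<open>The kernel centred at \<open>w\<close> vanishes outside the disc of radius
  \<open>r\<close>, and inside this disc \<open>f a\<close> differs from \<open>f w\<close> by at
  most \<open>\<omega>\<close>.\<close>

lemma
  fixes f :: "complex \<Rightarrow> real"
  assumes f: "continuous_on UNIV f" "\<And>a. 0 \<le> f a" "\<And>a. f a \<le> F"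
    and r: "0 < r" and om: "\<And>a b. dist a b < r \<Longrightarrow> \<bar>f a - f b\<bar> \<le> \<omega>"
  shows integrable_convolution_kernel: "integrable lborel (\<lambda>a. f a * log_kernel r (a - w))"
    and convolution_kernel_ge: "r\<^sup>2 * kernel_mass * (f w - \<omega>) \<le> (\<integral>a. f a * log_kernel r (a - w) \<partial>lborel)"
    and convolution_kernel_le: "(\<integral>a. f a * log_kernel r (a - w) \<partial>lborel) \<le> r\<^sup>2 * kernel_mass * (f w + \<omega>)"
proof -
  note [measurable] = borel_measurable_continuous_onI[OF f(1)]
  have close: "\<bar>f a - f w\<bar> * log_kernel r (a - w) \<le> \<omega> * log_kernel r (a - w)" for a
  proof (cases "dist a w < r")
    case True
    then show ?thesis
      using om by (intro mult_right_mono log_kernel_nonneg) auto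
  next
    case False
    then show ?thesis
      using r by (simp add: log_kernel_eq_0 dist_norm)
  qed
  have up: "f a * log_kernel r (a - w) \<le> (f w + \<omega>) * log_kernel r (a - w)" for a
    using close[of a] mult_right_mono[OF abs_ge_self log_kernel_nonneg, of "f a - f w" r "a - w"]
    by (simp add: algebra_simps)
  have low: "(f w - \<omega>) * log_kernel r (a - w) \<le> f a * log_kernel r (a - w)" for a
    using close[of a] mult_right_mono[OF abs_ge_minus_self log_kernel_nonneg, of "f a - f w" r "a - w"]
    by (simp add: algebra_simps)
  show int: "integrable lborel (\<lambda>a. f a * log_kernel r (a - w))"
  proof (rule Bochner_Integration.integrable_bound)
    show "integrable lborel (\<lambda>a. F * log_kernel r (a - w))"
      by (intro integrable_mult_right integrable_log_kernel r)
    show "AE a in lborel. norm (f a * log_kernel r (a - w)) \<le> norm (F * log_kernel r (a - w))"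
    proof (rule AE_I2)
      fix a
      have "0 \<le> F" using f(2)[of a] f(3)[of a] by linarith
      then show "norm (f a * log_kernel r (a - w)) \<le> norm (F * log_kernel r (a - w))"
        using f(2,3)[of a] log_kernel_nonneg[of r "a - w"]
        by (simp add: abs_mult mult_right_mono)
    qed
  qed measurable
  have "(\<integral>a. (f w - \<omega>) * log_kernel r (a - w) \<partial>lborel) \<le> (\<integral>a. f a * log_kernel r (a - w) \<partial>lborel)"
    by (intro integral_mono int integrable_mult_right integrable_log_kernel r low)
  then show "r\<^sup>2 * kernel_mass * (f w - \<omega>) \<le> (\<integral>a. f a * log_kernel r (a - w) \<partial>lborel)"
    by (simp add: integral_log_kernel[OF r] mult.commute)
  have "(\<integral>a. f a * log_kernel r (a - w) \<partial>lborel) \<le> (\<integral>a. (f w + \<omega>) * log_kernel r (a - w) \<partial>lborel)"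
    by (intro integral_mono int integrable_mult_right integrable_log_kernel r up)
  then show "(\<integral>a. f a * log_kernel r (a - w) \<partial>lborel) \<le> r\<^sup>2 * kernel_mass * (f w + \<omega>)"
    by (simp add: integral_log_kernel[OF r] mult.commute)
qed

text \<open>\<open>f\<close> is compared with its convolution with the logarithmic kernel. On the exceptional set of
  centres the kernel is cut off at a height \<open>L\<close>; the excess is the kernel of radius
  \<open>r * exp (- L)\<close>, whose mass is small whatever the zeros are.\<close>
lemma sum_test_function_le:
  fixes f :: "complex \<Rightarrow> real" and \<epsilon> :: real
  assumes f: "continuous_on UNIV f" "\<And>a. 0 \<le> f a" and supp: "\<And>a. a \<notin> ball 0 R \<Longrightarrow> f a = 0"
    and \<epsilon>: "0 < \<epsilon>"
  obtains e \<eta> N where "0 < e" "0 < \<eta>"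
    "\<And>n x. N \<le> n \<Longrightarrow> measure lborel {a \<in> ball 0 R. small_deriv k e n x a} \<le> \<eta> \<Longrightarrow>
       (\<Sum>w\<in>#proots ((pderiv ^^ k) (poly_of_roots n x)). f w) \<le> (\<Sum>i=1..n. f (x i)) + \<epsilon> * n"
proof -
  have "compact (f ` cball 0 R)"
    using f(1) by (intro compact_continuous_image) (auto intro: continuous_on_subset)
  then obtain F0 where "\<And>y. y \<in> f ` cball 0 R \<Longrightarrow> \<bar>y\<bar> \<le> F0"
    using compact_imp_bounded bounded_iff by (metis real_norm_def)
  then have F0: "\<bar>f a\<bar> \<le> F0" if "a \<in> cball 0 R" for a
    using that by blast
  define F where "F = max F0 0 + 1"
  have F: "f a \<le> F" for a
    using F0[of a] supp[of a] by (cases "a \<in> ball 0 R") (auto simp: F_def)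
  have F1: "F \<ge> 1" by (simp add: F_def)
  have f_int: "integrable lborel f"
  proof (rule Bochner_Integration.integrable_bound)
    show "integrable lborel (\<lambda>a. F * indicator (ball 0 R) a :: real)"
      by (intro integrable_mult_right integrable_real_indicator) (use emeasure_lborel_ball_finite in \<open>auto simp: less_top[symmetric]\<close>)
    show "f \<in> borel_measurable lborel"
      using borel_measurable_continuous_onI[OF f(1)] by simp
    show "AE a in lborel. norm (f a) \<le> norm (F * indicator (ball 0 R) a :: real)"
      using supp f(2) F F1 by (intro AE_I2) (auto simp: indicator_def)
  qed
  define J where "J = (\<integral>a. f a \<partial>lborel)"
  have J: "J \<ge> 0"
    unfolding J_def using f(2) by simp
  \<comment> \<open>The oscillation enters three times: once at the zeros and at most twice at the
    roots, as \<open>1 + \<tau> \<le> 2\<close>. Together this is \<open>\<epsilon> / 8\<close>; the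
    potential comparison costs \<open>\<epsilon> / 4\<close>, and the ratio of masses, the bad area
    and the excess over the cutoff cost \<open>\<epsilon> / 8\<close> each.\<close>
  define \<omega> where "\<omega> = \<epsilon> / 24"
  have \<omega>: "\<omega> > 0" using \<epsilon> by (simp add: \<omega>_def)
  obtain d where d: "d > 0" "\<And>a b. dist a b < d \<Longrightarrow> \<bar>f a - f b\<bar> < \<omega>"
    using compact_support_uniformly_continuous[OF f(1) supp \<omega>] by blast
  \<comment> \<open>\<open>d\<close> and \<open>r\<close> are the outer and inner radii. Their
    kernel masses have ratio \<open>1 + \<tau>\<close>, so using two radii costs at most
    \<open>\<tau> * F\<close> per root.\<close>
  define \<tau> where "\<tau> = min 1 (\<epsilon> / (8 * F))"
  have \<tau>: "\<tau> > 0" "\<tau> \<le> 1" "\<tau> * F \<le> \<epsilon> / 8"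
    using \<epsilon> F1 by (auto simp: \<tau>_def min_def field_simps)
  define r where "r = d / sqrt (1 + \<tau>)"
  have r: "0 < r" "r < d" "d\<^sup>2 = (1 + \<tau>) * r\<^sup>2"
    using d(1) \<tau>(1) by (auto simp: r_def power_divide divide_less_eq)
  define m where "m = r\<^sup>2 * kernel_mass"
  have m: "m > 0"
    using r kernel_mass_pos by (simp add: m_def)
  have "((\<lambda>L. F * exp (- 2 * L)) \<longlongrightarrow> 0) at_top"
    by real_asymp
  then have "\<forall>\<^sub>F L in at_top. F * exp (- 2 * L) < \<epsilon> / 8"
    using \<epsilon> by (intro order_tendstoD(2)) auto
  moreover have "\<forall>\<^sub>F L :: real in at_top. 0 \<le> L"
    by (rule eventually_ge_at_top)
  ultimately obtain L where L: "0 \<le> L" "F * exp (- 2 * L) \<le> \<epsilon> / 8"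
    using eventually_happens'[OF trivial_limit_at_top_linorder eventually_conj] by (metis less_imp_le)
  define e where "e = \<epsilon> * m / (8 * (J + 1))"
  have e: "e > 0" "e * J / m \<le> \<epsilon> / 8"
    using \<epsilon> m J mult_left_mono[of "J / (J + 1)" 1 "\<epsilon> / 8"] by (auto simp: e_def)
  \<comment> \<open>On bad centres each zero contributes at most the cutoff height \<open>L\<close>,
    in total \<open>F * L * \<eta> * n\<close>. Hence \<open>L\<close> is fixed first and the
    admissible bad area afterwards.\<close>
  define \<eta> where "\<eta> = \<epsilon> * m / (8 * F * (L + 1))"
  have \<eta>: "\<eta> > 0"
    using \<epsilon> m F1 L by (simp add: \<eta>_def)
  have \<eta>2: "F * L * \<eta> / m \<le> \<epsilon> / 8"
  proof -
    have "F * L * \<eta> / m = \<epsilon> / 8 * (L / (L + 1))"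
      using m F1 by (simp add: \<eta>_def)
    also have "\<dots> \<le> \<epsilon> / 8 * 1"
      using \<epsilon> L by (intro mult_left_mono) auto
    finally show ?thesis by simp
  qed
  obtain K where K: "K \<ge> 0"
    "\<And>n x u D g b e. 1 \<le> n \<Longrightarrow> k \<le> n \<Longrightarrow>
      (\<And>v w. v = 0 \<or> r \<le> norm v \<and> norm v \<le> d \<Longrightarrow> (u v - w) * D v = g w + b w * v) \<Longrightarrow>
      (\<And>v. v = 0 \<or> r \<le> norm v \<and> norm v \<le> d \<Longrightarrow> 1 \<le> norm (D v) \<and> norm (D v) \<le> 1) \<Longrightarrow>
      (\<And>w. 1 \<le> norm (g w) + norm (b w)) \<Longrightarrow> \<not> small_deriv k e n x (u 0) \<Longrightarrow>
      (\<Sum>w\<in>#proots ((pderiv ^^ k) (poly_of_roots n x)). ln (max 1 (r * norm (b w) / norm (g w))))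
      \<le> K * (1 + ln (real n)) + e * n + (\<Sum>i=1..n. ln (max 1 (d * norm (b (x i)) / norm (g (x i)))))"
    using log_potential_le[OF r(1,2) zero_less_one zero_less_one, of k thesis] by blast
  obtain N0 where N0: "\<And>n. N0 \<le> n \<Longrightarrow> (K * J / m) * (1 + ln (real n)) \<le> \<epsilon> / 8 * real n"
    using eventually_ln_le[of "\<epsilon> / 8" "K * J / m"] \<epsilon> unfolding eventually_sequentially by auto
  show ?thesis
  proof (rule that[of e \<eta> "max N0 (k + 1)"])
    fix n x
    assume n: "max N0 (k + 1) \<le> n"
      and small: "measure lborel {a \<in> ball 0 R. small_deriv k e n x a} \<le> \<eta>"
    define B where "B = {a \<in> ball 0 R. small_deriv k e n x a}"
    define W where "W = proots ((pderiv ^^ k) (poly_of_roots n x))"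
    have sizeW: "size W \<le> n"
      by (simp add: W_def size_proots_complex degree_higher_pderiv)
    have B_eq: "B = ball 0 R \<inter> {a. small_deriv k e n x a}"
      by (auto simp: B_def)
    have B_sets: "B \<in> sets borel"
      unfolding B_eq by (intro sets.Int small_deriv_measurable) auto
    have "emeasure lborel B \<le> emeasure lborel (ball 0 R :: complex set)"
      by (rule emeasure_mono) (auto simp: B_def)
    then have B_fin: "emeasure lborel B < \<infinity>"
      using emeasure_lborel_ball_finite[of "0::complex" R] by (simp add: order_le_less_trans)
    define T where "T = K * (1 + ln (real n)) + e * n"
    have T: "T \<ge> 0"
      using K(1) n e by (simp add: T_def)
    define r2 where "r2 = r * exp (- L)"
    have r2: "r2 > 0" using r by (simp add: r2_def)
    have mu: "\<And>a b. dist a b < d \<Longrightarrow> \<bar>f a - f b\<bar> \<le> \<omega>" "\<And>a b. dist a b < r \<Longrightarrow> \<bar>f a - f b\<bar> \<le> \<omega>"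
      using d(2) r(2) by (smt (verit))+
    note cr = integrable_convolution_kernel[OF f F r(1) mu(2)] convolution_kernel_ge[OF f F r(1) mu(2)]
    note cd = integrable_convolution_kernel[OF f F d(1) mu(1)] convolution_kernel_le[OF f F d(1) mu(1)]
    have pointwise: "f a * (\<Sum>w\<in>#W. log_kernel r (a - w)) \<le>
        f a * T + (\<Sum>i=1..n. f a * log_kernel d (a - x i)) +
        (F * n * L * indicator B a + F * (\<Sum>w\<in>#W. log_kernel r2 (a - w)))" for a
    proof -
      have s2: "0 \<le> (\<Sum>w\<in>#W. log_kernel r2 (a - w))" and s1: "0 \<le> (\<Sum>i=1..n. f a * log_kernel d (a - x i))"
        by (auto intro!: sum_mset_nonneg sum_nonneg mult_nonneg_nonneg f log_kernel_nonneg)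
      have t1: "0 \<le> f a * T" and t2: "0 \<le> F * (\<Sum>w\<in>#W. log_kernel r2 (a - w))"
        and t3: "0 \<le> F * n * L * indicator B a"
        using f T F1 s2 L by simp_all
      consider "a \<notin> ball 0 R" | "a \<in> B" | "a \<in> ball 0 R" "a \<notin> B" by blast
      then show ?thesis
      proof cases
        case 1
        then show ?thesis using supp[of a] s1 t1 t2 t3 by simp
      next
        case 2
        have "(\<Sum>w\<in>#W. log_kernel r (a - w)) \<le> (\<Sum>w\<in>#W. L + log_kernel r2 (a - w))"
          unfolding r2_def by (intro sum_mset_mono log_kernel_le_shift L r)
        also have "\<dots> = size W * L + (\<Sum>w\<in>#W. log_kernel r2 (a - w))"
          by (simp add: sum_mset.distrib)
        also have "\<dots> \<le> n * L + (\<Sum>w\<in>#W. log_kernel r2 (a - w))"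
          using sizeW L by (simp add: mult_right_mono)
        finally have "f a * (\<Sum>w\<in>#W. log_kernel r (a - w)) \<le> F * (n * L + (\<Sum>w\<in>#W. log_kernel r2 (a - w)))"
          using f(2) F F1 by (intro mult_mono sum_mset_nonneg log_kernel_nonneg) auto
        then show ?thesis
          using 2 s1 t1 by (simp add: algebra_simps)
      next
        case 3
        then have good: "\<not> small_deriv k e n x a" by (simp add: B_def)
        have "(\<Sum>w\<in>#W. ln (max 1 (r * norm (1::complex) / norm (a - w)))) \<le>
            K * (1 + ln (real n)) + e * n + (\<Sum>i=1..n. ln (max 1 (d * norm (1::complex) / norm (a - x i))))"
          unfolding W_def
        proof (rule K(2)[where u = "\<lambda>v. a + v" and D = "\<lambda>_. 1" and g = "\<lambda>w. a - w" and b = "\<lambda>_. 1"])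
          show "\<not> small_deriv k e n x (a + 0)" using good by simp
        qed (use n in \<open>auto simp: algebra_simps\<close>)
        then have "(\<Sum>w\<in>#W. log_kernel r (a - w)) \<le> T + (\<Sum>i=1..n. log_kernel d (a - x i))"
          by (simp add: T_def log_kernel_def)
        then have "f a * (\<Sum>w\<in>#W. log_kernel r (a - w)) \<le> f a * (T + (\<Sum>i=1..n. log_kernel d (a - x i)))"
          by (rule mult_left_mono) (rule f)
        then show ?thesis
          using t2 t3 by (simp add: algebra_simps sum_distrib_left)
      qed
    qed
    have indB: "integrable lborel (indicator B :: complex \<Rightarrow> real)"
      using B_sets B_fin by simp
    have intL: "integrable lborel (\<lambda>a. \<Sum>w\<in>#W. f a * log_kernel r (a - w))"
      by (rule integrable_sum_mset) (rule cr)
    have intR1: "integrable lborel (\<lambda>a. \<Sum>i=1..n. f a * log_kernel d (a - x i))"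
      by (intro Bochner_Integration.integrable_sum cd)
    have intR2: "integrable lborel (\<lambda>a. \<Sum>w\<in>#W. log_kernel r2 (a - w))"
      by (rule integrable_sum_mset) (rule integrable_log_kernel[OF r2])
    have "m * ((\<Sum>w\<in>#W. f w) - \<omega> * size W) = (\<Sum>w\<in>#W. m * (f w - \<omega>))"
      by (rule sum_mset_minus_const[symmetric])
    also have "\<dots> \<le> (\<Sum>w\<in>#W. \<integral>a. f a * log_kernel r (a - w) \<partial>lborel)"
      unfolding m_def by (intro sum_mset_mono cr)
    also have "\<dots> = (\<integral>a. (\<Sum>w\<in>#W. f a * log_kernel r (a - w)) \<partial>lborel)"
      by (rule integral_sum_mset[symmetric]) (rule cr)
    also have "\<dots> \<le> (\<integral>a. f a * T + (\<Sum>i=1..n. f a * log_kernel d (a - x i)) +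
        (F * n * L * indicator B a + F * (\<Sum>w\<in>#W. log_kernel r2 (a - w))) \<partial>lborel)"
      using pointwise
      by (intro integral_mono intL Bochner_Integration.integrable_add intR1 integrable_mult_right
          integrable_mult_left intR2 f_int indB) (simp add: sum_mset_distrib_left)
    also have "\<dots> = J * T + (\<Sum>i=1..n. \<integral>a. f a * log_kernel d (a - x i) \<partial>lborel) +
        (F * n * L * measure lborel B + F * (\<Sum>w\<in>#W. \<integral>a. log_kernel r2 (a - w) \<partial>lborel))"
      using B_sets B_fin
      by (simp add: intR1 intR2 f_int indB cd integrable_log_kernel[OF r2] integral_sum_mset
          Bochner_Integration.integral_sum J_def)
    also have "\<dots> \<le> J * T + (\<Sum>i=1..n. d\<^sup>2 * kernel_mass * (f (x i) + \<omega>)) +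
        (F * n * L * \<eta> + F * (n * (r2\<^sup>2 * kernel_mass)))"
      using small L F1 J sizeW kernel_mass_pos
      by (intro add_mono mult_left_mono sum_mono cd(2))
        (auto simp: integral_log_kernel[OF r2] B_def intro!: mult_right_mono)
    also have "(\<Sum>i=1..n. d\<^sup>2 * kernel_mass * (f (x i) + \<omega>)) = m * ((1 + \<tau>) * ((\<Sum>i=1..n. f (x i)) + n * \<omega>))"
      by (simp add: r(3) m_def sum.distrib flip: sum_distrib_left)
    also have "r2\<^sup>2 * kernel_mass = m * exp (- 2 * L)"
      by (simp add: r2_def m_def power_mult_distrib flip: exp_double)
    also have "J * T + m * ((1 + \<tau>) * ((\<Sum>i=1..n. f (x i)) + n * \<omega>)) +
        (F * n * L * \<eta> + F * (n * (m * exp (- 2 * L)))) = m * ((J * T) / m +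
        (1 + \<tau>) * ((\<Sum>i=1..n. f (x i)) + n * \<omega>) + n * (F * L * \<eta> / m) + n * (F * exp (- 2 * L)))"
      using m by (simp add: distrib_left)
    finally have "(\<Sum>w\<in>#W. f w) - \<omega> * size W \<le> (J * T) / m +
        (1 + \<tau>) * ((\<Sum>i=1..n. f (x i)) + n * \<omega>) + n * (F * L * \<eta> / m) + n * (F * exp (- 2 * L))"
      using m by (simp only: mult_le_cancel_left_pos)
    then have "(\<Sum>w\<in>#W. f w) \<le> \<omega> * size W + (J * T) / m +
        (1 + \<tau>) * ((\<Sum>i=1..n. f (x i)) + n * \<omega>) + n * (F * L * \<eta> / m) + n * (F * exp (- 2 * L))"
      by simp
    also have "\<dots> \<le> \<omega> * n + \<epsilon> / 4 * n +
        ((\<Sum>i=1..n. f (x i)) + \<epsilon> / 8 * n + 2 * n * \<omega>) + n * (\<epsilon> / 8) + n * (\<epsilon> / 8)"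
    proof (intro add_mono mult_left_mono)
      have "(J * T) / m = K * J / m * (1 + ln (real n)) + (e * J / m) * n"
        by (simp add: T_def algebra_simps add_divide_distrib)
      also have "\<dots> \<le> \<epsilon> / 8 * n + \<epsilon> / 8 * n"
        using N0[of n] n e(2) by (intro add_mono mult_right_mono) auto
      finally show "(J * T) / m \<le> \<epsilon> / 4 * n" by simp
      have "(\<Sum>i=1..n. f (x i)) \<le> n * F"
        using sum_bounded_above[of "{1..n}" "\<lambda>i. f (x i)" F] F by simp
      then have "\<tau> * (\<Sum>i=1..n. f (x i)) \<le> \<tau> * (n * F)"
        using \<tau> by (intro mult_left_mono) auto
      also have "\<dots> = (\<tau> * F) * n" by simp
      also have "\<dots> \<le> \<epsilon> / 8 * n"
        using \<tau> by (intro mult_right_mono) auto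
      finally have "\<tau> * (\<Sum>i=1..n. f (x i)) \<le> \<epsilon> / 8 * n" .
      moreover have "\<tau> * (n * \<omega>) \<le> 1 * (n * \<omega>)"
        using \<tau> \<omega> by (intro mult_right_mono) auto
      ultimately show "(1 + \<tau>) * ((\<Sum>i=1..n. f (x i)) + n * \<omega>) \<le>
          (\<Sum>i=1..n. f (x i)) + \<epsilon> / 8 * n + 2 * n * \<omega>"
        by (simp add: algebra_simps)
    qed (use \<omega> sizeW \<eta>2 L in auto)
    also have "\<dots> \<le> (\<Sum>i=1..n. f (x i)) + \<epsilon> * n"
      using \<epsilon> by (simp add: \<omega>_def algebra_simps)
    finally show "(\<Sum>w\<in>#proots ((pderiv ^^ k) (poly_of_roots n x)). f w) \<le> (\<Sum>i=1..n. f (x i)) + \<epsilon> * n"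
      by (simp add: W_def)
  qed (use e \<eta> in auto)
qed

section \<open>Anticoncentration\<close>

text \<open>Modulus \<open>1\<close> at \<open>t\<close> forces \<open>iexp (t * \<psi> y)\<close>
  to be almost surely constant. But for a fixed pair with different values of \<open>\<psi>\<close>
  the two exponentials agree for countably many \<open>t\<close> only, so by Fubini, for almost
  every \<open>t\<close>, almost every pair with different values has different
  exponentials.\<close>

lemma AE_norm_char_less_1:
  fixes \<psi> :: "'a \<Rightarrow> real"
  assumes "prob_space \<mu>" and [measurable]: "\<psi> \<in> borel_measurable \<mu>"
    and nondeg: "\<not> (AE p in \<mu> \<Otimes>\<^sub>M \<mu>. \<psi> (fst p) = \<psi> (snd p))"
  shows "AE t in lborel. norm (\<integral>y. iexp (t * \<psi> y) \<partial>\<mu>) < 1"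
proof -
  interpret prob_space \<mu> by fact
  interpret P: pair_prob_space \<mu> \<mu> ..
  interpret Q: pair_sigma_finite lborel "\<mu> \<Otimes>\<^sub>M \<mu>" ..
  have "AE p in \<mu> \<Otimes>\<^sub>M \<mu>. AE t in lborel.
      \<not> (\<psi> (fst p) \<noteq> \<psi> (snd p) \<and> iexp (t * \<psi> (fst p)) = iexp (t * \<psi> (snd p)))"
  proof (rule AE_I2)
    fix p
    let ?a = "\<psi> (fst p)" and ?b = "\<psi> (snd p)"
    have "{t. ?a \<noteq> ?b \<and> iexp (t * ?a) = iexp (t * ?b)} \<subseteq>
        range (\<lambda>n::int. 2 * of_int n * pi / (?a - ?b))"
    proof safe
      fix t assume "?a \<noteq> ?b" "iexp (t * ?a) = iexp (t * ?b)"
      then obtain n :: int where "\<i> * (t * ?a) = \<i> * (t * ?b) + (of_int (2 * n) * pi) * \<i>"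
        by (auto simp: exp_eq)
      then have "\<i> * complex_of_real (t * ?a) = \<i> * complex_of_real (t * ?b + 2 * of_int n * pi)"
        by (simp add: algebra_simps)
      then have "t * ?a = t * ?b + 2 * of_int n * pi"
        by (metis complex_i_not_zero mult_left_cancel of_real_eq_iff)
      then have "t = 2 * of_int n * pi / (?a - ?b)"
        using \<open>?a \<noteq> ?b\<close> by (simp add: field_simps)
      then show "t \<in> range (\<lambda>n::int. 2 * of_int n * pi / (?a - ?b))" by blast
    qed
    then have "countable {t. ?a \<noteq> ?b \<and> iexp (t * ?a) = iexp (t * ?b)}"
      by (rule countable_subset) simp
    then have "{t. ?a \<noteq> ?b \<and> iexp (t * ?a) = iexp (t * ?b)} \<in> null_sets lborel"
      by (rule countable_imp_null_set_lborel)
    then show "AE t in lborel. \<not> (?a \<noteq> ?b \<and> iexp (t * ?a) = iexp (t * ?b))"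
      by (rule AE_I') auto
  qed
  then have "AE t in lborel. AE p in \<mu> \<Otimes>\<^sub>M \<mu>.
      \<not> (\<psi> (fst p) \<noteq> \<psi> (snd p) \<and> iexp (t * \<psi> (fst p)) = iexp (t * \<psi> (snd p)))"
    by (subst Q.AE_commute) measurable
  then show ?thesis
  proof eventually_elim
    fix t
    assume t: "AE p in \<mu> \<Otimes>\<^sub>M \<mu>. \<not> (\<psi> (fst p) \<noteq> \<psi> (snd p) \<and> iexp (t * \<psi> (fst p)) = iexp (t * \<psi> (snd p)))"
    define c where "c = (\<integral>y. iexp (t * \<psi> y) \<partial>\<mu>)"
    have int: "integrable \<mu> (\<lambda>y. iexp (t * \<psi> y))"
      by (rule integrable_const_bound[of _ 1]) auto
    have "norm c \<le> 1"
      unfolding c_def using integral_norm_bound[of \<mu> "\<lambda>y. iexp (t * \<psi> y)"] by (simp add: prob_space)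
    show "norm (\<integral>y. iexp (t * \<psi> y) \<partial>\<mu>) < 1"
    proof (rule ccontr)
      assume "\<not> norm (\<integral>y. iexp (t * \<psi> y) \<partial>\<mu>) < 1"
      then have nc: "norm c = 1"
        using \<open>norm c \<le> 1\<close> by (simp add: c_def)
      \<comment> \<open>Equality in the triangle inequality: after rotation by \<open>cnj c\<close>
        the nonnegative function \<open>1 - Re (...)\<close> has integral \<open>0\<close>, so it
        vanishes almost everywhere.\<close>
      have "(\<integral>y. 1 - Re (cnj c * iexp (t * \<psi> y)) \<partial>\<mu>) = 1 - Re (cnj c * c)"
    proof -
        have "integrable \<mu> (\<lambda>y. Re (cnj c * iexp (t * \<psi> y)))"
          by (intro integrable_Re integrable_mult_right int)
        then have "(\<integral>y. 1 - Re (cnj c * iexp (t * \<psi> y)) \<partial>\<mu>) = 1 - (\<integral>y. Re (cnj c * iexp (t * \<psi> y)) \<partial>\<mu>)"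
          by (subst Bochner_Integration.integral_diff) (auto simp: prob_space)
        also have "(\<integral>y. Re (cnj c * iexp (t * \<psi> y)) \<partial>\<mu>) = Re (\<integral>y. cnj c * iexp (t * \<psi> y) \<partial>\<mu>)"
          by (intro integral_Re integrable_mult_right int)
        also have "(\<integral>y. cnj c * iexp (t * \<psi> y) \<partial>\<mu>) = cnj c * c"
          unfolding c_def by (rule integral_mult_right_zero)
        finally show ?thesis .
      qed
      also have "cnj c * c = 1"
        using nc by (metis complex_norm_square mult.commute of_real_1 power_one)
      finally have "(\<integral>y. 1 - Re (cnj c * iexp (t * \<psi> y)) \<partial>\<mu>) = 0" by simp
      moreover have le: "Re (cnj c * iexp (t * \<psi> y)) \<le> 1" for y
        using complex_Re_le_cmod[of "cnj c * iexp (t * \<psi> y)"] nc by (simp add: norm_mult)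
      moreover have "integrable \<mu> (\<lambda>y. 1 - Re (cnj c * iexp (t * \<psi> y)))"
        using int by (intro Bochner_Integration.integrable_diff integrable_Re integrable_mult_right) auto
      ultimately have "AE y in \<mu>. 1 - Re (cnj c * iexp (t * \<psi> y)) = 0"
        by (subst (asm) integral_nonneg_eq_0_iff_AE) auto
      then have "AE y in \<mu>. iexp (t * \<psi> y) = c"
      proof eventually_elim
        fix y
        let ?z = "cnj c * iexp (t * \<psi> y)"
        assume "1 - Re ?z = 0"
        moreover have "norm ?z = 1" using nc by (simp add: norm_mult)
        ultimately have "?z = 1"
          by (simp add: cmod_def complex_eq_iff)
        then have "c * ?z = c" by simp
        then show "iexp (t * \<psi> y) = c"
          using \<open>cnj c * c = 1\<close> by (simp add: mult.assoc[symmetric] mult.commute[of c])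
      qed
      note ae = this
      have "AE p in \<mu> \<Otimes>\<^sub>M \<mu>. iexp (t * \<psi> (fst p)) = c"
      proof (rule P.AE_pair_measure)
        show "AE y in \<mu>. AE y' in \<mu>. iexp (t * \<psi> (fst (y, y'))) = c"
          using ae by eventually_elim simp
      qed measurable
      moreover have "AE p in \<mu> \<Otimes>\<^sub>M \<mu>. iexp (t * \<psi> (snd p)) = c"
      proof (rule P.AE_pair_measure)
        show "AE y in \<mu>. AE y' in \<mu>. iexp (t * \<psi> (snd (y, y'))) = c"
          using ae by simp
      qed measurable
      ultimately have "AE p in \<mu> \<Otimes>\<^sub>M \<mu>. \<psi> (fst p) = \<psi> (snd p)"
        using t
        by eventually_elim auto
      with nondeg show False by simp
    qed
  qed
qed

text \<open>\<open>exp (- W\<^sup>2 / 2)\<close> is the Gaussian average over \<open>t\<close> of \<open>iexp (t * W)\<close>.\<close>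
lemma expectation_exp_square_sum_diff:
  fixes \<psi> :: "'a \<Rightarrow> real"
  assumes \<mu>: "prob_space \<mu>" and [measurable]: "\<psi> \<in> borel_measurable \<mu>" and A: "finite A"
  defines "N \<equiv> PiM A (\<lambda>_. \<mu>)"
  shows "(\<integral>p. exp (- ((\<Sum>i\<in>A. \<psi> (fst p i)) - (\<Sum>i\<in>A. \<psi> (snd p i)))\<^sup>2 / 2) \<partial>(N \<Otimes>\<^sub>M N)) =
    (\<integral>t. norm (\<integral>y. iexp (t * \<psi> y) \<partial>\<mu>) ^ (2 * card A) \<partial>std_normal_distribution)"
proof -
  interpret prob_space \<mu> by fact
  interpret PP: product_prob_space "\<lambda>_. \<mu>" A ..
  interpret N: prob_space N unfolding N_def by (rule prob_space_PiM) (rule \<mu>)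
  interpret NN: pair_prob_space N N ..
  interpret G: real_distribution std_normal_distribution by (rule real_dist_normal_dist)
  interpret NG: pair_prob_space "N \<Otimes>\<^sub>M N" std_normal_distribution ..
  define S where "S x = (\<Sum>i\<in>A. \<psi> (x i))" for x
  define ch where "ch t = (\<integral>y. iexp (t * \<psi> y) \<partial>\<mu>)" for t
  have S_meas [measurable]: "S \<in> borel_measurable N"
    unfolding S_def N_def by measurable
  have int1: "integrable N (\<lambda>x. iexp (t * S x))" for t
    by (rule N.integrable_const_bound[of _ 1]) auto
  have prod: "(\<integral>x. iexp (t * S x) \<partial>N) = ch t ^ card A" for t
  proof -
    have "(\<integral>x. iexp (t * S x) \<partial>N) = (\<integral>x. (\<Prod>i\<in>A. iexp (t * \<psi> (x i))) \<partial>N)"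
      using A by (simp add: S_def sum_distrib_left exp_sum)
    also have "\<dots> = (\<Prod>i\<in>A. ch t)"
      unfolding N_def ch_def
      by (rule PP.product_integral_prod[OF A]) (rule integrable_const_bound[of _ 1]; simp)
    finally show ?thesis by simp
  qed
  have int2: "integrable (N \<Otimes>\<^sub>M N) (\<lambda>p. iexp (t * S (fst p)) * iexp (- (t * S (snd p))))" for t
    by (rule NN.P.integrable_const_bound[of _ 1]) (auto simp: norm_mult)
  have "complex_of_real (\<integral>p. exp (- (S (fst p) - S (snd p))\<^sup>2 / 2) \<partial>(N \<Otimes>\<^sub>M N)) =
      (\<integral>p. char std_normal_distribution (S (fst p) - S (snd p)) \<partial>(N \<Otimes>\<^sub>M N))"
    by (simp add: char_std_normal_distribution)
  also have "\<dots> = (\<integral>p. (\<integral>t. iexp (t * S (fst p)) * iexp (- (t * S (snd p))) \<partial>std_normal_distribution) \<partial>(N \<Otimes>\<^sub>M N))"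
    unfolding char_def
    by (intro Bochner_Integration.integral_cong refl)
      (simp add: exp_add[symmetric] algebra_simps)
  also have "\<dots> = (\<integral>t. (\<integral>p. iexp (t * S (fst p)) * iexp (- (t * S (snd p))) \<partial>(N \<Otimes>\<^sub>M N)) \<partial>std_normal_distribution)"
    by (rule NG.Fubini_integral[symmetric])
      (rule NG.P.integrable_const_bound[of _ 1]; auto simp: norm_mult split_beta')
  also have "\<dots> = (\<integral>t. complex_of_real (norm (ch t) ^ (2 * card A)) \<partial>std_normal_distribution)"
  proof (intro Bochner_Integration.integral_cong refl)
    fix t
    have "(\<integral>p. iexp (t * S (fst p)) * iexp (- (t * S (snd p))) \<partial>(N \<Otimes>\<^sub>M N)) =
        (\<integral>x. (\<integral>x'. iexp (t * S x) * iexp (- (t * S x')) \<partial>N) \<partial>N)"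
      using NN.integral_fst'[OF int2] by simp
    also have "\<dots> = ch t ^ card A * cnj (ch t ^ card A)"
    proof -
      have "(\<integral>x'. iexp (- (t * S x')) \<partial>N) = (\<integral>x'. cnj (iexp (t * S x')) \<partial>N)"
        by (simp add: exp_cnj)
      also have "\<dots> = cnj (ch t ^ card A)"
        by (simp only: Bochner_Integration.integral_cnj prod)
      finally show ?thesis
        by (simp only: integral_mult_right_zero integral_mult_left_zero prod)
    qed
    also have "\<dots> = complex_of_real (norm (ch t) ^ (2 * card A))"
      by (simp only: complex_norm_square[symmetric] norm_power power_mult[symmetric] mult.commute[of 2] of_real_power)
    finally show "(\<integral>p. iexp (t * S (fst p)) * iexp (- (t * S (snd p))) \<partial>(N \<Otimes>\<^sub>M N)) =
        complex_of_real (norm (ch t) ^ (2 * card A))" .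
  qed
  finally show ?thesis
    unfolding integral_complex_of_real of_real_eq_iff S_def ch_def .
qed

text \<open>The Gaussian average of \<open>norm (ch t) ^ (2 * m)\<close> tends to \<open>0\<close>
  by dominated convergence. It equals the expectation of \<open>exp (- W\<^sup>2 / 2)\<close>, which
  is at least \<open>1/2\<close> where \<open>|W| < 1\<close>, so Markov's inequality applies. The
  law of \<open>W\<close> depends on \<open>A\<close> only through its size, hence one
  \<open>m\<close> serves all \<open>A\<close>.\<close>

lemma random_walk_spreads_real:
  fixes \<psi> :: "'a \<Rightarrow> real"
  assumes \<mu>: "prob_space \<mu>" and [measurable]: "\<psi> \<in> borel_measurable \<mu>"
    and nondeg: "\<not> (AE p in \<mu> \<Otimes>\<^sub>M \<mu>. \<psi> (fst p) = \<psi> (snd p))" and \<eta>: "0 < \<eta>"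
  obtains m where "\<And>A :: nat set. finite A \<Longrightarrow> card A = m \<Longrightarrow>
    measure (PiM A (\<lambda>_. \<mu>) \<Otimes>\<^sub>M PiM A (\<lambda>_. \<mu>))
      {p \<in> space (PiM A (\<lambda>_. \<mu>) \<Otimes>\<^sub>M PiM A (\<lambda>_. \<mu>)).
        \<bar>(\<Sum>i\<in>A. \<psi> (fst p i)) - (\<Sum>i\<in>A. \<psi> (snd p i))\<bar> < 1} \<le> \<eta>"
proof -
  interpret prob_space \<mu> by fact
  interpret G: real_distribution std_normal_distribution by (rule real_dist_normal_dist)
  define ch where "ch t = (\<integral>y. iexp (t * \<psi> y) \<partial>\<mu>)" for t
  have ch_meas [measurable]: "ch \<in> borel_measurable borel"
    unfolding ch_def by measurable
  have ch_le: "norm (ch t) \<le> 1" for t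
    unfolding ch_def using integral_norm_bound[of \<mu> "\<lambda>y. iexp (t * \<psi> y)"] by (simp add: prob_space)
  have "AE t in lborel. norm (ch t) < 1"
    unfolding ch_def by (rule AE_norm_char_less_1) fact+
  then have AE: "AE t in std_normal_distribution. norm (ch t) < 1"
    by (auto simp: AE_density)
  have "(\<lambda>m. \<integral>t. norm (ch t) ^ (2 * m) \<partial>std_normal_distribution) \<longlonglongrightarrow> (\<integral>t. 0 \<partial>std_normal_distribution)"
  proof (rule integral_dominated_convergence[where w = "\<lambda>_. 1"])
    show "AE t in std_normal_distribution. (\<lambda>m. norm (ch t) ^ (2 * m)) \<longlonglongrightarrow> 0"
      using AE
    proof eventually_elim
      fix t assume "norm (ch t) < 1"
      then have "(norm (ch t))\<^sup>2 < 1" by (simp add: abs_square_less_1)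
      then show "(\<lambda>m. norm (ch t) ^ (2 * m)) \<longlonglongrightarrow> 0"
        unfolding power_mult by (intro LIMSEQ_realpow_zero) auto
    qed
    show "AE t in std_normal_distribution. norm (norm (ch t) ^ (2 * m)) \<le> 1" for m
      using ch_le by (auto intro!: power_le_one)
  qed auto
  then have "(\<lambda>m. \<integral>t. norm (ch t) ^ (2 * m) \<partial>std_normal_distribution) \<longlonglongrightarrow> 0" by simp
  then have "\<forall>\<^sub>F m in sequentially. (\<integral>t. norm (ch t) ^ (2 * m) \<partial>std_normal_distribution) < \<eta> / 2"
    using \<eta> by (intro order_tendstoD(2)) auto
  then obtain m where m: "(\<integral>t. norm (ch t) ^ (2 * m) \<partial>std_normal_distribution) < \<eta> / 2"
    by (meson eventually_sequentially order_refl)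
  show ?thesis
  proof (rule that)
    fix A :: "nat set" assume A: "finite A" "card A = m"
    let ?N = "PiM A (\<lambda>_. \<mu>)"
    interpret N: prob_space ?N by (rule prob_space_PiM) (rule \<mu>)
    interpret NN: pair_prob_space ?N ?N ..
    define W where "W p = (\<Sum>i\<in>A. \<psi> (fst p i)) - (\<Sum>i\<in>A. \<psi> (snd p i))" for p
    have [measurable]: "W \<in> borel_measurable (?N \<Otimes>\<^sub>M ?N)"
      unfolding W_def by measurable
    have "measure (?N \<Otimes>\<^sub>M ?N) {p \<in> space (?N \<Otimes>\<^sub>M ?N). \<bar>W p\<bar> < 1} \<le>
        measure (?N \<Otimes>\<^sub>M ?N) {p \<in> space (?N \<Otimes>\<^sub>M ?N). 1/2 \<le> exp (- (W p)\<^sup>2 / 2)}"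
    proof (rule NN.P.finite_measure_mono)
      show "{p \<in> space (?N \<Otimes>\<^sub>M ?N). \<bar>W p\<bar> < 1} \<subseteq> {p \<in> space (?N \<Otimes>\<^sub>M ?N). 1/2 \<le> exp (- (W p)\<^sup>2 / 2)}"
      proof safe
        fix p assume "\<bar>W p\<bar> < 1"
        then have "(W p)\<^sup>2 \<le> 1" by (simp add: abs_square_le_1)
        then have "1/2 \<le> 1 + (- (W p)\<^sup>2 / 2)" by simp
        also have "\<dots> \<le> exp (- (W p)\<^sup>2 / 2)" by (rule exp_ge_add_one_self)
        finally show "1/2 \<le> exp (- (W p)\<^sup>2 / 2)" .
      qed
    qed measurable
    also have "\<dots> \<le> (\<integral>p. exp (- (W p)\<^sup>2 / 2) \<partial>(?N \<Otimes>\<^sub>M ?N)) / (1/2)"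
      by (rule integral_Markov_inequality_measure[where A = "space (?N \<Otimes>\<^sub>M ?N)" and u = "\<lambda>p. exp (- (W p)\<^sup>2 / 2)"])
        (auto intro!: NN.P.integrable_const_bound[of _ 1])
    also have "(\<integral>p. exp (- (W p)\<^sup>2 / 2) \<partial>(?N \<Otimes>\<^sub>M ?N)) = (\<integral>t. norm (ch t) ^ (2 * m) \<partial>std_normal_distribution)"
      unfolding W_def ch_def A(2)[symmetric] by (rule expectation_exp_square_sum_diff) fact+
    also have "\<dots> / (1/2) \<le> \<eta>"
      using m by simp
    finally show "measure (?N \<Otimes>\<^sub>M ?N) {p \<in> space (?N \<Otimes>\<^sub>M ?N).
        \<bar>(\<Sum>i\<in>A. \<psi> (fst p i)) - (\<Sum>i\<in>A. \<psi> (snd p i))\<bar> < 1} \<le> \<eta>"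
      by (simp add: W_def)
  qed
qed

text \<open>A nondegenerate complex variable has a nondegenerate real or imaginary part
  \<open>g\<close>, and \<open>|g x| \<le> norm x\<close> transfers the real case.\<close>

lemma random_walk_spreads:
  fixes \<phi> :: "'a \<Rightarrow> complex"
  assumes \<mu>: "prob_space \<mu>" and \<phi>[measurable]: "\<phi> \<in> borel_measurable \<mu>"
    and nondeg: "\<not> (AE p in \<mu> \<Otimes>\<^sub>M \<mu>. \<phi> (fst p) = \<phi> (snd p))" and \<eta>: "0 < \<eta>"
  obtains m where "\<And>A :: nat set. finite A \<Longrightarrow> card A = m \<Longrightarrow>
    measure (PiM A (\<lambda>_. \<mu>) \<Otimes>\<^sub>M PiM A (\<lambda>_. \<mu>))
      {p \<in> space (PiM A (\<lambda>_. \<mu>) \<Otimes>\<^sub>M PiM A (\<lambda>_. \<mu>)).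
        norm ((\<Sum>i\<in>A. \<phi> (fst p i)) - (\<Sum>i\<in>A. \<phi> (snd p i))) < 1} \<le> \<eta>"
proof -
  have "\<not> (AE p in \<mu> \<Otimes>\<^sub>M \<mu>. Re (\<phi> (fst p)) = Re (\<phi> (snd p))) \<or>
      \<not> (AE p in \<mu> \<Otimes>\<^sub>M \<mu>. Im (\<phi> (fst p)) = Im (\<phi> (snd p)))"
    using nondeg by (auto simp: complex_eq_iff)
  then obtain g :: "complex \<Rightarrow> real" where g [measurable]: "g \<in> borel_measurable borel"
    and lin: "\<And>x y. g (x - y) = g x - g y" "\<And>(f :: nat \<Rightarrow> complex) A. g (sum f A) = (\<Sum>i\<in>A. g (f i))"
    and le: "\<And>x. \<bar>g x\<bar> \<le> norm x"
    and nd: "\<not> (AE p in \<mu> \<Otimes>\<^sub>M \<mu>. g (\<phi> (fst p)) = g (\<phi> (snd p)))"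
    by (elim disjE) (blast intro: borel_measurable_Re borel_measurable_Im abs_Re_le_cmod abs_Im_le_cmod
      minus_complex.sel Re_sum Im_sum)+
  have gm: "(\<lambda>y. g (\<phi> y)) \<in> borel_measurable \<mu>"
    by measurable
  obtain m where m: "\<And>A :: nat set. finite A \<Longrightarrow> card A = m \<Longrightarrow>
    measure (PiM A (\<lambda>_. \<mu>) \<Otimes>\<^sub>M PiM A (\<lambda>_. \<mu>))
      {p \<in> space (PiM A (\<lambda>_. \<mu>) \<Otimes>\<^sub>M PiM A (\<lambda>_. \<mu>)).
        \<bar>(\<Sum>i\<in>A. g (\<phi> (fst p i))) - (\<Sum>i\<in>A. g (\<phi> (snd p i)))\<bar> < 1} \<le> \<eta>"
    using random_walk_spreads_real[OF \<mu> gm nd \<eta>] by blast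
  show ?thesis
  proof (rule that)
    fix A :: "nat set" assume A: "finite A" "card A = m"
    let ?N = "PiM A (\<lambda>_. \<mu>)"
    interpret N: prob_space ?N by (rule prob_space_PiM) (rule \<mu>)
    interpret NN: pair_prob_space ?N ?N ..
    have "measure (?N \<Otimes>\<^sub>M ?N) {p \<in> space (?N \<Otimes>\<^sub>M ?N).
        norm ((\<Sum>i\<in>A. \<phi> (fst p i)) - (\<Sum>i\<in>A. \<phi> (snd p i))) < 1} \<le>
      measure (?N \<Otimes>\<^sub>M ?N) {p \<in> space (?N \<Otimes>\<^sub>M ?N).
        \<bar>(\<Sum>i\<in>A. g (\<phi> (fst p i))) - (\<Sum>i\<in>A. g (\<phi> (snd p i)))\<bar> < 1}"
    proof (rule NN.P.finite_measure_mono)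
      have "\<bar>(\<Sum>i\<in>A. g (\<phi> (fst p i))) - (\<Sum>i\<in>A. g (\<phi> (snd p i)))\<bar> \<le>
          norm ((\<Sum>i\<in>A. \<phi> (fst p i)) - (\<Sum>i\<in>A. \<phi> (snd p i)))" for p
        using le[of "(\<Sum>i\<in>A. \<phi> (fst p i)) - (\<Sum>i\<in>A. \<phi> (snd p i))"] by (simp add: lin)
      then show "{p \<in> space (?N \<Otimes>\<^sub>M ?N). norm ((\<Sum>i\<in>A. \<phi> (fst p i)) - (\<Sum>i\<in>A. \<phi> (snd p i))) < 1} \<subseteq>
        {p \<in> space (?N \<Otimes>\<^sub>M ?N). \<bar>(\<Sum>i\<in>A. g (\<phi> (fst p i))) - (\<Sum>i\<in>A. g (\<phi> (snd p i)))\<bar> < 1}"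
        by (auto intro: le_less_trans)
    qed measurable
    also have "\<dots> \<le> \<eta>" by (rule m[OF A])
    finally show "measure (?N \<Otimes>\<^sub>M ?N) {p \<in> space (?N \<Otimes>\<^sub>M ?N).
        norm ((\<Sum>i\<in>A. \<phi> (fst p i)) - (\<Sum>i\<in>A. \<phi> (snd p i))) < 1} \<le> \<eta>" .
  qed
qed

section \<open>Anticoncentration of elementary symmetric polynomials\<close>

lemma coeff_prod_linear_0_1:
  fixes y :: "'i \<Rightarrow> 'b :: comm_ring_1"
  assumes "finite I"
  shows "coeff (\<Prod>i\<in>I. [:1, y i:]) 0 = 1 \<and> coeff (\<Prod>i\<in>I. [:1, y i:]) (Suc 0) = (\<Sum>i\<in>I. y i)"
  using assms by (induction I) auto

text \<open>General constant terms cover both the factors \<open>1 + \<phi> (x i) * X\<close> and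
  the factors \<open>a - z i + X\<close>.\<close>

lemma measurable_coeff_prod_linear [measurable (raw)]:
  fixes g h :: "'i \<Rightarrow> 'a \<Rightarrow> complex"
  assumes "finite I" "\<And>i. i \<in> I \<Longrightarrow> g i \<in> borel_measurable M" "\<And>i. i \<in> I \<Longrightarrow> h i \<in> borel_measurable M"
  shows "(\<lambda>x. coeff (\<Prod>i\<in>I. [:g i x, h i x:]) j) \<in> borel_measurable M"
  using assms
proof (induction I arbitrary: j)
  case (insert i I)
  have [measurable]: "g i \<in> borel_measurable M" "h i \<in> borel_measurable M"
    "(\<lambda>x. coeff (\<Prod>i\<in>I. [:g i x, h i x:]) j) \<in> borel_measurable M" for j
    using insert by auto
  have "(\<lambda>x. coeff (\<Prod>i\<in>insert i I. [:g i x, h i x:]) j) =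
      (\<lambda>x. g i x * coeff (\<Prod>i\<in>I. [:g i x, h i x:]) j +
        (case j of 0 \<Rightarrow> 0 | Suc j' \<Rightarrow> h i x * coeff (\<Prod>i\<in>I. [:g i x, h i x:]) j'))"
    using insert.hyps by (auto simp: fun_eq_iff coeff_pCons split: nat.splits)
  then show ?case
    by (simp only:) (cases j; simp)
qed simp

text \<open>Regrouping by the coefficients of \<open>H\<close>: since \<open>G\<close> has no
  constant term, the top index drops from \<open>Suc k\<close> to \<open>k\<close>, where the new
  coefficient is \<open>c (Suc k) * coeff G 1\<close>. This is the degree reduction of the induction
  on \<open>k\<close>.\<close>

lemma sum_coeff_mult_no_constant:
  fixes G H :: "complex poly"
  assumes "coeff G 0 = 0"
  shows "(\<Sum>l\<le>Suc k. c l * coeff (H * G) l) =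
    (\<Sum>m\<le>k. (\<Sum>l=Suc m..Suc k. c l * coeff G (l - m)) * coeff H m)"
proof -
  have "(\<Sum>l\<le>Suc k. c l * coeff (H * G) l) = (\<Sum>l\<le>Suc k. \<Sum>m<l. c l * coeff H m * coeff G (l - m))"
  proof (rule sum.cong)
    fix l
    have "coeff (H * G) l = (\<Sum>m<l. coeff H m * coeff G (l - m))"
      using assms by (simp add: coeff_mult lessThan_Suc_atMost[symmetric])
    then show "c l * coeff (H * G) l = (\<Sum>m<l. c l * coeff H m * coeff G (l - m))"
      by (simp add: sum_distrib_left mult.assoc)
  qed simp
  also have "\<dots> = (\<Sum>m<Suc k. \<Sum>l=Suc m..Suc k. c l * coeff H m * coeff G (l - m))"
    by (rule sum.nested_swap')
  also have "\<dots> = (\<Sum>m\<le>k. (\<Sum>l=Suc m..Suc k. c l * coeff G (l - m)) * coeff H m)"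
    unfolding lessThan_Suc_atMost by (simp add: sum_distrib_left sum_distrib_right mult_ac del: sum.cl_ivl_Suc)
  finally show ?thesis .
qed

text \<open>Cauchy-Schwarz: given the second variable, two independent copies of the first one satisfy
  the condition with the squared conditional probability.\<close>
lemma decoupling:
  assumes "prob_space N1" "prob_space N2"
    and [measurable]: "{p \<in> space (N2 \<Otimes>\<^sub>M N1). Q (fst p) (snd p)} \<in> sets (N2 \<Otimes>\<^sub>M N1)"
    and [measurable]: "V \<in> sets (N1 \<Otimes>\<^sub>M N1)"
    and small: "\<And>x x'. x \<in> space N1 \<Longrightarrow> x' \<in> space N1 \<Longrightarrow> (x, x') \<notin> V \<Longrightarrow>
      measure N2 {y \<in> space N2. Q y x \<and> Q y x'} \<le> \<eta>"
    and "0 \<le> \<eta>"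
  shows "(measure (N2 \<Otimes>\<^sub>M N1) {p \<in> space (N2 \<Otimes>\<^sub>M N1). Q (fst p) (snd p)})\<^sup>2 \<le> measure (N1 \<Otimes>\<^sub>M N1) V + \<eta>"
proof -
  interpret N1: prob_space N1 by fact
  interpret N2: prob_space N2 by fact
  interpret P11: pair_prob_space N1 N1 ..
  interpret P21: pair_prob_space N2 N1 ..
  interpret P: pair_prob_space N2 "N1 \<Otimes>\<^sub>M N1" ..
  define E where "E = {p \<in> space (N2 \<Otimes>\<^sub>M N1). Q (fst p) (snd p)}"
  define q where "q y = measure N1 (Pair y -` E)" for y
  define E2 where "E2 = {p \<in> space (N2 \<Otimes>\<^sub>M (N1 \<Otimes>\<^sub>M N1)). Q (fst p) (fst (snd p)) \<and> Q (fst p) (snd (snd p))}"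
  have E [measurable]: "E \<in> sets (N2 \<Otimes>\<^sub>M N1)"
    unfolding E_def by fact
  have "{p \<in> space (N2 \<Otimes>\<^sub>M (N1 \<Otimes>\<^sub>M N1)). (fst p, fst (snd p)) \<in> E \<and> (fst p, snd (snd p)) \<in> E} \<in> sets (N2 \<Otimes>\<^sub>M (N1 \<Otimes>\<^sub>M N1))"
    by measurable
  also have "{p \<in> space (N2 \<Otimes>\<^sub>M (N1 \<Otimes>\<^sub>M N1)). (fst p, fst (snd p)) \<in> E \<and> (fst p, snd (snd p)) \<in> E} = E2"
    by (auto simp: E_def E2_def space_pair_measure)
  finally have E2 [measurable]: "E2 \<in> sets (N2 \<Otimes>\<^sub>M (N1 \<Otimes>\<^sub>M N1))" .
  have q_meas [measurable]: "q \<in> borel_measurable N2"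
    unfolding q_def measure_def using N1.measurable_emeasure_Pair[OF E] by measurable
  have q01: "0 \<le> q y" "q y \<le> 1" for y
    by (auto simp: q_def)
  have qi: "integrable N2 q" "integrable N2 (\<lambda>y. (q y)\<^sup>2)"
    using q01 by (auto intro!: N2.integrable_const_bound[of _ 1] simp: power_le_one)
  have "ennreal (measure (N2 \<Otimes>\<^sub>M N1) E) = (\<integral>\<^sup>+y. ennreal (q y) \<partial>N2)"
    by (simp add: P21.P.emeasure_eq_measure[symmetric] N1.emeasure_pair_measure_alt[OF E]
        N1.emeasure_eq_measure q_def)
  also have "\<dots> = ennreal (\<integral>y. q y \<partial>N2)"
    using qi q01 by (intro nn_integral_eq_integral) auto
  finally have mE: "measure (N2 \<Otimes>\<^sub>M N1) E = (\<integral>y. q y \<partial>N2)"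
    using q01 by (simp add: ennreal_inj)
  have "ennreal (measure (N2 \<Otimes>\<^sub>M (N1 \<Otimes>\<^sub>M N1)) E2) = (\<integral>\<^sup>+y. emeasure (N1 \<Otimes>\<^sub>M N1) (Pair y -` E2) \<partial>N2)"
    by (simp add: P.P.emeasure_eq_measure[symmetric] P11.P.emeasure_pair_measure_alt[OF E2])
  also have "\<dots> = (\<integral>\<^sup>+y. ennreal ((q y)\<^sup>2) \<partial>N2)"
  proof (rule nn_integral_cong)
    fix y assume y: "y \<in> space N2"
    have "Pair y -` E2 = (Pair y -` E) \<times> (Pair y -` E)"
      using y by (auto simp: E_def E2_def space_pair_measure)
    moreover have "Pair y -` E \<in> sets N1"
      by (rule sets_Pair1[OF E])
    ultimately show "emeasure (N1 \<Otimes>\<^sub>M N1) (Pair y -` E2) = ennreal ((q y)\<^sup>2)"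
      by (simp add: N1.emeasure_pair_measure_Times N1.emeasure_eq_measure q_def power2_eq_square ennreal_mult)
  qed
  also have "\<dots> = ennreal (\<integral>y. (q y)\<^sup>2 \<partial>N2)"
    using qi by (intro nn_integral_eq_integral) auto
  finally have mE2: "measure (N2 \<Otimes>\<^sub>M (N1 \<Otimes>\<^sub>M N1)) E2 = (\<integral>y. (q y)\<^sup>2 \<partial>N2)"
    by (simp add: ennreal_inj)
  \<comment> \<open>\<open>q y\<close> is the conditional probability given \<open>y\<close>, and
    its variance is nonnegative.\<close>
  have "(measure (N2 \<Otimes>\<^sub>M N1) E)\<^sup>2 \<le> measure (N2 \<Otimes>\<^sub>M (N1 \<Otimes>\<^sub>M N1)) E2"
    unfolding mE mE2 using N2.variance_positive[of q] N2.variance_eq[OF qi] by simp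
  also have "ennreal (measure (N2 \<Otimes>\<^sub>M (N1 \<Otimes>\<^sub>M N1)) E2) \<le> ennreal (measure (N1 \<Otimes>\<^sub>M N1) V + \<eta>)"
  proof -
    \<comment> \<open>Integration in the other order, with the two copies fixed: the section has
      measure at most \<open>1\<close> over \<open>V\<close> and at most \<open>\<eta>\<close>
      elsewhere.\<close>
    have "emeasure (N2 \<Otimes>\<^sub>M (N1 \<Otimes>\<^sub>M N1)) E2 = (\<integral>\<^sup>+p. emeasure N2 ((\<lambda>y. (y, p)) -` E2) \<partial>(N1 \<Otimes>\<^sub>M N1))"
      by (rule P.emeasure_pair_measure_alt2[OF E2])
    also have "\<dots> \<le> (\<integral>\<^sup>+p. indicator V p + ennreal \<eta> \<partial>(N1 \<Otimes>\<^sub>M N1))"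
    proof (rule nn_integral_mono)
      fix p assume p: "p \<in> space (N1 \<Otimes>\<^sub>M N1)"
      show "emeasure N2 ((\<lambda>y. (y, p)) -` E2) \<le> indicator V p + ennreal \<eta>"
      proof (cases "p \<in> V")
        case True
        have "emeasure N2 ((\<lambda>y. (y, p)) -` E2) \<le> 1"
          by (rule N2.emeasure_le_1)
        then show ?thesis
          using True by (simp add: add_increasing2)
      next
        case False
        have "(\<lambda>y. (y, p)) -` E2 = {y \<in> space N2. Q y (fst p) \<and> Q y (snd p)}"
          using p by (auto simp: E2_def space_pair_measure)
        then show ?thesis
          using small[of "fst p" "snd p"] p False
          by (auto simp: N2.emeasure_eq_measure space_pair_measure intro!: ennreal_leI)
      qed
    qed
    also have "\<dots> = emeasure (N1 \<Otimes>\<^sub>M N1) V + ennreal \<eta>"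
      by (subst nn_integral_add) (auto simp: P11.P.emeasure_space_1)
    also have "\<dots> = ennreal (measure (N1 \<Otimes>\<^sub>M N1) V + \<eta>)"
      using \<open>0 \<le> \<eta>\<close> by (simp add: P11.P.emeasure_eq_measure)
    finally show ?thesis
      by (simp add: P.P.emeasure_eq_measure)
  qed
  then have "measure (N2 \<Otimes>\<^sub>M (N1 \<Otimes>\<^sub>M N1)) E2 \<le> measure (N1 \<Otimes>\<^sub>M N1) V + \<eta>"
    using \<open>0 \<le> \<eta>\<close> by (subst (asm) ennreal_le_iff) auto
  finally show ?thesis
    by (simp add: E_def)
qed

text \<open>Splitting \<open>I\<close> into a block \<open>A\<close> of fixed size and the rest, the difference over two copies
  of \<open>A\<close> is a combination of the same kind for \<open>k - 1\<close>, whose leading coefficient is \<open>c k\<close> times an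
  increment of a random walk. The lower coefficients are arbitrary, as the difference does not
  control them.\<close>
lemma anticoncentration_nondegenerate:
  fixes \<phi> :: "'a \<Rightarrow> complex"
  assumes \<mu>: "prob_space \<mu>" and \<phi>[measurable]: "\<phi> \<in> borel_measurable \<mu>"
    and nondeg: "\<not> (AE p in \<mu> \<Otimes>\<^sub>M \<mu>. \<phi> (fst p) = \<phi> (snd p))" and "0 < \<eta>"
  shows "\<exists>N \<delta>. 0 < \<delta> \<and> (\<forall>(I :: nat set) c. finite I \<longrightarrow> N \<le> card I \<longrightarrow> 1 \<le> norm (c k) \<longrightarrow>
    measure (PiM I (\<lambda>_. \<mu>)) {x \<in> space (PiM I (\<lambda>_. \<mu>)).
      norm (\<Sum>j\<le>k. c j * coeff (\<Prod>i\<in>I. [:1, \<phi> (x i):]) j) \<le> \<delta>} \<le> \<eta>)"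
  using \<open>0 < \<eta>\<close>
proof (induction k arbitrary: \<eta>)
  case 0
  have empty: "{x \<in> space (PiM I (\<lambda>_. \<mu>)). norm (\<Sum>j\<le>0. c j * coeff (\<Prod>i\<in>I. [:1, \<phi> (x i):]) j) \<le> 1/2} = {}"
    if "finite I" "1 \<le> norm (c 0)" for I :: "nat set" and c
  proof -
    have "norm (\<Sum>j\<le>0. c j * coeff (\<Prod>i\<in>I. [:1, \<phi> (x i):]) j) = norm (c 0)" for x
      using coeff_prod_linear_0_1[OF that(1), of "\<lambda>i. \<phi> (x i)"] by simp
    then show ?thesis using that(2) by auto
  qed
  have "measure (PiM I (\<lambda>_. \<mu>)) {x \<in> space (PiM I (\<lambda>_. \<mu>)).
      norm (\<Sum>j\<le>0. c j * coeff (\<Prod>i\<in>I. [:1, \<phi> (x i):]) j) \<le> 1/2} \<le> \<eta>"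
    if "finite I" "1 \<le> norm (c 0)" for I :: "nat set" and c
    unfolding empty[where c = c, OF that] using 0 by simp
  then show ?case
    by (intro exI[of _ 0] exI[of _ "1/2"]) auto
next
  case (Suc k)
  \<comment> \<open>Decoupling bounds the square of the probability, so the target is
    \<open>\<eta>\<^sup>2\<close>; one half is spent on the random walk and the other on the
    induction hypothesis. Likewise the threshold becomes \<open>\<delta> / 2\<close>, because two
    values below it are subtracted.\<close>
  have \<eta>': "0 < \<eta>\<^sup>2 / 2" using Suc.prems by simp
  obtain m where m: "\<And>A :: nat set. finite A \<Longrightarrow> card A = m \<Longrightarrow>
    measure (PiM A (\<lambda>_. \<mu>) \<Otimes>\<^sub>M PiM A (\<lambda>_. \<mu>))
      {p \<in> space (PiM A (\<lambda>_. \<mu>) \<Otimes>\<^sub>M PiM A (\<lambda>_. \<mu>)).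
        norm ((\<Sum>i\<in>A. \<phi> (fst p i)) - (\<Sum>i\<in>A. \<phi> (snd p i))) < 1} \<le> \<eta>\<^sup>2 / 2"
    using random_walk_spreads[OF \<mu> \<phi> nondeg \<eta>'] by blast
  obtain N \<delta> where \<delta>: "0 < \<delta>" and IH: "\<And>(B :: nat set) d. finite B \<Longrightarrow> N \<le> card B \<Longrightarrow> 1 \<le> norm (d k) \<Longrightarrow>
    measure (PiM B (\<lambda>_. \<mu>)) {x \<in> space (PiM B (\<lambda>_. \<mu>)).
      norm (\<Sum>j\<le>k. d j * coeff (\<Prod>i\<in>B. [:1, \<phi> (x i):]) j) \<le> \<delta>} \<le> \<eta>\<^sup>2 / 2"
    using Suc.IH[OF \<eta>'] by blast
  have "measure (PiM I (\<lambda>_. \<mu>)) {x \<in> space (PiM I (\<lambda>_. \<mu>)).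
      norm (\<Sum>j\<le>Suc k. c j * coeff (\<Prod>i\<in>I. [:1, \<phi> (x i):]) j) \<le> \<delta> / 2} \<le> \<eta>"
    if I: "finite I" "N + m \<le> card I" and c: "1 \<le> norm (c (Suc k))" for I :: "nat set" and c
  proof -
    obtain A where A: "A \<subseteq> I" "card A = m" "finite A"
      using obtain_subset_with_card_n[of m I] I by (metis add_leD2 rev_finite_subset)
    define B where "B = I - A"
    have B: "finite B" "N \<le> card B" "B \<inter> A = {}" "B \<union> A = I"
      using I A by (auto simp: B_def card_Diff_subset)
    let ?A = "PiM A (\<lambda>_. \<mu>)" and ?B = "PiM B (\<lambda>_. \<mu>)" and ?I = "PiM I (\<lambda>_. \<mu>)"
    interpret A: prob_space ?A by (rule prob_space_PiM) (rule \<mu>)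
    interpret B: prob_space ?B by (rule prob_space_PiM) (rule \<mu>)
    interpret \<mu>: prob_space \<mu> by (rule \<mu>)
    interpret PS: product_sigma_finite "\<lambda>_ :: nat. \<mu>" ..
    define F where "F J x = (\<Prod>i\<in>J. [:1, \<phi> (x i):])" for J :: "nat set" and x
    define Q where "Q y x \<longleftrightarrow> norm (\<Sum>j\<le>Suc k. c j * coeff (F B y * F A x) j) \<le> \<delta> / 2" for y x
    define V where "V = {p \<in> space (?A \<Otimes>\<^sub>M ?A). norm ((\<Sum>i\<in>A. \<phi> (fst p i)) - (\<Sum>i\<in>A. \<phi> (snd p i))) < 1}"
    have [measurable]: "(\<lambda>p. coeff (F B (fst p)) j) \<in> borel_measurable (?B \<Otimes>\<^sub>M ?A)"
      "(\<lambda>p. coeff (F A (snd p)) j) \<in> borel_measurable (?B \<Otimes>\<^sub>M ?A)" for j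
      unfolding F_def using A B by measurable
    have Fm [measurable]: "(\<lambda>x. coeff (F I x) j) \<in> borel_measurable ?I" for j
      unfolding F_def using I by measurable
    have Fmerge: "F I (merge B A p) = F B (fst p) * F A (snd p)" for p
    proof -
      obtain y x where p: "p = (y, x)" by fastforce
      have "F I (merge B A p) = (\<Prod>i\<in>B. [:1, \<phi> (merge B A p i):]) * (\<Prod>i\<in>A. [:1, \<phi> (merge B A p i):])"
        unfolding F_def B(4)[symmetric] using A B by (intro prod.union_disjoint) auto
      also have "\<dots> = F B y * F A x"
        unfolding F_def p using B(3) by (intro arg_cong2[of _ _ _ _ "(*)"] prod.cong) (auto simp: merge_def)
      finally show ?thesis by (simp add: p)
    qed
    have "measure ?I {x \<in> space ?I. norm (\<Sum>j\<le>Suc k. c j * coeff (F I x) j) \<le> \<delta> / 2} =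
        measure (distr (?B \<Otimes>\<^sub>M ?A) ?I (merge B A)) {x \<in> space ?I. norm (\<Sum>j\<le>Suc k. c j * coeff (F I x) j) \<le> \<delta> / 2}"
      using PS.distr_merge[of B A] A B by simp
    also have "\<dots> = measure (?B \<Otimes>\<^sub>M ?A) {p \<in> space (?B \<Otimes>\<^sub>M ?A). Q (fst p) (snd p)}"
    proof (subst measure_distr)
      show "merge B A \<in> measurable (?B \<Otimes>\<^sub>M ?A) ?I"
        using measurable_merge[of B A "\<lambda>_. \<mu>"] B(4) by simp
      then have "merge B A p \<in> space ?I" if "p \<in> space (?B \<Otimes>\<^sub>M ?A)" for p
        using that by (rule measurable_space)
      then have "merge B A -` {x \<in> space ?I. norm (\<Sum>j\<le>Suc k. c j * coeff (F I x) j) \<le> \<delta> / 2} \<inter> space (?B \<Otimes>\<^sub>M ?A) =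
          {p \<in> space (?B \<Otimes>\<^sub>M ?A). Q (fst p) (snd p)}"
        by (auto simp: Fmerge Q_def simp del: sum.atMost_Suc)
      then show "measure (?B \<Otimes>\<^sub>M ?A) (merge B A -` {x \<in> space ?I. norm (\<Sum>j\<le>Suc k. c j * coeff (F I x) j) \<le> \<delta> / 2} \<inter> space (?B \<Otimes>\<^sub>M ?A)) =
          measure (?B \<Otimes>\<^sub>M ?A) {p \<in> space (?B \<Otimes>\<^sub>M ?A). Q (fst p) (snd p)}"
        by simp
    qed measurable
    finally have eq: "measure ?I {x \<in> space ?I. norm (\<Sum>j\<le>Suc k. c j * coeff (F I x) j) \<le> \<delta> / 2} =
        measure (?B \<Otimes>\<^sub>M ?A) {p \<in> space (?B \<Otimes>\<^sub>M ?A). Q (fst p) (snd p)}" .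
    have "(measure (?B \<Otimes>\<^sub>M ?A) {p \<in> space (?B \<Otimes>\<^sub>M ?A). Q (fst p) (snd p)})\<^sup>2 \<le> measure (?A \<Otimes>\<^sub>M ?A) V + \<eta>\<^sup>2 / 2"
    proof (rule decoupling)
      show "{p \<in> space (?B \<Otimes>\<^sub>M ?A). Q (fst p) (snd p)} \<in> sets (?B \<Otimes>\<^sub>M ?A)"
        unfolding Q_def coeff_mult by measurable
      show "V \<in> sets (?A \<Otimes>\<^sub>M ?A)"
        unfolding V_def by measurable
      fix x x' assume x: "x \<in> space ?A" "x' \<in> space ?A" "(x, x') \<notin> V"
      define G where "G = F A x - F A x'"
      have G0: "coeff G 0 = 0"
        using coeff_prod_linear_0_1[OF A(3), of "\<lambda>i. \<phi> (x i)"] coeff_prod_linear_0_1[OF A(3), of "\<lambda>i. \<phi> (x' i)"]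
        by (simp add: G_def F_def)
      have "coeff G 1 = (\<Sum>i\<in>A. \<phi> (x i)) - (\<Sum>i\<in>A. \<phi> (x' i))"
        using coeff_prod_linear_0_1[OF A(3), of "\<lambda>i. \<phi> (x i)"] coeff_prod_linear_0_1[OF A(3), of "\<lambda>i. \<phi> (x' i)"]
        by (simp add: G_def F_def)
      then have G1: "1 \<le> norm (coeff G 1)"
        using x by (simp add: V_def space_pair_measure)
      \<comment> \<open>These coefficients depend on \<open>x\<close> and \<open>x'\<close>, which
        are fixed here. This is why the induction hypothesis has to be uniform in the
        coefficients.\<close>
      define d where "d j = (\<Sum>l=Suc j..Suc k. c l * coeff G (l - j))" for j
      have dk: "1 \<le> norm (d k)"
      proof -
        have "d k = c (Suc k) * coeff G 1" by (simp add: d_def)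
        moreover have "1 * 1 \<le> norm (c (Suc k)) * norm (coeff G 1)"
          using c G1 by (intro mult_mono) auto
        ultimately show ?thesis by (simp add: norm_mult)
      qed
      have "measure ?B {y \<in> space ?B. Q y x \<and> Q y x'} \<le>
          measure ?B {y \<in> space ?B. norm (\<Sum>j\<le>k. d j * coeff (\<Prod>i\<in>B. [:1, \<phi> (y i):]) j) \<le> \<delta>}"
      proof (rule B.finite_measure_mono)
        show "{y \<in> space ?B. norm (\<Sum>j\<le>k. d j * coeff (\<Prod>i\<in>B. [:1, \<phi> (y i):]) j) \<le> \<delta>} \<in> B.events"
          using B(1) by measurable
        show "{y \<in> space ?B. Q y x \<and> Q y x'} \<subseteq> {y \<in> space ?B. norm (\<Sum>j\<le>k. d j * coeff (\<Prod>i\<in>B. [:1, \<phi> (y i):]) j) \<le> \<delta>}"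
        proof safe
          fix y assume Q: "Q y x" "Q y x'"
          have "(\<Sum>j\<le>k. d j * coeff (F B y) j) = (\<Sum>j\<le>Suc k. c j * coeff (F B y * G) j)"
            unfolding d_def by (rule sum_coeff_mult_no_constant[OF G0, symmetric])
          also have "\<dots> = (\<Sum>j\<le>Suc k. c j * coeff (F B y * F A x) j) - (\<Sum>j\<le>Suc k. c j * coeff (F B y * F A x') j)"
            by (simp only: G_def right_diff_distrib coeff_diff sum_subtractf)
          also have "norm \<dots> \<le> \<delta> / 2 + \<delta> / 2"
            using Q unfolding Q_def by (intro order_trans[OF norm_triangle_ineq4] add_mono)
          finally show "norm (\<Sum>j\<le>k. d j * coeff (\<Prod>i\<in>B. [:1, \<phi> (y i):]) j) \<le> \<delta>"
            by (simp add: F_def)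
        qed
      qed
      also have "\<dots> \<le> \<eta>\<^sup>2 / 2"
        by (rule IH[where d = d, OF B(1,2) dk])
      finally show "measure ?B {y \<in> space ?B. Q y x \<and> Q y x'} \<le> \<eta>\<^sup>2 / 2" .
    qed (use \<eta>' A.prob_space_axioms B.prob_space_axioms in auto)
    also have "\<dots> \<le> \<eta>\<^sup>2"
      using m[OF A(3,2)] by (simp add: V_def)
    finally show ?thesis
      using Suc.prems unfolding eq[symmetric] F_def by (simp only: power2_le_iff_abs_le abs_of_nonneg measure_nonneg less_imp_le)
  qed
  then show ?case
    using \<delta> by (intro exI[of _ "N + m"] exI[of _ "\<delta> / 2"]) auto
qed

text \<open>If \<open>\<phi>\<close> is degenerate, it is almost surely a nonzero constant, and the
  coefficient is its \<open>k\<close>-th power times \<open>card I choose k\<close>, which is at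
  least \<open>1\<close> once \<open>k \<le> card I\<close>.\<close>

lemma anticoncentration:
  fixes \<phi> :: "'a \<Rightarrow> complex"
  assumes \<mu>: "prob_space \<mu>" and \<phi>[measurable]: "\<phi> \<in> borel_measurable \<mu>"
    and nz: "AE y in \<mu>. \<phi> y \<noteq> 0" and \<eta>: "0 < \<eta>"
  obtains N \<delta> where "0 < \<delta>" "\<And>I :: nat set. finite I \<Longrightarrow> N \<le> card I \<Longrightarrow>
    measure (PiM I (\<lambda>_. \<mu>)) {x \<in> space (PiM I (\<lambda>_. \<mu>)). norm (coeff (\<Prod>i\<in>I. [:1, \<phi> (x i):]) k) \<le> \<delta>} \<le> \<eta>"
proof (cases "AE p in \<mu> \<Otimes>\<^sub>M \<mu>. \<phi> (fst p) = \<phi> (snd p)")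
  case False
  obtain N \<delta> where \<delta>: "0 < \<delta>" and *: "\<And>(I :: nat set) c. finite I \<Longrightarrow> N \<le> card I \<Longrightarrow> 1 \<le> norm (c k) \<Longrightarrow>
    measure (PiM I (\<lambda>_. \<mu>)) {x \<in> space (PiM I (\<lambda>_. \<mu>)).
      norm (\<Sum>j\<le>k. c j * coeff (\<Prod>i\<in>I. [:1, \<phi> (x i):]) j) \<le> \<delta>} \<le> \<eta>"
    using anticoncentration_nondegenerate[OF \<mu> \<phi> False \<eta>, of k] by blast
  show ?thesis
  proof (rule that[OF \<delta>])
    fix I :: "nat set" assume I: "finite I" "N \<le> card I"
    have "(\<Sum>j\<le>k. (if j = k then 1 else 0) * a j) = (\<Sum>j\<le>k. if j = k then a j else 0)"
      for a :: "nat \<Rightarrow> complex"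
      by (rule sum.cong) auto
    then have "(\<Sum>j\<le>k. (if j = k then 1 else 0) * a j) = a k" for a :: "nat \<Rightarrow> complex"
      by simp
    then show "measure (PiM I (\<lambda>_. \<mu>)) {x \<in> space (PiM I (\<lambda>_. \<mu>)). norm (coeff (\<Prod>i\<in>I. [:1, \<phi> (x i):]) k) \<le> \<delta>} \<le> \<eta>"
      using *[OF I, of "\<lambda>j. if j = k then 1 else 0"] by simp
  qed
next
  case True
  interpret prob_space \<mu> by fact
  interpret P: pair_prob_space \<mu> \<mu> ..
  have "AE y in \<mu>. AE y' in \<mu>. \<phi> y = \<phi> y'"
    using P.AE_pair[OF True] by simp
  with nz have "AE y in \<mu>. \<phi> y \<noteq> 0 \<and> (AE y' in \<mu>. \<phi> y = \<phi> y')"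
    by eventually_elim simp
  then obtain y where y: "\<phi> y \<noteq> 0" "AE y' in \<mu>. \<phi> y = \<phi> y'"
    using eventually_happens'[OF ae_filter_bot] by blast
  define \<delta> where "\<delta> = norm (\<phi> y) ^ k / 2"
  have \<delta>: "0 < \<delta>" using y by (simp add: \<delta>_def)
  show ?thesis
  proof (rule that[OF \<delta>])
    fix I :: "nat set" assume I: "finite I" "k \<le> card I"
    interpret I: prob_space "PiM I (\<lambda>_. \<mu>)" by (rule prob_space_PiM) (rule \<mu>)
    have "AE x in PiM I (\<lambda>_. \<mu>). \<forall>i\<in>I. \<phi> (x i) = \<phi> y"
    proof (intro AE_finite_allI[OF I(1)])
      fix i assume "i \<in> I"
      then show "AE x in PiM I (\<lambda>_. \<mu>). \<phi> (x i) = \<phi> y"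
        by (intro AE_PiM_component \<mu>) (use y(2) in \<open>auto elim: eventually_mono\<close>)
    qed
    then have "AE x in PiM I (\<lambda>_. \<mu>). \<not> norm (coeff (\<Prod>i\<in>I. [:1, \<phi> (x i):]) k) \<le> \<delta>"
    proof eventually_elim
      fix x assume "\<forall>i\<in>I. \<phi> (x i) = \<phi> y"
      then have "(\<Prod>i\<in>I. [:1, \<phi> (x i):]) = [:1, \<phi> y:] ^ card I" by simp
      then have "norm (coeff (\<Prod>i\<in>I. [:1, \<phi> (x i):]) k) = real (card I choose k) * norm (\<phi> y) ^ k"
        using I by (simp add: coeff_linear_poly_power norm_mult norm_power)
      moreover have "1 * norm (\<phi> y) ^ k \<le> real (card I choose k) * norm (\<phi> y) ^ k"
        using I by (intro mult_right_mono) (auto simp: Suc_leI)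
      moreover have "norm (\<phi> y) ^ k > 0" using y by simp
      ultimately show "\<not> norm (coeff (\<Prod>i\<in>I. [:1, \<phi> (x i):]) k) \<le> \<delta>"
        unfolding \<delta>_def by linarith
    qed
    then have "measure (PiM I (\<lambda>_. \<mu>)) {x \<in> space (PiM I (\<lambda>_. \<mu>)). norm (coeff (\<Prod>i\<in>I. [:1, \<phi> (x i):]) k) \<le> \<delta>} = 0"
      using I(1) by (subst I.prob_eq_0) (auto elim!: eventually_mono)
    then show "measure (PiM I (\<lambda>_. \<mu>)) {x \<in> space (PiM I (\<lambda>_. \<mu>)). norm (coeff (\<Prod>i\<in>I. [:1, \<phi> (x i):]) k) \<le> \<delta>} \<le> \<eta>"
      using \<eta> by simp
  qed
qed

section \<open>Convergence in probability\<close>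

locale iid_sequence = prob_space M for M :: "'w measure" +
  fixes \<mu> :: "complex measure" and z :: "nat \<Rightarrow> 'w \<Rightarrow> complex"
  assumes sets_\<mu>: "sets \<mu> = sets borel"
    and indep: "indep_vars (\<lambda>_. borel) z {1..}"
    and distr_z: "\<And>i. i \<ge> 1 \<Longrightarrow> distr M borel (z i) = \<mu>"
begin

lemma measurable_z [measurable (raw)]: "i \<ge> 1 \<Longrightarrow> z i \<in> borel_measurable M"
  using indep by (auto simp: indep_vars_def)

lemma prob_space_\<mu>: "prob_space \<mu>"
  using prob_space_distr[of "z 1" borel] distr_z[of 1] by simp

lemma measurable_\<mu> [measurable_cong]: "sets \<mu> = sets borel"
  by (rule sets_\<mu>)

lemma space_\<mu> [simp]: "space \<mu> = UNIV"
  using sets_eq_imp_space_eq[OF sets_\<mu>] by simp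

lemma prob_z:
  assumes "i \<ge> 1" "A \<in> sets borel"
  shows "prob {\<omega> \<in> space M. z i \<omega> \<in> A} = measure \<mu> A"
proof -
  have "measure \<mu> A = measure (distr M borel (z i)) A"
    using assms by (simp add: distr_z)
  also have "\<dots> = prob (z i -` A \<inter> space M)"
    using assms by (intro measure_distr) auto
  also have "z i -` A \<inter> space M = {\<omega> \<in> space M. z i \<omega> \<in> A}" by auto
  finally show ?thesis ..
qed

lemma prob_joint:
  assumes I: "I \<noteq> {}" "I \<subseteq> {1..}"
    and A: "{x \<in> space (PiM I (\<lambda>_. \<mu>)). Q x} \<in> sets (PiM I (\<lambda>_. \<mu>))"
  shows "prob {\<omega> \<in> space M. Q (\<lambda>i\<in>I. z i \<omega>)} = measure (PiM I (\<lambda>_. \<mu>)) {x \<in> space (PiM I (\<lambda>_. \<mu>)). Q x}"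
proof -
  let ?X = "\<lambda>\<omega>. \<lambda>i\<in>I. z i \<omega>"
  have "indep_vars (\<lambda>_. borel) z I"
    using indep I(2) by (rule indep_vars_subset)
  then have "distr M (PiM I (\<lambda>_. borel)) ?X = PiM I (\<lambda>i. distr M borel (z i))"
    using I by (subst (asm) indep_vars_iff_distr_eq_PiM') (auto intro!: measurable_z)
  also have "\<dots> = PiM I (\<lambda>_. \<mu>)"
    using I by (intro PiM_cong) (auto intro!: distr_z)
  finally have eq: "PiM I (\<lambda>_. \<mu>) = distr M (PiM I (\<lambda>_. borel)) ?X" ..
  have X: "?X \<in> measurable M (PiM I (\<lambda>_. borel))"
    using I by (intro measurable_restrict measurable_z) auto
  have A': "{x \<in> space (PiM I (\<lambda>_. \<mu>)). Q x} \<in> sets (PiM I (\<lambda>_. borel))"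
    using A unfolding eq by simp
  have sp: "space (PiM I (\<lambda>_. \<mu>)) = space (PiM I (\<lambda>_. borel))"
    unfolding eq by simp
  have "measure (PiM I (\<lambda>_. \<mu>)) {x \<in> space (PiM I (\<lambda>_. \<mu>)). Q x} =
      measure (distr M (PiM I (\<lambda>_. borel)) ?X) {x \<in> space (PiM I (\<lambda>_. \<mu>)). Q x}"
    by (subst eq) simp
  also have "\<dots> = prob (?X -` {x \<in> space (PiM I (\<lambda>_. \<mu>)). Q x} \<inter> space M)"
    by (rule measure_distr[OF X A'])
  also have "?X -` {x \<in> space (PiM I (\<lambda>_. \<mu>)). Q x} \<inter> space M = {\<omega> \<in> space M. Q (?X \<omega>)}"
    using measurable_space[OF X] by (auto simp: sp)
  finally show ?thesis ..
qed

text \<open>Only the exceptional event is required to be measurable, not \<open>Q\<close>.\<close>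
definition likely :: "real \<Rightarrow> ('w \<Rightarrow> bool) \<Rightarrow> bool" where
  "likely \<gamma> Q \<longleftrightarrow> (\<exists>E\<in>events. prob E \<le> \<gamma> \<and> (\<forall>\<omega>\<in>space M - E. Q \<omega>))"

lemma likelyI: "{\<omega> \<in> space M. \<not> Q \<omega>} \<in> events \<Longrightarrow> prob {\<omega> \<in> space M. \<not> Q \<omega>} \<le> \<gamma> \<Longrightarrow> likely \<gamma> Q"
  unfolding likely_def by (rule bexI[of _ "{\<omega> \<in> space M. \<not> Q \<omega>}"]) auto

lemma likely_conj:
  assumes "likely \<gamma> Q" "likely \<gamma>' Q'"
  shows "likely (\<gamma> + \<gamma>') (\<lambda>\<omega>. Q \<omega> \<and> Q' \<omega>)"
proof -
  obtain E E' where E: "E \<in> events" "prob E \<le> \<gamma>" "\<forall>\<omega>\<in>space M - E. Q \<omega>"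
    "E' \<in> events" "prob E' \<le> \<gamma>'" "\<forall>\<omega>\<in>space M - E'. Q' \<omega>"
    using assms unfolding likely_def by blast
  then have "prob (E \<union> E') \<le> \<gamma> + \<gamma>'"
    using measure_Un_le[of E M E'] by linarith
  then show ?thesis
    unfolding likely_def using E by (intro bexI[of _ "E \<union> E'"]) auto
qed

lemma likely_mono:
  assumes "likely \<gamma> Q" "\<gamma> \<le> \<gamma>'" "\<And>\<omega>. \<omega> \<in> space M \<Longrightarrow> Q \<omega> \<Longrightarrow> Q' \<omega>"
  shows "likely \<gamma>' Q'"
  using assms unfolding likely_def by (meson DiffD1 order_trans)

lemma eventually_likelyI:
  assumes "(\<lambda>n. prob {\<omega> \<in> space M. \<not> Q n \<omega>}) \<longlonglongrightarrow> 0" "\<And>n. {\<omega> \<in> space M. \<not> Q n \<omega>} \<in> events" "0 < \<gamma>"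
  shows "\<forall>\<^sub>F n in sequentially. likely \<gamma> (Q n)"
proof -
  have "\<forall>\<^sub>F n in sequentially. prob {\<omega> \<in> space M. \<not> Q n \<omega>} < \<gamma>"
    using order_tendstoD(2)[OF assms(1,3)] .
  then show ?thesis
    by eventually_elim (use assms(2) in \<open>auto intro!: likelyI\<close>)
qed

section \<open>Bad centres have small area with high probability\<close>

lemma small_deriv_eq_coeff:
  "small_deriv k e n x a \<longleftrightarrow> coeff (\<Prod>i=1..n. [:a - x i, 1:]) 0 = 0 \<or>
    norm (fact k * coeff (\<Prod>i=1..n. [:a - x i, 1:]) k) \<le> exp (- e * n) * norm (coeff (\<Prod>i=1..n. [:a - x i, 1:]) 0)"
proof -
  have "poly_of_roots n x \<circ>\<^sub>p [:a, 1:] = (\<Prod>i=1..n. [:a - x i, 1:])"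
    unfolding poly_of_roots_def pcompose_prod by (simp add: pcompose_pCons)
  then show ?thesis
    using poly_higher_pderiv[of 0 "poly_of_roots n x" a] poly_higher_pderiv[of k "poly_of_roots n x" a]
    unfolding small_deriv_def by simp
qed

text \<open>Measurability is needed jointly in the sample point and the centre, for Fubini. The form
  with coefficients reduces it to products of linear factors.\<close>

lemma small_deriv_event [measurable]:
  "Measurable.pred (M \<Otimes>\<^sub>M borel) (\<lambda>p. small_deriv k e n (\<lambda>i. z i (fst p)) (snd p))"
proof -
  have [measurable]: "(\<lambda>p. coeff (\<Prod>i=1..n. [:snd p - z i (fst p), 1:]) j) \<in> borel_measurable (M \<Otimes>\<^sub>M borel)" for j
    by (rule measurable_coeff_prod_linear) (auto intro!: borel_measurable_diff measurable_compose[OF measurable_fst] measurable_z)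
  show ?thesis
    unfolding small_deriv_eq_coeff by measurable
qed

lemma small_deriv_event_at: "{\<omega> \<in> space M. small_deriv k e n (\<lambda>i. z i \<omega>) a} \<in> events"
proof -
  have "(\<lambda>\<omega>. (\<omega>, a)) \<in> measurable M (M \<Otimes>\<^sub>M borel)" by measurable
  from measurable_compose[OF this small_deriv_event] show ?thesis
    by (simp add: pred_def)
qed

text \<open>Away from the roots the quotient at \<open>a\<close> is \<open>fact k\<close> times the
  elementary symmetric polynomial of the \<open>\<phi> (z i)\<close>. By anticoncentration it
  exceeds a fixed \<open>\<delta>\<close> with high probability, whereas
  \<open>exp (- e * n)\<close> tends to \<open>0\<close>.\<close>

lemma small_deriv_unlikely:
  assumes a: "measure \<mu> {a} = 0" and e: "0 < e"
  shows "(\<lambda>n. prob {\<omega> \<in> space M. small_deriv k e n (\<lambda>i. z i \<omega>) a}) \<longlonglongrightarrow> 0"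
proof (rule order_tendstoI)
  show "\<forall>\<^sub>F n in sequentially. c < prob {\<omega> \<in> space M. small_deriv k e n (\<lambda>i. z i \<omega>) a}" if "c < 0" for c
    using that by (intro always_eventually allI) (meson less_le_trans measure_nonneg)
next
  fix \<eta> :: real assume \<eta>: "0 < \<eta>"
  interpret \<mu>: prob_space \<mu> by (rule prob_space_\<mu>)
  define \<phi> where "\<phi> y = 1 / (a - y)" for y :: complex
  have \<phi>[measurable]: "\<phi> \<in> borel_measurable borel"
    unfolding \<phi>_def by measurable
  \<comment> \<open>At \<open>y = a\<close> the quotient has the default value \<open>0\<close>, so
    this says exactly that \<open>a\<close> is no atom.\<close>
  have nz: "AE y in \<mu>. \<phi> y \<noteq> 0"
  proof (rule AE_I')
    show "{a} \<in> null_sets \<mu>"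
      using a sets_\<mu> by (simp add: null_sets_def \<mu>.emeasure_eq_measure)
  qed (auto simp: \<phi>_def)
  have \<phi>': "\<phi> \<in> borel_measurable \<mu>" by measurable
  obtain N \<delta> where \<delta>: "0 < \<delta>" and N: "\<And>I :: nat set. finite I \<Longrightarrow> N \<le> card I \<Longrightarrow>
    measure (PiM I (\<lambda>_. \<mu>)) {x \<in> space (PiM I (\<lambda>_. \<mu>)). norm (coeff (\<Prod>i\<in>I. [:1, \<phi> (x i):]) k) \<le> \<delta>} \<le> \<eta> / 2"
    using anticoncentration[OF prob_space_\<mu> \<phi>' nz half_gt_zero[OF \<eta>], of k] by blast
  have "((\<lambda>n. exp (- e * real n)) \<longlongrightarrow> 0) sequentially"
    using e by real_asymp
  then have "\<forall>\<^sub>F n in sequentially. exp (- e * real n) < \<delta>"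
    using \<delta> by (rule order_tendstoD(2))
  then show "\<forall>\<^sub>F n in sequentially. prob {\<omega> \<in> space M. small_deriv k e n (\<lambda>i. z i \<omega>) a} < \<eta>"
    using eventually_ge_at_top[of "max N 1"]
  proof eventually_elim
    fix n assume en: "exp (- e * real n) < \<delta>" and n: "max N 1 \<le> n"
    let ?I = "{1..n}"
    have ne: "?I \<noteq> {}" using n by simp
    define E1 where "E1 = (\<Union>i\<in>?I. {\<omega> \<in> space M. z i \<omega> \<in> {a}})"
    define E2 where "E2 = {\<omega> \<in> space M. norm (coeff (\<Prod>i\<in>?I. [:1, \<phi> (z i \<omega>):]) k) \<le> \<delta>}"
    have E1: "E1 \<in> events"
      unfolding E1_def by (intro sets.finite_UN) (auto intro!: measurable_sets_Collect[OF measurable_z])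
    have [measurable]: "(\<lambda>x. coeff (\<Prod>i\<in>?I. [:1, \<phi> (x i):]) k) \<in> borel_measurable (PiM ?I (\<lambda>_. \<mu>))"
      by (rule measurable_coeff_prod_linear) auto
    have "(\<lambda>\<omega>. coeff (\<Prod>i\<in>?I. [:1, \<phi> (z i \<omega>):]) k) \<in> borel_measurable M"
      by (rule measurable_coeff_prod_linear) (auto intro!: measurable_compose[OF measurable_z \<phi>])
    then have E2: "E2 \<in> events"
      unfolding E2_def by measurable
    have "prob E1 \<le> (\<Sum>i\<in>?I. prob {\<omega> \<in> space M. z i \<omega> \<in> {a}})"
      unfolding E1_def by (intro finite_measure_subadditive_finite) (auto intro!: measurable_sets_Collect[OF measurable_z])
    also have "\<dots> = (\<Sum>i\<in>?I. measure \<mu> {a})"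
      by (intro sum.cong prob_z) auto
    finally have "prob E1 \<le> 0" using a by simp
    moreover have "prob E2 \<le> \<eta> / 2"
    proof -
      have "E2 = {\<omega> \<in> space M. norm (coeff (\<Prod>i\<in>?I. [:1, \<phi> ((\<lambda>i\<in>?I. z i \<omega>) i):]) k) \<le> \<delta>}"
        unfolding E2_def by (intro Collect_cong conj_cong refl) simp
      also have "prob \<dots> = measure (PiM ?I (\<lambda>_. \<mu>)) {x \<in> space (PiM ?I (\<lambda>_. \<mu>)). norm (coeff (\<Prod>i\<in>?I. [:1, \<phi> (x i):]) k) \<le> \<delta>}"
        by (rule prob_joint[OF ne]) auto
      also have "\<dots> \<le> \<eta> / 2"
        by (rule N) (use n in auto)
      finally show ?thesis .
    qed
    moreover have "{\<omega> \<in> space M. small_deriv k e n (\<lambda>i. z i \<omega>) a} \<subseteq> E1 \<union> E2"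
    proof safe
      fix \<omega> assume \<omega>: "\<omega> \<in> space M" "small_deriv k e n (\<lambda>i. z i \<omega>) a" "\<omega> \<notin> E2"
      let ?x = "\<lambda>i. z i \<omega>"
      show "\<omega> \<in> E1"
      proof (rule ccontr)
        assume "\<omega> \<notin> E1"
        then have x: "a \<noteq> ?x i" if "i \<in> ?I" for i
          using \<omega>(1) that by (auto simp: E1_def)
        let ?p = "poly (poly_of_roots n ?x) a"
        have p: "norm ?p > 0"
          using x by (auto simp: norm_poly_of_roots intro!: prod_pos)
        have "norm (poly ((pderiv ^^ k) (poly_of_roots n ?x)) a) =
            norm ?p * (fact k * norm (coeff (\<Prod>i\<in>?I. [:1, \<phi> (?x i):]) k))"
          unfolding poly_of_roots_def by (subst poly_higher_pderiv_prod) (use x in \<open>auto simp: norm_mult \<phi>_def\<close>)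
        moreover have "exp (- e * n) < fact k * norm (coeff (\<Prod>i\<in>?I. [:1, \<phi> (?x i):]) k)"
        proof -
          have "\<delta> < norm (coeff (\<Prod>i\<in>?I. [:1, \<phi> (?x i):]) k)"
            using \<omega> by (simp add: E2_def)
          also have "\<dots> \<le> fact k * norm (coeff (\<Prod>i\<in>?I. [:1, \<phi> (?x i):]) k)"
            by (simp add: mult_le_cancel_right1 fact_ge_1)
          finally show ?thesis using en by simp
        qed
        ultimately have "exp (- e * n) * norm ?p < norm (poly ((pderiv ^^ k) (poly_of_roots n ?x)) a)"
          using p by (simp add: mult.commute)
        then show False
          using \<omega>(2) p by (auto simp: small_deriv_def)
      qed
    qed
    then have "prob {\<omega> \<in> space M. small_deriv k e n (\<lambda>i. z i \<omega>) a} \<le> prob E1 + prob E2"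
      using finite_measure_mono[of _ "E1 \<union> E2"] measure_Un_le[OF E1 E2] E1 E2 by (meson order_trans sets.Un)
    ultimately show "prob {\<omega> \<in> space M. small_deriv k e n (\<lambda>i. z i \<omega>) a} < \<eta>"
      using \<eta> by linarith
  qed
qed

lemma countable_atoms: "countable {a. measure \<mu> {a} \<noteq> 0}"
proof -
  interpret \<mu>: prob_space \<mu> by (rule prob_space_\<mu>)
  show ?thesis by (rule \<mu>.countable_support)
qed

text \<open>For every centre that is no atom the probability of being bad tends to \<open>0\<close>,
  and the atoms have no area. Dominated convergence over the disc and Fubini bring the expected bad
  area below \<open>\<gamma> * \<eta>\<close>, and Markov's inequality concludes.\<close>

lemma small_deriv_area_likely:
  assumes e: "0 < e" and \<eta>: "0 < \<eta>" and \<gamma>: "0 < \<gamma>"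
  shows "\<forall>\<^sub>F n in sequentially. likely \<gamma> (\<lambda>\<omega>. measure lborel {a \<in> ball 0 R. small_deriv k e n (\<lambda>i. z i \<omega>) a} \<le> \<eta>)"
proof -
  interpret P: pair_sigma_finite M lborel ..
  define B where "B n = {p \<in> space (M \<Otimes>\<^sub>M lborel). norm (snd p) < R \<and> small_deriv k e n (\<lambda>i. z i (fst p)) (snd p)}" for n
  have [measurable]: "Measurable.pred (M \<Otimes>\<^sub>M lborel) (\<lambda>p. small_deriv k e n (\<lambda>i. z i (fst p)) (snd p))" for n
    using small_deriv_event[of k e n] by (simp cong: measurable_cong_sets sets_pair_measure_cong)
  have B [measurable]: "B n \<in> sets (M \<Otimes>\<^sub>M lborel)" for n
    unfolding B_def by measurable
  have sect1: "Pair \<omega> -` B n = {a \<in> ball 0 R. small_deriv k e n (\<lambda>i. z i \<omega>) a}" if "\<omega> \<in> space M" for n \<omega>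
    using that by (auto simp: B_def space_pair_measure)
  have sect2: "(\<lambda>\<omega>. (\<omega>, a)) -` B n = (if a \<in> ball 0 R then {\<omega> \<in> space M. small_deriv k e n (\<lambda>i. z i \<omega>) a} else {})" for n a
    by (auto simp: B_def space_pair_measure)
  have "(\<lambda>n. \<integral>\<^sup>+a. emeasure M ((\<lambda>\<omega>. (\<omega>, a)) -` B n) \<partial>lborel) \<longlonglongrightarrow> (\<integral>\<^sup>+a. 0 \<partial>(lborel :: complex measure))"
  proof (rule nn_integral_dominated_convergence[where w = "indicator (ball 0 R)"])
    show "indicator (ball 0 R) \<in> borel_measurable (lborel :: complex measure)"
      by (intro borel_measurable_indicator) simp
    show "(\<integral>\<^sup>+a. indicator (ball 0 R) a \<partial>(lborel :: complex measure)) < \<infinity>"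
      using emeasure_lborel_ball_finite[of "0::complex" R] by (simp add: less_top[symmetric])
    have "AE a in lborel. measure \<mu> {a} = 0"
      using countable_imp_null_set_lborel[OF countable_atoms] by (rule AE_I') auto
    then show "AE a in lborel. (\<lambda>n. emeasure M ((\<lambda>\<omega>. (\<omega>, a)) -` B n)) \<longlonglongrightarrow> 0"
    proof eventually_elim
      fix a assume "measure \<mu> {a} = 0"
      then have "(\<lambda>n. ennreal (prob {\<omega> \<in> space M. small_deriv k e n (\<lambda>i. z i \<omega>) a})) \<longlonglongrightarrow> ennreal 0"
        by (rule tendsto_ennrealI[OF small_deriv_unlikely[OF _ e]])
      then show "(\<lambda>n. emeasure M ((\<lambda>\<omega>. (\<omega>, a)) -` B n)) \<longlonglongrightarrow> 0"
        by (cases "norm a < R") (simp_all add: sect2 emeasure_eq_measure)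
    qed
    show "AE a in lborel. emeasure M ((\<lambda>\<omega>. (\<omega>, a)) -` B n) \<le> indicator (ball 0 R) a" for n
      by (rule AE_I2) (simp add: sect2 indicator_def emeasure_le_1)
    show "(\<lambda>a. emeasure M ((\<lambda>\<omega>. (\<omega>, a)) -` B n)) \<in> borel_measurable lborel" for n
      by (rule P.measurable_emeasure_Pair2[OF B])
  qed auto
  then have "(\<lambda>n. emeasure (M \<Otimes>\<^sub>M lborel) (B n)) \<longlonglongrightarrow> 0"
    by (simp add: P.emeasure_pair_measure_alt2[OF B])
  then have "\<forall>\<^sub>F n in sequentially. emeasure (M \<Otimes>\<^sub>M lborel) (B n) < ennreal (\<gamma> * \<eta>)"
    using \<gamma> \<eta> by (intro order_tendstoD(2)) auto
  then show ?thesis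
  proof eventually_elim
    fix n assume small: "emeasure (M \<Otimes>\<^sub>M lborel) (B n) < ennreal (\<gamma> * \<eta>)"
    define E where "E = {\<omega> \<in> space M. ennreal \<eta> \<le> emeasure lborel (Pair \<omega> -` B n)}"
    have E [measurable]: "E \<in> events"
      unfolding E_def using lborel.measurable_emeasure_Pair[OF B, of n] by measurable
    have "ennreal \<eta> * emeasure M E = (\<integral>\<^sup>+\<omega>. ennreal \<eta> * indicator E \<omega> \<partial>M)"
      by (rule nn_integral_cmult_indicator[symmetric]) fact
    also have "\<dots> \<le> (\<integral>\<^sup>+\<omega>. emeasure lborel (Pair \<omega> -` B n) \<partial>M)"
      by (rule nn_integral_mono) (auto simp: E_def indicator_def)
    also have "\<dots> = emeasure (M \<Otimes>\<^sub>M lborel) (B n)"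
      by (rule lborel.emeasure_pair_measure_alt[OF B, symmetric])
    also have "\<dots> \<le> ennreal (\<gamma> * \<eta>)"
      using small by simp
    finally have "ennreal (\<eta> * prob E) \<le> ennreal (\<gamma> * \<eta>)"
      using \<eta> by (simp add: emeasure_eq_measure ennreal_mult)
    then have "prob E \<le> \<gamma>"
      using \<eta> \<gamma> by (simp add: mult.commute)
    moreover have "measure lborel {a \<in> ball 0 R. small_deriv k e n (\<lambda>i. z i \<omega>) a} \<le> \<eta>" if "\<omega> \<in> space M - E" for \<omega>
    proof -
      have "emeasure lborel {a \<in> ball 0 R. small_deriv k e n (\<lambda>i. z i \<omega>) a} < ennreal \<eta>"
        using that sect1[of \<omega> n] by (auto simp: E_def)
      then have "enn2real (emeasure lborel {a \<in> ball 0 R. small_deriv k e n (\<lambda>i. z i \<omega>) a}) \<le> \<eta>"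
        using \<eta> by (intro enn2real_leI) auto
      then show ?thesis by (simp add: measure_def)
    qed
    ultimately show "likely \<gamma> (\<lambda>\<omega>. measure lborel {a \<in> ball 0 R. small_deriv k e n (\<lambda>i. z i \<omega>) a} \<le> \<eta>)"
      unfolding likely_def using E by blast
  qed
qed

end

section \<open>Integrals against the zero measure\<close>

lemma integral_zero_measure:
  fixes f :: "complex \<Rightarrow> real"
  assumes "degree p > 0" and [measurable]: "f \<in> borel_measurable borel"
  shows "(\<integral>x. f x \<partial>zero_measure p) = (\<Sum>w\<in>#proots p. f w) / real (degree p)"
proof -
  have ne: "proots p \<noteq> {#}"
    using assms(1) size_proots_complex[of p] by auto
  have "(\<integral>x. f x \<partial>zero_measure p) = (\<integral>x. f x \<partial>measure_pmf (pmf_of_multiset (proots p)))"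
    unfolding zero_measure_def by (rule integral_distr) auto
  also have "\<dots> = (\<Sum>w\<in>set_mset (proots p). f w * pmf (pmf_of_multiset (proots p)) w)"
    by (rule integral_measure_pmf_real) (use ne in auto)
  also have "\<dots> = (\<Sum>w\<in>set_mset (proots p). real (count (proots p) w) * f w) / real (degree p)"
    using ne by (simp add: size_proots_complex sum_divide_distrib mult.commute)
  also have "(\<Sum>w\<in>set_mset (proots p). real (count (proots p) w) * f w) = (\<Sum>w\<in>#proots p. f w)"
    by (rule sum_mset_count[symmetric]) simp_all
  finally show ?thesis .
qed

lemma zero_measure_in_prob_algebra: "zero_measure p \<in> space (prob_algebra borel)"
  unfolding space_prob_algebra zero_measure_def
  by (auto intro!: measure_pmf.prob_space_distr)

lemma size_filter_mset_le_sum: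
  fixes h :: "'a \<Rightarrow> real"
  assumes "\<And>x. x \<in># A \<Longrightarrow> 0 \<le> h x" "\<And>x. x \<in># A \<Longrightarrow> P x \<Longrightarrow> c \<le> h x"
  shows "c * size (filter_mset P A) \<le> (\<Sum>x\<in>#A. h x)"
  using assms
proof (induction A)
  case (add x A)
  then have IH: "c * size (filter_mset P A) \<le> (\<Sum>x\<in>#A. h x)" by auto
  show ?case
  proof (cases "P x")
    case True
    then have "c \<le> h x" using add.prems by auto
    then show ?thesis using IH True by (simp add: algebra_simps)
  next
    case False
    have "0 \<le> h x" using add.prems by auto
    then show ?thesis using IH False by simp
  qed
qed simp

section \<open>Law of large numbers and zeros near infinity\<close>

context iid_sequence
begin

lemma integral_z:
  fixes f :: "complex \<Rightarrow> real"
  assumes "i \<ge> 1" and [measurable]: "f \<in> borel_measurable borel"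
  shows "expectation (\<lambda>\<omega>. f (z i \<omega>)) = (\<integral>x. f x \<partial>\<mu>)"
  using assms by (subst distr_z[OF assms(1), symmetric], subst integral_distr) (auto intro: measurable_z)

lemma weak_law:
  fixes f :: "complex \<Rightarrow> real" and \<epsilon> \<gamma> :: real
  assumes f [measurable]: "f \<in> borel_measurable borel" and F: "\<And>x. \<bar>f x\<bar> \<le> F" and "0 < \<epsilon>" "0 < \<gamma>"
  shows "\<forall>\<^sub>F n in sequentially. likely \<gamma> (\<lambda>\<omega>. \<bar>(\<Sum>i=1..n. f (z i \<omega>)) - n * (\<integral>x. f x \<partial>\<mu>)\<bar> \<le> \<epsilon> * n)"
proof -
  \<comment> \<open>Hoeffding's inequality is applied on the interval from \<open>- G\<close> to
    \<open>G\<close>; adding \<open>1\<close> gives it positive length.\<close>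
  define G where "G = F + 1"
  have G: "G > 0" "\<And>x. \<bar>f x\<bar> \<le> G"
    using order_trans[OF abs_ge_zero F] order_trans[OF F, of "F + 1"] by (auto simp: G_def add_nonneg_pos)
  have "((\<lambda>n. 2 * exp (- 2 * (\<epsilon> * real n)\<^sup>2 / (real n * (2 * G)\<^sup>2))) \<longlongrightarrow> 0) sequentially"
    using G(1) \<open>0 < \<epsilon>\<close> by real_asymp
  then have "\<forall>\<^sub>F n in sequentially. 2 * exp (- 2 * (\<epsilon> * real n)\<^sup>2 / (real n * (2 * G)\<^sup>2)) < \<gamma>"
    using \<open>0 < \<gamma>\<close> by (rule order_tendstoD(2))
  then show ?thesis
    using eventually_ge_at_top[of 1]
  proof eventually_elim
    fix n :: nat assume small: "2 * exp (- 2 * (\<epsilon> * real n)\<^sup>2 / (real n * (2 * G)\<^sup>2)) < \<gamma>" and n: "1 \<le> n"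
    have ind: "indep_vars (\<lambda>_. borel) (\<lambda>i \<omega>. f (z i \<omega>)) {1..n}"
      by (rule indep_vars_compose2[OF indep_vars_subset[OF indep]]) auto
    interpret H: Hoeffding_ineq M "{1..n}" "\<lambda>i \<omega>. f (z i \<omega>)" "\<lambda>_. - G" "\<lambda>_. G" "\<Sum>i=1..n. expectation (\<lambda>\<omega>. f (z i \<omega>))"
      by unfold_locales (use ind G in \<open>auto simp: abs_le_iff minus_le_iff\<close>)
    have mean: "(\<Sum>i=1..n. expectation (\<lambda>\<omega>. f (z i \<omega>))) = n * (\<integral>x. f x \<partial>\<mu>)"
      by (simp add: integral_z)
    have "prob {\<omega> \<in> space M. \<epsilon> * n \<le> \<bar>(\<Sum>i=1..n. f (z i \<omega>)) - n * (\<integral>x. f x \<partial>\<mu>)\<bar>} \<le>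
        2 * exp (- 2 * (\<epsilon> * n)\<^sup>2 / (\<Sum>i=1..n. (G - (- G))\<^sup>2))"
      unfolding mean[symmetric] by (rule H.Hoeffding_ineq_abs_ge) (use n G \<open>0 < \<epsilon>\<close> in auto)
    also have "\<dots> < \<gamma>"
      using small by simp
    finally have p: "prob {\<omega> \<in> space M. \<epsilon> * n \<le> \<bar>(\<Sum>i=1..n. f (z i \<omega>)) - n * (\<integral>x. f x \<partial>\<mu>)\<bar>} < \<gamma>" .
    have [measurable]: "(\<lambda>\<omega>. \<Sum>i=1..n. f (z i \<omega>)) \<in> borel_measurable M"
      by (intro borel_measurable_sum measurable_compose[OF measurable_z f]) auto
    have ev: "{\<omega> \<in> space M. \<epsilon> * n \<le> \<bar>(\<Sum>i=1..n. f (z i \<omega>)) - n * (\<integral>x. f x \<partial>\<mu>)\<bar>} \<in> events"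
      by measurable
    show "likely \<gamma> (\<lambda>\<omega>. \<bar>(\<Sum>i=1..n. f (z i \<omega>)) - n * (\<integral>x. f x \<partial>\<mu>)\<bar> \<le> \<epsilon> * n)"
      unfolding likely_def by (rule bexI[OF _ ev]) (use p in auto)
  qed
qed

text \<open>For \<open>x \<noteq> 0\<close> the integrand is the logarithmic kernel of radius \<open>3 * s\<close> centred at \<open>1 / x\<close>.\<close>
lemma inverted_kernel_mass:
  fixes x :: complex
  assumes s: "0 < s"
  shows "(\<integral>\<^sup>+t. ennreal (ln (max 1 (3 * s * norm x / norm (1 - x * t)))) * indicator (ball 0 s) t \<partial>lborel)
    \<le> ennreal (9 * s\<^sup>2 * kernel_mass) * indicator {x. 1 / (4 * s) \<le> norm x} x"
proof -
  have eq: "ln (max 1 (3 * s * norm x / norm (1 - x * t))) = log_kernel (3 * s) (t - 1 / x)" if "x \<noteq> 0" for t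
  proof -
    have "norm (1 - x * t) = norm (x * (1 / x - t))"
      using that by (simp add: algebra_simps)
    then have "norm (1 - x * t) = norm x * norm (t - 1 / x)"
      by (simp add: norm_mult norm_minus_commute)
    then show ?thesis
      using that by (simp add: log_kernel_def)
  qed
  show ?thesis
  \<comment> \<open>If \<open>norm x < 1 / (4 * s)\<close> and \<open>x \<noteq> 0\<close>, then
    \<open>1 / x\<close> has modulus above \<open>4 * s\<close>, hence distance more than
    \<open>3 * s\<close> from every \<open>t\<close> in the disc, and the kernel vanishes.\<close>
  proof (cases "1 / (4 * s) \<le> norm x")
    case True
    then have x: "x \<noteq> 0" using s by auto
    have "(\<integral>\<^sup>+t. ennreal (ln (max 1 (3 * s * norm x / norm (1 - x * t)))) * indicator (ball 0 s) t \<partial>lborel)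
        \<le> (\<integral>\<^sup>+t. ennreal (log_kernel (3 * s) (t - 1 / x)) \<partial>lborel)"
      by (intro nn_integral_mono) (auto simp: eq[OF x] indicator_def)
    also have "\<dots> = ennreal ((3 * s)\<^sup>2 * kernel_mass)"
      using s by (subst nn_integral_eq_integral)
        (auto simp: integrable_log_kernel integral_log_kernel log_kernel_nonneg)
    finally show ?thesis
      using True by (simp add: power_mult_distrib)
  next
    case False
    have "ln (max 1 (3 * s * norm x / norm (1 - x * t))) = 0" if t: "t \<in> ball 0 s" for t
    proof (cases "x = 0")
      case x: False
      have "4 * s < norm (1 / x)"
        using False s x by (simp add: norm_divide field_simps)
      also have "\<dots> \<le> norm t + norm (t - 1 / x)"
        using norm_triangle_sub[of "1 / x" t] by (simp add: norm_minus_commute)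
      finally have "3 * s \<le> norm (t - 1 / x)"
        using t by simp
      then show ?thesis
        using s by (simp add: eq[OF x] log_kernel_eq_0)
    qed simp
    then have "(\<integral>\<^sup>+t. ennreal (ln (max 1 (3 * s * norm x / norm (1 - x * t)))) * indicator (ball 0 s) t \<partial>lborel) =
        (\<integral>\<^sup>+(t::complex). 0 \<partial>lborel)"
      by (intro nn_integral_cong) (auto simp: indicator_def)
    then show ?thesis by simp
  qed
qed

text \<open>Average over \<open>t\<close> in the disc of radius \<open>s\<close>: by Fubini and
  \<open>inverted_kernel_mass\<close> the mean of the integral is at most
  \<open>9 * kernel_mass / pi\<close> times the mass of \<open>norm x \<ge> 1 / (4 * s)\<close>. The
  factors \<open>s\<^sup>2\<close> cancel, so this tends to \<open>0\<close> with \<open>s\<close>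
  for every \<open>\<mu>\<close>. The excluded points \<open>0\<close> and the reciprocals of atoms
  form a null set.\<close>

lemma exists_exterior_pole:
  assumes \<theta>: "0 < \<theta>"
  obtains s t where "0 < s" "s \<le> 1" "t \<noteq> 0" "norm t < s" "measure \<mu> {1 / t} = 0"
    "(\<integral>\<^sup>+x. ennreal (ln (max 1 (3 * s * norm x / norm (1 - x * t)))) \<partial>\<mu>) \<le> ennreal \<theta>"
proof -
  interpret \<mu>: prob_space \<mu> by (rule prob_space_\<mu>)
  interpret P: pair_sigma_finite \<mu> lborel ..
  define A where "A j = {x :: complex. real (Suc j) / 4 \<le> norm x}" for j
  have A [measurable]: "A j \<in> sets borel" for j
    unfolding A_def by (intro borel_closed closed_Collect_le continuous_intros)
  have "(\<lambda>j. measure \<mu> (A j)) \<longlonglongrightarrow> measure \<mu> (\<Inter>j. A j)"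
  proof (rule \<mu>.finite_Lim_measure_decseq)
    show "range A \<subseteq> sets \<mu>" unfolding sets_\<mu> using A by blast
    show "decseq A"
      unfolding decseq_def A_def by force
  qed
  also have "(\<Inter>j. A j) = {}"
  proof -
    have "\<exists>j. x \<notin> A j" for x
    proof -
      obtain j where "4 * norm x < real j" using reals_Archimedean2 by blast
      then have "x \<notin> A j" by (simp add: A_def)
      then show ?thesis ..
    qed
    then show ?thesis by blast
  qed
  finally have "(\<lambda>j. measure \<mu> (A j)) \<longlonglongrightarrow> 0" by simp
  then have "\<forall>\<^sub>F j in sequentially. measure \<mu> (A j) < \<theta> * pi / (9 * kernel_mass)"
    using \<theta> kernel_mass_pos by (intro order_tendstoD(2)) auto
  then obtain j where j: "measure \<mu> (A j) < \<theta> * pi / (9 * kernel_mass)"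
    by (meson eventually_sequentially order_refl)
  define s where "s = 1 / real (Suc j)"
  have s: "0 < s" "s \<le> 1" by (auto simp: s_def)
  define h where "h x t = ennreal (ln (max 1 (3 * s * norm x / norm (1 - x * t))))" for x t :: complex
  have h [measurable]: "(\<lambda>p. h (fst p) (snd p)) \<in> borel_measurable (\<mu> \<Otimes>\<^sub>M lborel)"
    unfolding h_def by measurable
  have "\<exists>t. t \<in> ball 0 s \<and> t \<noteq> 0 \<and> measure \<mu> {1 / t} = 0 \<and> (\<integral>\<^sup>+x. h x t \<partial>\<mu>) \<le> ennreal \<theta>"
  proof (rule ccontr)
    assume contr: "\<not> ?thesis"
    have "countable ((\<lambda>a. 1 / a) ` {a. measure \<mu> {a} \<noteq> 0} \<union> {0})"
      by (intro countable_Un countable_image countable_atoms) simp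
    then have "(\<lambda>a. 1 / a) ` {a. measure \<mu> {a} \<noteq> 0} \<union> {0} \<in> null_sets lborel"
      by (rule countable_imp_null_set_lborel)
    then have "AE t in lborel. t \<notin> (\<lambda>a. 1 / a) ` {a. measure \<mu> {a} \<noteq> 0} \<union> {0}"
      by (rule AE_not_in)
    then have "AE t in lborel. ennreal \<theta> * indicator (ball 0 s) t \<le> (\<integral>\<^sup>+x. h x t * indicator (ball 0 s) t \<partial>\<mu>)"
    proof eventually_elim
      fix t assume t: "t \<notin> (\<lambda>a. 1 / a) ` {a. measure \<mu> {a} \<noteq> 0} \<union> {0}"
      then have "t \<noteq> 0" by blast
      moreover have "measure \<mu> {1 / t} = 0"
      proof (rule ccontr)
        assume "measure \<mu> {1 / t} \<noteq> 0"
        then have "1 / (1 / t) \<in> (\<lambda>a. 1 / a) ` {a. measure \<mu> {a} \<noteq> 0}" by blast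
        then show False using t by simp
      qed
      ultimately show "ennreal \<theta> * indicator (ball 0 s) t \<le> (\<integral>\<^sup>+x. h x t * indicator (ball 0 s) t \<partial>\<mu>)"
        using contr by (cases "t \<in> ball 0 s") (auto simp: not_le less_imp_le)
    qed
    then have "(\<integral>\<^sup>+(t::complex). ennreal \<theta> * indicator (ball 0 s) t \<partial>lborel) \<le>
        (\<integral>\<^sup>+t. (\<integral>\<^sup>+x. h x t * indicator (ball 0 s) t \<partial>\<mu>) \<partial>lborel)"
      by (rule nn_integral_mono_AE)
    also have "\<dots> = (\<integral>\<^sup>+x. (\<integral>\<^sup>+t. h x t * indicator (ball 0 s) t \<partial>lborel) \<partial>\<mu>)"
    proof (rule P.Fubini')
      have [measurable]: "(\<lambda>p. indicator (ball 0 s) (snd p) :: ennreal) \<in> borel_measurable (\<mu> \<Otimes>\<^sub>M lborel)"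
        by (rule measurable_compose[OF measurable_snd]) (intro borel_measurable_indicator, simp)
      show "(\<lambda>(x, t). h x t * indicator (ball 0 s) t) \<in> borel_measurable (\<mu> \<Otimes>\<^sub>M lborel)"
        unfolding split_beta' by (intro borel_measurable_times_ennreal h) measurable
    qed
    also have "\<dots> \<le> (\<integral>\<^sup>+x. ennreal (9 * s\<^sup>2 * kernel_mass) * indicator (A j) x \<partial>\<mu>)"
    proof (rule nn_integral_mono)
      fix x
      have "A j = {x. 1 / (4 * s) \<le> norm x}"
        by (simp add: A_def s_def)
      then show "(\<integral>\<^sup>+t. h x t * indicator (ball 0 s) t \<partial>lborel) \<le> ennreal (9 * s\<^sup>2 * kernel_mass) * indicator (A j) x"
        unfolding h_def using inverted_kernel_mass[OF s(1), of x] by simp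
    qed
    also have "\<dots> = ennreal (9 * s\<^sup>2 * kernel_mass * measure \<mu> (A j))"
      using A sets_\<mu> kernel_mass_pos
      by (subst nn_integral_cmult_indicator) (auto simp: \<mu>.emeasure_eq_measure ennreal_mult)
    also have "\<dots> < ennreal (\<theta> * pi * s\<^sup>2)"
    proof (rule ennreal_lessI)
      show "0 < \<theta> * pi * s\<^sup>2" using \<theta> s by simp
      have "9 * s\<^sup>2 * kernel_mass * measure \<mu> (A j) < 9 * s\<^sup>2 * kernel_mass * (\<theta> * pi / (9 * kernel_mass))"
        using j s kernel_mass_pos by (intro mult_strict_left_mono) auto
      then show "9 * s\<^sup>2 * kernel_mass * measure \<mu> (A j) < \<theta> * pi * s\<^sup>2"
        using kernel_mass_pos by (simp add: mult_ac)
    qed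
    also have "ennreal (\<theta> * pi * s\<^sup>2) = ennreal \<theta> * emeasure lborel (ball (0::complex) s)"
      using \<theta> s by (simp add: emeasure_ball unit_ball_vol_2 mult.assoc ennreal_mult)
    also have "\<dots> = (\<integral>\<^sup>+t. ennreal \<theta> * indicator (ball 0 s) (t::complex) \<partial>lborel)"
      by (rule nn_integral_cmult_indicator[symmetric]) simp
    finally show False
      using less_irrefl by blast
  qed
  then show ?thesis
    using that[OF s] by (auto simp: h_def)
qed

text \<open>The comparison of potentials in the coordinate \<open>1 / x\<close>, for a disc containing the origin.\<close>
lemma tail_likely:
  fixes \<epsilon> \<gamma> :: real
  assumes \<epsilon>: "0 < \<epsilon>" and \<gamma>: "0 < \<gamma>"
  obtains R where "\<forall>\<^sub>F n in sequentially. likely \<gamma> (\<lambda>\<omega>.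
    real (size {#w \<in># proots ((pderiv ^^ k) (poly_of_roots n (\<lambda>i. z i \<omega>))). R \<le> norm w#}) \<le> \<epsilon> * n)"
proof -
  \<comment> \<open>If \<open>norm w \<ge> 2 / s\<close> and \<open>norm t < s\<close>, then
    \<open>norm (1 - w * t) \<le> 3 / 2 * s * norm w\<close>. So each far zero contributes at least
    \<open>ln (4 / 3)\<close> to the sum for the inner radius \<open>2 * s\<close>.\<close>
  define L where "L = ln (4 / 3 :: real)"
  have L: "L > 0" by (simp add: L_def)
  \<comment> \<open>Three errors of size \<open>\<delta> * n\<close> occur, from the logarithmic
    term, from the value at the centre and from the roots; their sum is
    \<open>3 / 4 * L * \<epsilon> * n\<close>.\<close>
  define \<delta> where "\<delta> = \<epsilon> * L / 4"
  have \<delta>: "\<delta> > 0" using \<epsilon> L by (simp add: \<delta>_def)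
  \<comment> \<open>With this bound on the mean, Markov's inequality lets \<open>H\<close> exceed
    \<open>\<delta> * n\<close> with probability at most \<open>\<gamma> / 2\<close>; the other half
    of \<open>\<gamma>\<close> is for the value at the centre.\<close>
  have "0 < \<gamma> * \<delta> / 2" using \<gamma> \<delta> by simp
  then obtain s t where st: "0 < s" "s \<le> 1" "t \<noteq> 0" "norm t < s" "measure \<mu> {1 / t} = 0"
    and mass: "(\<integral>\<^sup>+x. ennreal (ln (max 1 (3 * s * norm x / norm (1 - x * t)))) \<partial>\<mu>) \<le> ennreal (\<gamma> * \<delta> / 2)"
    by (rule exists_exterior_pole)
  define h where "h x = ln (max 1 (3 * s * norm x / norm (1 - x * t)))" for x
  have h0: "0 \<le> h x" for x by (simp add: h_def)
  have h [measurable]: "h \<in> borel_measurable borel"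
    unfolding h_def by measurable
  \<comment> \<open>Since \<open>norm t < s\<close>, the radii \<open>2 * s\<close> and
    \<open>3 * s\<close> keep \<open>norm (t + v)\<close> between \<open>norm t\<close> and
    \<open>4 * s\<close> on the annulus, and the pole \<open>v = - t\<close> of the coordinate stays
    inside the inner circle.\<close>
  have pos: "0 < 2 * s" "2 * s < 3 * s" "0 < norm t" "0 < 4 * s"
    using st by auto
  obtain K where K: "K \<ge> 0"
    "\<And>n x u D g b e. 1 \<le> n \<Longrightarrow> k \<le> n \<Longrightarrow>
      (\<And>v w. v = 0 \<or> 2 * s \<le> norm v \<and> norm v \<le> 3 * s \<Longrightarrow> (u v - w) * D v = g w + b w * v) \<Longrightarrow>
      (\<And>v. v = 0 \<or> 2 * s \<le> norm v \<and> norm v \<le> 3 * s \<Longrightarrow> norm t \<le> norm (D v) \<and> norm (D v) \<le> 4 * s) \<Longrightarrow>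
      (\<And>w. norm t \<le> norm (g w) + norm (b w)) \<Longrightarrow> \<not> small_deriv k e n x (u 0) \<Longrightarrow>
      (\<Sum>w\<in>#proots ((pderiv ^^ k) (poly_of_roots n x)). ln (max 1 (2 * s * norm (b w) / norm (g w))))
      \<le> K * (1 + ln (real n)) + e * n + (\<Sum>i=1..n. ln (max 1 (3 * s * norm (b (x i)) / norm (g (x i)))))"
    using log_potential_le[OF pos, of k thesis] by blast
  have "\<forall>\<^sub>F n in sequentially. likely (\<gamma> / 2) (\<lambda>\<omega>. \<not> small_deriv k \<delta> n (\<lambda>i. z i \<omega>) (1 / t))"
    by (rule eventually_likelyI) (use small_deriv_unlikely[OF st(5) \<delta>, of k] small_deriv_event_at \<gamma> in auto)
  moreover have "\<forall>\<^sub>F n in sequentially. K * (1 + ln (real n)) \<le> \<delta> * real n"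
    using \<delta> by (rule eventually_ln_le)
  moreover have "\<forall>\<^sub>F n in sequentially. max 1 k \<le> n"
    by (rule eventually_ge_at_top)
  ultimately have "\<forall>\<^sub>F n in sequentially. likely \<gamma> (\<lambda>\<omega>.
    real (size {#w \<in># proots ((pderiv ^^ k) (poly_of_roots n (\<lambda>i. z i \<omega>))). 2 / s \<le> norm w#}) \<le> \<epsilon> * n)"
  proof eventually_elim
    fix n assume lik: "likely (\<gamma> / 2) (\<lambda>\<omega>. \<not> small_deriv k \<delta> n (\<lambda>i. z i \<omega>) (1 / t))"
      and Kn: "K * (1 + ln (real n)) \<le> \<delta> * real n" and n: "max 1 k \<le> n"
    define H where "H \<omega> = (\<Sum>i=1..n. h (z i \<omega>))" for \<omega>
    have [measurable]: "H \<in> borel_measurable M"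
      unfolding H_def by (intro borel_measurable_sum measurable_compose[OF measurable_z h]) auto
    define E where "E = {\<omega> \<in> space M. ennreal (\<delta> * n) \<le> ennreal (H \<omega>)}"
    have E [measurable]: "E \<in> events"
      unfolding E_def by measurable
    have "ennreal (\<delta> * n) * emeasure M E = (\<integral>\<^sup>+\<omega>. ennreal (\<delta> * n) * indicator E \<omega> \<partial>M)"
      by (rule nn_integral_cmult_indicator[symmetric]) fact
    also have "\<dots> \<le> (\<integral>\<^sup>+\<omega>. ennreal (H \<omega>) \<partial>M)"
      by (rule nn_integral_mono) (auto simp: E_def indicator_def)
    also have "\<dots> = (\<Sum>i=1..n. \<integral>\<^sup>+\<omega>. ennreal (h (z i \<omega>)) \<partial>M)"
      unfolding H_def using h0
      by (subst nn_integral_sum[symmetric]) (auto intro!: measurable_compose[OF measurable_z] simp: sum_ennreal)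
    also have "\<dots> = (\<Sum>i=1..n. \<integral>\<^sup>+x. ennreal (h x) \<partial>\<mu>)"
    proof (rule sum.cong)
      fix i assume i: "i \<in> {1..n}"
      then have "(\<integral>\<^sup>+x. ennreal (h x) \<partial>\<mu>) = (\<integral>\<^sup>+x. ennreal (h x) \<partial>distr M borel (z i))"
        by (simp add: distr_z)
      also have "\<dots> = (\<integral>\<^sup>+\<omega>. ennreal (h (z i \<omega>)) \<partial>M)"
        using i by (intro nn_integral_distr measurable_z) auto
      finally show "(\<integral>\<^sup>+\<omega>. ennreal (h (z i \<omega>)) \<partial>M) = (\<integral>\<^sup>+x. ennreal (h x) \<partial>\<mu>)" ..
    qed simp
    also have "\<dots> \<le> (\<Sum>i=1..n. ennreal (\<gamma> * \<delta> / 2))"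
      using mass by (intro sum_mono) (simp add: h_def)
    also have "\<dots> = ennreal (\<delta> * n * (\<gamma> / 2))"
      using \<gamma> \<delta> by (simp add: ennreal_of_nat_eq_real_of_nat mult_ac flip: ennreal_mult')
    finally have "ennreal (\<delta> * n * prob E) \<le> ennreal (\<delta> * n * (\<gamma> / 2))"
      using \<delta> by (simp add: emeasure_eq_measure ennreal_mult)
    then have "\<delta> * n * prob E \<le> \<delta> * n * (\<gamma> / 2)"
      using \<delta> \<gamma> by (subst (asm) ennreal_le_iff) auto
    then have "prob E \<le> \<gamma> / 2"
      using \<delta> n by (subst (asm) mult_le_cancel_left_pos) auto
    have "likely (\<gamma> / 2) (\<lambda>\<omega>. H \<omega> \<le> \<delta> * n)"
    proof -
      have "H \<omega> \<le> \<delta> * n" if "\<omega> \<in> space M - E" for \<omega>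
      proof (rule ccontr)
        assume "\<not> H \<omega> \<le> \<delta> * n"
        then have "ennreal (\<delta> * n) \<le> ennreal (H \<omega>)" by (intro ennreal_leI) simp
        then show False using that by (simp add: E_def)
      qed
      then show ?thesis
        unfolding likely_def using E \<open>prob E \<le> \<gamma> / 2\<close> by blast
    qed
    from likely_conj[OF lik this] show "likely \<gamma> (\<lambda>\<omega>.
      real (size {#w \<in># proots ((pderiv ^^ k) (poly_of_roots n (\<lambda>i. z i \<omega>))). 2 / s \<le> norm w#}) \<le> \<epsilon> * n)"
    proof (rule likely_mono)
      fix \<omega> assume "\<not> small_deriv k \<delta> n (\<lambda>i. z i \<omega>) (1 / t) \<and> H \<omega> \<le> \<delta> * n"
      then have good: "\<not> small_deriv k \<delta> n (\<lambda>i. z i \<omega>) (1 / t)" and H: "H \<omega> \<le> \<delta> * n" by auto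
      define S where "S = (pderiv ^^ k) (poly_of_roots n (\<lambda>i. z i \<omega>))"
      have ne: "t + v \<noteq> 0" if "v = 0 \<or> 2 * s \<le> norm v \<and> norm v \<le> 3 * s" for v
      proof
        assume "t + v = 0"
        then have "v = - t" by (simp add: add_eq_0_iff)
        then have "norm v = norm t" by simp
        then show False using that st by auto
      qed
      have "(\<Sum>w\<in>#proots S. ln (max 1 (2 * s * norm (- w) / norm (1 - w * t)))) \<le> K * (1 + ln (real n)) + \<delta> * n +
          (\<Sum>i=1..n. ln (max 1 (3 * s * norm (- z i \<omega>) / norm (1 - z i \<omega> * t))))"
        unfolding S_def
      proof (rule K(2)[of n "\<lambda>v. 1 / (t + v)" "\<lambda>v. t + v" "\<lambda>w. 1 - w * t" "\<lambda>w. - w" \<delta> "\<lambda>i. z i \<omega>"])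
        show "\<not> small_deriv k \<delta> n (\<lambda>i. z i \<omega>) (1 / (t + 0))" using good by simp
        show "norm t \<le> norm (1 - w * t) + norm (- w)" for w
        proof -
          have "1 \<le> norm (1 - w * t) + norm (w * t)"
            by (metis norm_one norm_triangle_sub add.commute)
          also have "norm (w * t) \<le> norm w * 1"
            unfolding norm_mult using st by (intro mult_left_mono) auto
          finally show ?thesis using st by simp
        qed
        fix v :: complex assume v: "v = 0 \<or> 2 * s \<le> norm v \<and> norm v \<le> 3 * s"
        show "(1 / (t + v) - w) * (t + v) = 1 - w * t + - w * v" for w
          using ne[OF v] by (simp add: field_simps)
        have "norm t \<le> 4 * s" using st by linarith
        moreover have "norm v \<le> norm (t + v) + norm t" "norm (t + v) \<le> norm t + norm v"
          by (metis add_diff_cancel_left' norm_triangle_ineq4, rule norm_triangle_ineq)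
        ultimately show "norm t \<le> norm (t + v) \<and> norm (t + v) \<le> 4 * s"
          using v st by (cases "v = 0") auto
      qed (use n in auto)
      then have sum: "(\<Sum>w\<in>#proots S. ln (max 1 (2 * s * norm w / norm (1 - w * t)))) \<le> 3 * \<delta> * n"
        using Kn H by (simp add: H_def h_def)
      have "L * size {#w \<in># proots S. 2 / s \<le> norm w#} \<le> (\<Sum>w\<in>#proots S. ln (max 1 (2 * s * norm w / norm (1 - w * t))))"
      proof (rule size_filter_mset_le_sum)
        fix w assume w: "w \<in># proots S" "2 / s \<le> norm w"
        \<comment> \<open>For \<open>w = 1 / t\<close> the quotient below would take the default
          value \<open>0\<close>; the lower bound at the centre excludes this zero.\<close>
        have "poly S (1 / t) \<noteq> 0"
          using good unfolding small_deriv_def S_def[symmetric]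
          by (metis exp_ge_zero mult_nonneg_nonneg norm_ge_zero norm_zero)
        moreover have "poly S w = 0"
          using w(1) calculation by (cases "S = 0") auto
        ultimately have "w \<noteq> 1 / t" by auto
        then have wt: "1 - w * t \<noteq> 0"
          using st(3) by (auto simp: field_simps)
        have "2 \<le> s * norm w" using w(2) st by (simp add: field_simps)
        have "norm (1 - w * t) \<le> 1 + norm w * norm t"
          by (metis norm_mult norm_one norm_triangle_ineq4)
        also have "\<dots> \<le> s * norm w / 2 + norm w * s"
          using \<open>2 \<le> s * norm w\<close> st by (intro add_mono mult_left_mono) auto
        finally have "4 / 3 \<le> 2 * s * norm w / norm (1 - w * t)"
          using wt by (simp add: field_simps)
        then show "L \<le> ln (max 1 (2 * s * norm w / norm (1 - w * t)))"
          unfolding L_def by (subst ln_le_cancel_iff) auto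
      qed simp
      with sum have "L * size {#w \<in># proots S. 2 / s \<le> norm w#} \<le> L * (3 / 4 * \<epsilon> * n)"
        by (simp add: \<delta>_def mult_ac)
      then have "real (size {#w \<in># proots S. 2 / s \<le> norm w#}) \<le> 3 / 4 * \<epsilon> * n"
        using L by simp
      also have "\<dots> \<le> \<epsilon> * n" using \<epsilon> by (intro mult_right_mono) auto
      finally show "real (size {#w \<in># proots ((pderiv ^^ k) (poly_of_roots n (\<lambda>i. z i \<omega>))). 2 / s \<le> norm w#}) \<le> \<epsilon> * n"
        by (simp add: S_def)
    qed simp
  qed
  then show ?thesis by (rule that)
qed

text \<open>Since \<open>f\<close> may be shifted to be nonnegative and the number of zeros is known, an upper bound
  for compactly supported functions extends to bounded ones of any sign.\<close>
lemma sum_zeros_le_likely: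
  fixes f :: "complex \<Rightarrow> real" and \<epsilon> \<gamma> :: real
  assumes f: "continuous_on UNIV f" "\<And>x. \<bar>f x\<bar> \<le> F" and \<epsilon>: "0 < \<epsilon>" and \<gamma>: "0 < \<gamma>"
  shows "\<forall>\<^sub>F n in sequentially. likely \<gamma> (\<lambda>\<omega>.
    (\<Sum>w\<in>#proots ((pderiv ^^ k) (poly_of_roots n (\<lambda>i. z i \<omega>))). f w) \<le> (\<Sum>i=1..n. f (z i \<omega>)) + \<epsilon> * n)"
proof -
  define G where "G = F + 1"
  have G: "G > 0" "\<And>x. \<bar>f x\<bar> \<le> G"
    using order_trans[OF abs_ge_zero f(2)] order_trans[OF f(2), of "F + 1"] by (auto simp: G_def add_nonneg_pos)
  \<comment> \<open>Each far zero is charged \<open>2 * G\<close>, the upper bound of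
    \<open>f + G\<close>, so this share of far zeros costs
    \<open>\<epsilon> / 4 * n\<close>.\<close>
  have "0 < \<epsilon> / (8 * G)" "0 < \<gamma> / 2" using \<epsilon> \<gamma> G by auto
  then obtain R where tail: "\<forall>\<^sub>F n in sequentially. likely (\<gamma> / 2) (\<lambda>\<omega>.
    real (size {#w \<in># proots ((pderiv ^^ k) (poly_of_roots n (\<lambda>i. z i \<omega>))). R \<le> norm w#}) \<le> \<epsilon> / (8 * G) * n)"
    by (rule tail_likely)
  define cut where "cut x = max 0 (min 1 (R + 1 - norm x))" for x :: complex
  define g where "g x = (f x + G) * cut x" for x
  have cut: "0 \<le> cut x" "cut x \<le> 1" for x by (auto simp: cut_def)
  have fG: "0 \<le> f x + G" "f x + G \<le> 2 * G" for x
    using G(2)[of x] by (auto simp: abs_le_iff)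
  have gc: "continuous_on UNIV g"
    unfolding g_def cut_def by (intro continuous_intros f)
  have g0: "0 \<le> g x" for x
    unfolding g_def using cut fG by (intro mult_nonneg_nonneg)
  have gs: "g x = 0" if "x \<notin> ball 0 (R + 1)" for x
    using that by (simp add: g_def cut_def)
  have g_le: "g x \<le> f x + G" for x
    unfolding g_def using mult_left_mono[OF cut(2) fG(1), of x] by simp
  have le_g: "f x \<le> g x + (if R \<le> norm x then 2 * G else 0) - G" for x
  proof (cases "R \<le> norm x")
    case True
    then show ?thesis using g0[of x] G(2)[of x] by (simp add: abs_le_iff)
  next
    case False
    then show ?thesis by (simp add: g_def cut_def)
  qed
  have \<epsilon>4: "0 < \<epsilon> / 4" using \<epsilon> by simp
  obtain e \<eta> N where e: "0 < e" "0 < \<eta>" and N: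
    "\<And>n x. N \<le> n \<Longrightarrow> measure lborel {a \<in> ball 0 (R + 1). small_deriv k e n x a} \<le> \<eta> \<Longrightarrow>
       (\<Sum>w\<in>#proots ((pderiv ^^ k) (poly_of_roots n x)). g w) \<le> (\<Sum>i=1..n. g (x i)) + \<epsilon> / 4 * n"
    using sum_test_function_le[OF gc g0 gs \<epsilon>4, where k = k] by blast
  \<comment> \<open>The shift adds \<open>G\<close> at \<open>n\<close> roots but only at
    \<open>n - k\<close> zeros, which leaves an error of \<open>G * k\<close>.\<close>
  have "\<forall>\<^sub>F n in sequentially. G * real k \<le> \<epsilon> / 4 * real n"
    using \<epsilon> by real_asymp
  moreover have "\<forall>\<^sub>F n in sequentially. likely (\<gamma> / 2) (\<lambda>\<omega>. measure lborel {a \<in> ball 0 (R + 1). small_deriv k e n (\<lambda>i. z i \<omega>) a} \<le> \<eta>)"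
    by (rule small_deriv_area_likely) (use e \<gamma> in auto)
  moreover have "\<forall>\<^sub>F n in sequentially. max N k \<le> n"
    by (rule eventually_ge_at_top)
  ultimately show ?thesis
    using tail
  proof eventually_elim
    fix n assume Gk: "G * real k \<le> \<epsilon> / 4 * real n" and n: "max N k \<le> n"
      and l1: "likely (\<gamma> / 2) (\<lambda>\<omega>. measure lborel {a \<in> ball 0 (R + 1). small_deriv k e n (\<lambda>i. z i \<omega>) a} \<le> \<eta>)"
      and l2: "likely (\<gamma> / 2) (\<lambda>\<omega>.
        real (size {#w \<in># proots ((pderiv ^^ k) (poly_of_roots n (\<lambda>i. z i \<omega>))). R \<le> norm w#}) \<le> \<epsilon> / (8 * G) * n)"
    from likely_conj[OF l1 l2] show "likely \<gamma> (\<lambda>\<omega>.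
      (\<Sum>w\<in>#proots ((pderiv ^^ k) (poly_of_roots n (\<lambda>i. z i \<omega>))). f w) \<le> (\<Sum>i=1..n. f (z i \<omega>)) + \<epsilon> * n)"
    proof (rule likely_mono)
      fix \<omega>
      define W where "W = proots ((pderiv ^^ k) (poly_of_roots n (\<lambda>i. z i \<omega>)))"
      assume "measure lborel {a \<in> ball 0 (R + 1). small_deriv k e n (\<lambda>i. z i \<omega>) a} \<le> \<eta> \<and>
        real (size {#w \<in># proots ((pderiv ^^ k) (poly_of_roots n (\<lambda>i. z i \<omega>))). R \<le> norm w#}) \<le> \<epsilon> / (8 * G) * n"
      then have area: "measure lborel {a \<in> ball 0 (R + 1). small_deriv k e n (\<lambda>i. z i \<omega>) a} \<le> \<eta>"
        and sz: "real (size {#w \<in># W. R \<le> norm w#}) \<le> \<epsilon> / (8 * G) * n"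
        by (auto simp: W_def)
      have size: "real (size W) = real n - real k"
        using n by (simp add: W_def size_proots_complex degree_higher_pderiv of_nat_diff)
      have filt: "(\<Sum>w\<in>#A. if R \<le> norm w then 2 * G else 0) = 2 * G * size {#w \<in># A. R \<le> norm w#}" for A
        by (induction A) (auto simp: algebra_simps)
      have "(\<Sum>w\<in>#W. f w) \<le> (\<Sum>w\<in>#W. g w + (if R \<le> norm w then 2 * G else 0) + (- G))"
        using le_g by (intro sum_mset_mono) simp
      also have "\<dots> = (\<Sum>w\<in>#W. g w) + 2 * G * size {#w \<in># W. R \<le> norm w#} - G * size W"
        by (simp only: sum_mset.distrib filt) simp
      also have "(\<Sum>w\<in>#W. g w) \<le> (\<Sum>i=1..n. g (z i \<omega>)) + \<epsilon> / 4 * n"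
        unfolding W_def by (rule N[OF _ area]) (use n in auto)
      also have "(\<Sum>i=1..n. g (z i \<omega>)) \<le> (\<Sum>i=1..n. f (z i \<omega>) + G)"
        by (intro sum_mono g_le)
      also have "\<dots> = (\<Sum>i=1..n. f (z i \<omega>)) + G * n"
        by (simp add: sum.distrib)
      also have "2 * G * size {#w \<in># W. R \<le> norm w#} \<le> 2 * G * (\<epsilon> / (8 * G) * n)"
        using sz G by (intro mult_left_mono) auto
      also have "\<dots> = \<epsilon> / 4 * n" using G by simp
      finally have "(\<Sum>w\<in>#W. f w) \<le> (\<Sum>i=1..n. f (z i \<omega>)) + \<epsilon> / 2 * n + G * k"
        unfolding size by (simp add: algebra_simps)
      also have "\<dots> \<le> (\<Sum>i=1..n. f (z i \<omega>)) + \<epsilon> * n"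
      proof -
        have "0 \<le> \<epsilon> * n" using \<epsilon> by simp
        then show ?thesis using Gk by linarith
      qed
      finally show "(\<Sum>w\<in>#proots ((pderiv ^^ k) (poly_of_roots n (\<lambda>i. z i \<omega>))). f w) \<le> (\<Sum>i=1..n. f (z i \<omega>)) + \<epsilon> * n"
        by (simp add: W_def)
    qed simp
  qed
qed

section \<open>Weak convergence in probability\<close>

lemma integral_zero_measure_likely:
  fixes f :: "complex \<Rightarrow> real" and \<epsilon> \<gamma> :: real
  assumes f: "continuous_on UNIV f" "bounded (range f)" and \<epsilon>: "0 < \<epsilon>" and \<gamma>: "0 < \<gamma>"
  shows "\<forall>\<^sub>F n in sequentially. likely \<gamma> (\<lambda>\<omega>.
    \<bar>(\<integral>x. f x \<partial>zero_measure ((pderiv ^^ k) (poly_of_roots n (\<lambda>i. z i \<omega>)))) - (\<integral>x. f x \<partial>\<mu>)\<bar> < \<epsilon>)"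
proof -
  interpret \<mu>: prob_space \<mu> by (rule prob_space_\<mu>)
  obtain F where F: "\<And>x. \<bar>f x\<bar> \<le> F"
    using f(2) unfolding bounded_iff by (metis rangeI real_norm_def)
  have f_meas [measurable]: "f \<in> borel_measurable borel"
    by (rule borel_measurable_continuous_onI[OF f(1)])
  define m where "m = (\<integral>x. f x \<partial>\<mu>)"
  \<comment> \<open>Three errors \<open>d * n\<close> occur: zeros against roots, the weak law, and
    the normalisation by \<open>n - k\<close> instead of \<open>n\<close>. As
    \<open>2 * k + 1 \<le> n\<close> gives \<open>n \<le> 2 * (n - k)\<close>, they sum to at most
    \<open>6 * d * (n - k)\<close>.\<close>
  define d where "d = \<epsilon> / 8"
  have d: "d > 0" using \<epsilon> by (simp add: d_def)
  have \<gamma>3: "0 < \<gamma> / 3" using \<gamma> by simp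
  have "\<forall>\<^sub>F n in sequentially. \<bar>m\<bar> * real k \<le> d * real n"
    using d by real_asymp
  moreover have "\<forall>\<^sub>F n in sequentially. 2 * k + 1 \<le> n"
    by (rule eventually_ge_at_top)
  moreover have "\<forall>\<^sub>F n in sequentially. likely (\<gamma> / 3) (\<lambda>\<omega>.
      (\<Sum>w\<in>#proots ((pderiv ^^ k) (poly_of_roots n (\<lambda>i. z i \<omega>))). f w) \<le> (\<Sum>i=1..n. f (z i \<omega>)) + d * n)"
    by (rule sum_zeros_le_likely[OF f(1) F d \<gamma>3])
  \<comment> \<open>The class of bounded continuous functions is closed under negation, so the upper
    bound for \<open>- f\<close> supplies the missing lower bound for \<open>f\<close>.\<close>
  moreover have "\<forall>\<^sub>F n in sequentially. likely (\<gamma> / 3) (\<lambda>\<omega>.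
      (\<Sum>w\<in>#proots ((pderiv ^^ k) (poly_of_roots n (\<lambda>i. z i \<omega>))). - f w) \<le> (\<Sum>i=1..n. - f (z i \<omega>)) + d * n)"
    by (rule sum_zeros_le_likely[OF continuous_on_minus[OF f(1)] _ d \<gamma>3]) (use F in simp)
  moreover have "\<forall>\<^sub>F n in sequentially. likely (\<gamma> / 3) (\<lambda>\<omega>. \<bar>(\<Sum>i=1..n. f (z i \<omega>)) - n * (\<integral>x. f x \<partial>\<mu>)\<bar> \<le> d * n)"
    by (rule weak_law[OF f_meas F d \<gamma>3])
  ultimately show ?thesis
  proof eventually_elim
    fix n
    assume mk: "\<bar>m\<bar> * real k \<le> d * real n" and n: "2 * k + 1 \<le> n"
      and l1: "likely (\<gamma> / 3) (\<lambda>\<omega>. (\<Sum>w\<in>#proots ((pderiv ^^ k) (poly_of_roots n (\<lambda>i. z i \<omega>))). f w) \<le> (\<Sum>i=1..n. f (z i \<omega>)) + d * n)"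
      and l2: "likely (\<gamma> / 3) (\<lambda>\<omega>. (\<Sum>w\<in>#proots ((pderiv ^^ k) (poly_of_roots n (\<lambda>i. z i \<omega>))). - f w) \<le> (\<Sum>i=1..n. - f (z i \<omega>)) + d * n)"
      and l3: "likely (\<gamma> / 3) (\<lambda>\<omega>. \<bar>(\<Sum>i=1..n. f (z i \<omega>)) - n * (\<integral>x. f x \<partial>\<mu>)\<bar> \<le> d * n)"
    from likely_conj[OF likely_conj[OF l1 l2] l3] show "likely \<gamma> (\<lambda>\<omega>.
      \<bar>(\<integral>x. f x \<partial>zero_measure ((pderiv ^^ k) (poly_of_roots n (\<lambda>i. z i \<omega>)))) - (\<integral>x. f x \<partial>\<mu>)\<bar> < \<epsilon>)"
    proof (rule likely_mono)
      fix \<omega>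
      define S where "S = (pderiv ^^ k) (poly_of_roots n (\<lambda>i. z i \<omega>))"
      define Y where "Y = (\<Sum>w\<in>#proots S. f w)"
      define X where "X = (\<Sum>i=1..n. f (z i \<omega>))"
      have neg: "(\<Sum>w\<in>#A. - f w) = - (\<Sum>w\<in>#A. f w)" for A
        by (induction A) auto
      assume "((\<Sum>w\<in>#proots ((pderiv ^^ k) (poly_of_roots n (\<lambda>i. z i \<omega>))). f w) \<le> (\<Sum>i=1..n. f (z i \<omega>)) + d * n \<and>
        (\<Sum>w\<in>#proots ((pderiv ^^ k) (poly_of_roots n (\<lambda>i. z i \<omega>))). - f w) \<le> (\<Sum>i=1..n. - f (z i \<omega>)) + d * n) \<and>
        \<bar>(\<Sum>i=1..n. f (z i \<omega>)) - n * (\<integral>x. f x \<partial>\<mu>)\<bar> \<le> d * n"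
      then have "\<bar>Y - X\<bar> \<le> d * n" "\<bar>X - n * m\<bar> \<le> d * n"
        by (auto simp: Y_def X_def S_def m_def neg sum_negf)
      then have "\<bar>Y - n * m\<bar> \<le> 2 * d * n" by linarith
      moreover have "n * m = real (n - k) * m + m * k"
        using n by (simp add: of_nat_diff algebra_simps)
      moreover have "\<bar>m * k\<bar> \<le> d * n" using mk by (simp add: abs_mult)
      ultimately have "\<bar>Y - real (n - k) * m\<bar> \<le> 3 * d * n" by linarith
      also have "\<dots> \<le> 6 * d * real (n - k)"
      proof -
        have "real n \<le> 2 * real (n - k)" using n by (simp add: of_nat_diff)
        then have "3 * d * real n \<le> 3 * d * (2 * real (n - k))"
          using d by (intro mult_left_mono) auto
        then show ?thesis by simp
      qed
      also have "\<dots> < \<epsilon> * real (n - k)"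
        using \<epsilon> n by (intro mult_strict_right_mono) (auto simp: d_def)
      finally have lt: "\<bar>Y - real (n - k) * m\<bar> < \<epsilon> * real (n - k)" .
      have deg: "degree S = n - k"
        by (simp add: S_def degree_higher_pderiv)
      have "(\<integral>x. f x \<partial>zero_measure S) = Y / real (n - k)"
        unfolding Y_def deg[symmetric] by (rule integral_zero_measure) (use n in \<open>auto simp: deg\<close>)
      then have "(\<integral>x. f x \<partial>zero_measure S) - m = (Y - real (n - k) * m) / real (n - k)"
        using n by (simp add: field_simps)
      then have "\<bar>(\<integral>x. f x \<partial>zero_measure S) - m\<bar> = \<bar>Y - real (n - k) * m\<bar> / real (n - k)"
        using n by (simp add: abs_divide)
      also have "\<dots> < \<epsilon>"
        using lt n by (simp add: divide_less_eq)
      finally show "\<bar>(\<integral>x. f x \<partial>zero_measure ((pderiv ^^ k) (poly_of_roots n (\<lambda>i. z i \<omega>)))) - (\<integral>x. f x \<partial>\<mu>)\<bar> < \<epsilon>"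
        by (simp add: S_def m_def)
    qed simp
  qed
qed

text \<open>An open set is built from the generators by finite intersections, which split
  \<open>\<gamma>\<close>, and unions, where a single member containing \<open>\<nu>\<close>
  suffices. The measurable exceptional event in \<open>likely\<close> bounds the outer measure,
  whether or not the event \<open>X n \<omega> \<notin> U\<close> is measurable.\<close>

lemma tendsto_in_probability_weak:
  fixes X :: "nat \<Rightarrow> 'w \<Rightarrow> 'b :: topological_space measure"
  assumes \<nu>: "\<nu> \<in> space (prob_algebra borel)" and X: "\<And>n \<omega>. X n \<omega> \<in> space (prob_algebra borel)"
    and lim: "\<And>(f :: 'b \<Rightarrow> real) \<epsilon> \<gamma>. continuous_on UNIV f \<Longrightarrow> bounded (range f) \<Longrightarrow> 0 < \<epsilon> \<Longrightarrow> 0 < \<gamma> \<Longrightarrow>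
      \<forall>\<^sub>F n in sequentially. likely \<gamma> (\<lambda>\<omega>. \<bar>(\<integral>x. f x \<partial>X n \<omega>) - (\<integral>x. f x \<partial>\<nu>)\<bar> < \<epsilon>)"
  shows "tendsto_in_probability M weak_topology X \<nu>"
  unfolding tendsto_in_probability_def
proof (intro conjI allI impI)
  show "\<nu> \<in> topspace weak_topology"
    using \<nu> by (simp add: topspace_weak_topology space_prob_algebra)
  fix U :: "'b measure set" assume U: "openin weak_topology U \<and> \<nu> \<in> U"
  let ?S = "{{\<nu> \<in> space (prob_algebra borel). (\<integral>x. f x \<partial>\<nu>) \<in> V} | (f :: 'b \<Rightarrow> real) V.
        continuous_on UNIV f \<and> bounded (range f) \<and> open V}"
  have "generate_topology_on ?S U"
    using U unfolding weak_topology_def openin_topology_generated_by_iff by simp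
  then have likely_U: "\<nu> \<in> U \<Longrightarrow> 0 < \<gamma> \<Longrightarrow> \<forall>\<^sub>F n in sequentially. likely \<gamma> (\<lambda>\<omega>. X n \<omega> \<in> U)" for \<gamma>
  proof (induction arbitrary: \<gamma> rule: generate_topology_on.induct)
    case (Int a b)
    have "\<forall>\<^sub>F n in sequentially. likely (\<gamma> / 2) (\<lambda>\<omega>. X n \<omega> \<in> a)" "\<forall>\<^sub>F n in sequentially. likely (\<gamma> / 2) (\<lambda>\<omega>. X n \<omega> \<in> b)"
      using Int by auto
    then show ?case
    proof eventually_elim
      fix n assume "likely (\<gamma> / 2) (\<lambda>\<omega>. X n \<omega> \<in> a)" "likely (\<gamma> / 2) (\<lambda>\<omega>. X n \<omega> \<in> b)"
      from likely_conj[OF this] show "likely \<gamma> (\<lambda>\<omega>. X n \<omega> \<in> a \<inter> b)"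
        by (rule likely_mono) auto
    qed
  next
    case (UN K)
    then obtain a where a: "a \<in> K" "\<nu> \<in> a" by blast
    then have "\<forall>\<^sub>F n in sequentially. likely \<gamma> (\<lambda>\<omega>. X n \<omega> \<in> a)"
      using UN by blast
    then show ?case
      by (rule eventually_mono) (erule likely_mono[OF _ order_refl], use a in auto)
  next
    case (Basis s)
    then obtain f :: "'b \<Rightarrow> real" and V where s: "s = {\<nu> \<in> space (prob_algebra borel). (\<integral>x. f x \<partial>\<nu>) \<in> V}"
      and f: "continuous_on UNIV f" "bounded (range f)" and V: "open V"
      by blast
    have "(\<integral>x. f x \<partial>\<nu>) \<in> V" using Basis s by simp
    then obtain \<epsilon> where \<epsilon>: "0 < \<epsilon>" "\<And>y. dist y (\<integral>x. f x \<partial>\<nu>) < \<epsilon> \<Longrightarrow> y \<in> V"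
      using V unfolding open_dist by blast
    have "\<forall>\<^sub>F n in sequentially. likely \<gamma> (\<lambda>\<omega>. \<bar>(\<integral>x. f x \<partial>X n \<omega>) - (\<integral>x. f x \<partial>\<nu>)\<bar> < \<epsilon>)"
      by (rule lim[OF f \<epsilon>(1) Basis(3)])
    then show ?case
      by (rule eventually_mono) (erule likely_mono[OF _ order_refl], use s X \<epsilon>(2) in \<open>auto simp: dist_real_def\<close>)
  qed simp
  show "(\<lambda>n. outer_measure_of M {\<omega> \<in> space M. X n \<omega> \<notin> U}) \<longlonglongrightarrow> 0"
  proof (rule order_tendstoI)
    fix c :: ennreal assume "0 < c"
    \<comment> \<open>\<open>c\<close> ranges over the extended reals and may be infinite, whereas
      \<open>likely\<close> takes a real bound.\<close>
    then obtain q :: real where q: "0 < q" "ennreal q < c"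
    proof (cases c)
      case (real r)
      then have "0 < r / 2" "ennreal (r / 2) < c"
        using \<open>0 < c\<close> by (auto simp: ennreal_less_iff)
      then show ?thesis by (rule that)
    next
      case top
      then show ?thesis by (intro that[of 1]) auto
    qed
    have "\<forall>\<^sub>F n in sequentially. likely q (\<lambda>\<omega>. X n \<omega> \<in> U)"
      using likely_U U q by simp
    then show "\<forall>\<^sub>F n in sequentially. outer_measure_of M {\<omega> \<in> space M. X n \<omega> \<notin> U} < c"
    proof eventually_elim
      fix n assume "likely q (\<lambda>\<omega>. X n \<omega> \<in> U)"
      then obtain E where E: "E \<in> events" "prob E \<le> q" "\<forall>\<omega>\<in>space M - E. X n \<omega> \<in> U"
        unfolding likely_def by blast
      have "outer_measure_of M {\<omega> \<in> space M. X n \<omega> \<notin> U} \<le> outer_measure_of M E"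
        by (rule outer_measure_of_mono) (use E in auto)
      also have "\<dots> = ennreal (prob E)"
        using E by (simp add: emeasure_eq_measure)
      also have "\<dots> \<le> ennreal q"
        using E by (intro ennreal_leI)
      finally show "outer_measure_of M {\<omega> \<in> space M. X n \<omega> \<notin> U} < c"
        using q by simp
    qed
  qed simp
qed

end

theorem theorem1p1:
  fixes \<mu> :: "complex measure" and M :: "'w measure"
    and z :: "nat \<Rightarrow> 'w \<Rightarrow> complex" and P :: "nat \<Rightarrow> 'w \<Rightarrow> complex poly" and k :: nat
  assumes "prob_space \<mu>" and "sets \<mu> = sets borel"
    and "prob_space M"
    and "prob_space.indep_vars M (\<lambda>_. borel) z {1..}"
    and "\<And>i. i \<ge> 1 \<Longrightarrow> distr M borel (z i) = \<mu>"
    and "\<And>n \<omega>. P n \<omega> = (\<Prod>i=1..n. [:- z i \<omega>, 1:])"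
  shows "tendsto_in_probability M weak_topology
           (\<lambda>n \<omega>. zero_measure ((pderiv ^^ k) (P n \<omega>))) \<mu>"
proof -
  interpret M: prob_space M by fact
  interpret iid_sequence M \<mu> z
    by unfold_locales (use assms in auto)
  have P: "P n \<omega> = poly_of_roots n (\<lambda>i. z i \<omega>)" for n \<omega>
    by (simp add: assms(6) poly_of_roots_def)
  show ?thesis
  proof (rule tendsto_in_probability_weak)
    show "\<mu> \<in> space (prob_algebra borel)"
      using assms by (simp add: space_prob_algebra)
    show "zero_measure ((pderiv ^^ k) (P n \<omega>)) \<in> space (prob_algebra borel)" for n \<omega>
      by (rule zero_measure_in_prob_algebra)
    show "\<forall>\<^sub>F n in sequentially. likely \<gamma> (\<lambda>\<omega>.
        \<bar>(\<integral>x. f x \<partial>zero_measure ((pderiv ^^ k) (P n \<omega>))) - (\<integral>x. f x \<partial>\<mu>)\<bar> < \<epsilon>)"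
      if "continuous_on UNIV f" "bounded (range f)" "0 < \<epsilon>" "0 < \<gamma>" for f :: "complex \<Rightarrow> real" and \<epsilon> \<gamma>
      unfolding P using that by (rule integral_zero_measure_likely)
  qed
qed

end
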